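(* Let $\eta,\varepsilon>0$, $q\in[1,\infty]$, $\alpha\in[0,1)$ and $0\le s<q/(2q-1)$ (where $q/(2q-1)=1/2$ and $1/q=0$ if $q=\infty$) be such that $$\alpha<1-\Bigl(2-\frac1q\Bigr)s .$$ Let $\Omega$ be a bounded open set in $\mathbb{R}^k$ and suppose that $F:\Omega\times\mathbb{R}^{n-k}\to\mathbb{R}^{k\times(n-k)}$ is a locally Lipschitz map. Then there are a compact set $\mathfrak{C}\subseteq\Omega$ and a function $u:\Omega\to\mathbb{R}^{n-k}$ such that (i) $\mathrm{supp}(u)\subseteq\Omega$, $\|u\|_\infty\le\eta$ and $Du(x)=F(x,u(x))$ for $\mathscr{L}^k$-almost every $x\in\mathfrak{C}$; (ii) $\mathscr{L}^k(\Omega\setminus\mathfrak{C})\le\varepsilon\,\mathscr{L}^k(\Omega)$ and $\mathbf{1}_{\mathfrak{C}}\in W^{s,1}(\Omega)$; (iii) $u\in L^\infty(\Omega)\cap W^{1,q}(\Omega)$ and $Du\in W^{\alpha,q}(\Omega)$. In addition, if $0\le s<1/2$ then $u$ is also of class $C^1_c(\Omega)$ and the identity $Du(x)=F(x,u(x))$ holds everywhere on $\mathfrak{C}$. Finally, if $s=0$, then $u\in\bigcap_{0<\alpha<1}C^{1,\alpha}(\Omega)$.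
   Context: $\mathscr{L}^k$ is Lebesgue measure on $\mathbb{R}^k$; $1\le k<n$. For an open set $\Omega\subset\mathbb{R}^k$, $s\in(0,1)$ and $p\in[1,\infty)$, $W^{s,p}(\Omega)$ is the space of $v\in L^p(\Omega)$ (possibly vector-valued) with $[v]_{W^{s,p}(\Omega)}^p:=\int_\Omega\int_\Omega\frac{|v(x)-v(y)|^p}{|x-y|^{sp+k}}\,dx\,dy<\infty$; for $p=\infty$, $W^{s,\infty}(\Omega)=C^{s}(\Omega)$ (bounded $s$-Hölder functions). $W^{0,p}(\Omega)$ means $L^p(\Omega)$, and $W^{1,q}(\Omega)$ is the classical first-order Sobolev space with weak gradient $Du$, viewed as a $k\times(n-k)$ matrix-valued function. $C^1_c(\Omega)$ denotes $C^1$ functions with compact support in $\Omega$. *)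

theory Defs
  imports "HOL-Analysis.Analysis" "HOL-Probability.Essential_Supremum"
begin

text \<open>
  A function on an open set \<open>\<Omega>\<close> is represented by a total function of which only the
  values on \<open>\<Omega>\<close> are used. Exponents \<open>p \<in> [1, \<infinity>]\<close> have type \<^typ>\<open>ennreal\<close>.
\<close>

definition locally_lipschitz_on :: "'a::metric_space set \<Rightarrow> ('a \<Rightarrow> 'b::metric_space) \<Rightarrow> bool" where
  "locally_lipschitz_on S f \<longleftrightarrow> (\<forall>z\<in>S. \<exists>r>0. \<exists>L. L-lipschitz_on (ball z r \<inter> S) f)"

text \<open>The closure is taken in the whole space, not relative to \<open>\<Omega>\<close>.\<close>

definition supp_on :: "'a::topological_space set \<Rightarrow> ('a \<Rightarrow> 'b::zero) \<Rightarrow> 'a set" where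
  "supp_on \<Omega> f = closure {x \<in> \<Omega>. f x \<noteq> 0}"

definition Linf_norm :: "'a::euclidean_space set \<Rightarrow> ('a \<Rightarrow> 'b::euclidean_space) \<Rightarrow> ennreal" where
  "Linf_norm \<Omega> v = esssup (lebesgue_on \<Omega>) (\<lambda>x. ennreal (norm (v x)))"

definition Lp_space :: "ennreal \<Rightarrow> 'a::euclidean_space set \<Rightarrow> ('a \<Rightarrow> 'b::euclidean_space) set" where
  "Lp_space p \<Omega> = {v \<in> borel_measurable (lebesgue_on \<Omega>).
     if p = \<infinity> then Linf_norm \<Omega> v < \<infinity>
     else (\<integral>\<^sup>+x. ennreal (norm (v x) powr enn2real p) \<partial>lebesgue_on \<Omega>) < \<infinity>}"

definition holder_space :: "real \<Rightarrow> 'a::metric_space set \<Rightarrow> ('a \<Rightarrow> 'b::metric_space) set" where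
  "holder_space s \<Omega> = {v. bounded (v ` \<Omega>) \<and>
     (\<exists>C. \<forall>x\<in>\<Omega>. \<forall>y\<in>\<Omega>. dist (v x) (v y) \<le> C * dist x y powr s)}"

text \<open>
  The \<open>p\<close>-th power of the Gagliardo seminorm, for finite \<open>p\<close>. The integrand is
  \<open>0\<close> on the diagonal, since \<open>0 powr p = 0\<close>.
\<close>

definition gagliardo :: "real \<Rightarrow> real \<Rightarrow> 'a::euclidean_space set \<Rightarrow> ('a \<Rightarrow> 'b::euclidean_space) \<Rightarrow> ennreal" where
  "gagliardo s p \<Omega> v =
     (\<integral>\<^sup>+x. (\<integral>\<^sup>+y. ennreal (norm (v x - v y) powr p / norm (x - y) powr (s * p + real DIM('a)))
        \<partial>lebesgue_on \<Omega>) \<partial>lebesgue_on \<Omega>)"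

text \<open>
  \<open>W\<^sup>s\<^sup>,\<^sup>p(\<Omega>)\<close> for \<open>s \<in> [0, 1)\<close>. For \<open>p = \<infinity>\<close> and \<open>s > 0\<close> membership is a condition on the
  function itself, not on its class modulo null sets.
\<close>

definition frac_sobolev :: "real \<Rightarrow> ennreal \<Rightarrow> 'a::euclidean_space set \<Rightarrow> ('a \<Rightarrow> 'b::euclidean_space) set" where
  "frac_sobolev s p \<Omega> =
     (if s = 0 then Lp_space p \<Omega>
      else if p = \<infinity> then holder_space s \<Omega>
      else {v \<in> Lp_space p \<Omega>. gagliardo s (enn2real p) \<Omega> v < \<infinity>})"

definition C1_on :: "'a::real_normed_vector set \<Rightarrow> ('a \<Rightarrow> 'b::real_normed_vector) set" where
  "C1_on \<Omega> = {f. \<exists>f'::'a \<Rightarrow> 'a \<Rightarrow>\<^sub>L 'b.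
     (\<forall>x\<in>\<Omega>. (f has_derivative blinfun_apply (f' x)) (at x)) \<and> continuous_on \<Omega> f'}"

definition C1c_on :: "'a::real_normed_vector set \<Rightarrow> ('a \<Rightarrow> 'b::real_normed_vector) set" where
  "C1c_on \<Omega> = {f \<in> C1_on \<Omega>. compact (supp_on \<Omega> f) \<and> supp_on \<Omega> f \<subseteq> \<Omega>}"

definition C1_holder :: "real \<Rightarrow> 'a::real_normed_vector set \<Rightarrow> ('a \<Rightarrow> 'b::real_normed_vector) set" where
  "C1_holder a \<Omega> = {f. bounded (f ` \<Omega>) \<and> (\<exists>f'::'a \<Rightarrow> 'a \<Rightarrow>\<^sub>L 'b.
     (\<forall>x\<in>\<Omega>. (f has_derivative blinfun_apply (f' x)) (at x)) \<and> f' \<in> holder_space a \<Omega>)}"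

text \<open>
  Gradients of maps \<open>\<real>\<^sup>k \<rightarrow> \<real>\<^sup>m\<close> are \<open>k \<times> m\<close> matrices: the entry at \<open>(i, j)\<close> is the
  \<open>i\<close>-th partial derivative of the \<open>j\<close>-th component (the transpose of the Jacobian matrix), so
  that the derivative in direction \<open>h\<close> is the row vector \<open>h v* Du\<close>.
\<close>

definition has_gradient :: "(real^'k \<Rightarrow> real^'m) \<Rightarrow> real^'m^'k \<Rightarrow> real^'k \<Rightarrow> bool" where
  "has_gradient u D x \<longleftrightarrow> (u has_derivative (\<lambda>h. h v* D)) (at x)"

definition locally_integrable_on :: "'a::euclidean_space set \<Rightarrow> ('a \<Rightarrow> 'b::euclidean_space) \<Rightarrow> bool" where
  "locally_integrable_on \<Omega> v \<longleftrightarrow> (\<forall>K. compact K \<and> K \<subseteq> \<Omega> \<longrightarrow> set_integrable lebesgue K v)"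

text \<open>A weak gradient is determined only up to a null set, hence a relation. Test functions are \<open>C\<^sup>1\<^sub>c\<close>.\<close>

definition weak_gradient :: "(real^'k) set \<Rightarrow> (real^'k \<Rightarrow> real^'m) \<Rightarrow> (real^'k \<Rightarrow> real^'m^'k) \<Rightarrow> bool" where
  "weak_gradient \<Omega> u G \<longleftrightarrow>
     locally_integrable_on \<Omega> u \<and> locally_integrable_on \<Omega> G \<and>
     (\<forall>\<phi>\<in>(C1c_on \<Omega> :: (real^'k \<Rightarrow> real) set). \<forall>i j.
        (LINT x:\<Omega>|lebesgue. u x $ j * frechet_derivative \<phi> (at x) (axis i 1)) =
        - (LINT x:\<Omega>|lebesgue. G x $ i $ j * \<phi> x))"

definition sobolev1 :: "ennreal \<Rightarrow> (real^'k) set \<Rightarrow> (real^'k \<Rightarrow> real^'m) set" where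
  "sobolev1 q \<Omega> = {u \<in> Lp_space q \<Omega>. \<exists>G\<in>Lp_space q \<Omega>. weak_gradient \<Omega> u G}"

end

theory Submission
  imports Defs
begin

text \<open>
  The map is the sum of a series of corrections carried by dyadic cubes, in the spirit of Alberti's
  Lusin type theorem for gradients. At generation \<open>n\<close> the space is cut into cubes of side
  \<open>d n = \<delta> / 2^n\<close>. Along the chain of cubes that contain a point one follows a chain of affine maps:
  the affine map of a cube with centre \<open>c\<close> agrees at \<open>c\<close> with the affine map of the parent cube, and its slope
  is the value of \<open>F\<close> at \<open>c\<close> and at this common value. The points at which \<open>F\<close> is evaluated in two successive
  generations are at distance of order \<open>d n\<close>, so the slopes differ by a multiple \<open>A * d n\<close> of the side. The
  correction \<open>w n\<close> is the difference of the two affine maps, cut off in a gap of relative width \<open>t n\<close>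
  along the faces of the cubes. At a point that avoids all gaps, the partial sums have the slopes
  \<open>F (c, b)\<close> of its cubes, and these converge to \<open>F (x, u x)\<close> because \<open>F\<close> is Lipschitz (lemma
  \<open>f_sums_on_\<CC>\<close>). The compact set \<open>\<CC>\<close> consists of the points of this kind in those cubes of side \<open>\<delta>\<close> on which the construction is carried out.

  The gaps control the regularity. The gradient \<open>f n\<close> of \<open>w n\<close> is bounded by a multiple of \<open>d n\<close> off the gaps
  and of \<open>d n / t n\<close> in the gaps, it varies at scale \<open>t n * d n\<close>, and the gaps have measure of order \<open>t n\<close>.
  Hence the local \<open>\<beta>\<close>-Hoelder constant of \<open>f n\<close> has \<open>L\<^sup>q\<close> norm of order
  \<open>d n * (t n * d n) powr (-\<beta>) * t n powr (1/q - 1)\<close>; this is \<open>rate \<beta> (1/q) n\<close>, up to a constant, with \<open>1/q\<close>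
  read as \<open>0\<close> for \<open>q = \<infinity>\<close>. On the other side, the gaps of generation \<open>n\<close> form about \<open>1 / d n\<close> slabs of thickness
  \<open>t n * d n\<close>, so that they contribute \<open>(t n * d n) powr (1 - \<sigma>) / d n\<close> to the \<open>W\<^sup>\<sigma>\<^sup>,\<^sup>1\<close> seminorm of the indicator of
  \<open>\<CC>\<close>. This is summable for \<open>t n\<close> of order \<open>2 powr (- n * \<sigma> / (1 - \<sigma>))\<close>, up to a power of \<open>n\<close>, and with this choice
  the rate decays geometrically if and only if \<open>\<beta> < 1 - (2 - 1/q) * \<sigma>\<close> (lemma \<open>rate_le_geometric\<close>). The hypothesis on \<open>\<alpha>\<close>
  and \<open>s\<close> leaves room for \<open>\<beta> > \<alpha>\<close> and, if \<open>s > 0\<close>, for \<open>\<sigma> > s\<close>. For \<open>s = 0\<close> one takes \<open>\<sigma> = 0\<close>: the widths then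
  decay only like a power of \<open>n\<close>, and every Hoelder exponent below \<open>1\<close> is reached by the same map.

  The gain from \<open>\<alpha>\<close> to \<open>\<beta>\<close> and from \<open>s\<close> to \<open>\<sigma>\<close> makes the double integrals harmless: a bound
  \<open>|f x - f y|\<^sup>p \<le> |x - y|\<^bsup>\<beta>p\<^esup> (\<Phi> x + \<Phi> y)\<close> with integrable \<open>\<Phi>\<close> is enough for a seminorm of any smaller order
  (lemma \<open>gagliardo_finite\<close>). It is applied to the gradient, through \<open>fractional_series\<close>, and to the
  indicator, where \<open>\<Phi>\<close> is a negative power of the distance to the edge of the gap. The weak gradient of
  the sum comes from integrating each \<open>C\<^sup>1\<close> correction by parts (lemma \<open>weak_gradient_series\<close>). If
  \<open>\<sigma> < 1/2\<close>, then \<open>\<beta> < 1 - 2 * \<sigma>\<close> is possible with \<open>q = \<infinity>\<close>, and the gradients converge uniformly (lemma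
  \<open>holder_gradient\<close>).
\<close>

section \<open>Norms of matrix products\<close>

lemma norm_vector_matrix_mult_le:
  fixes D :: "real^'m^'k"
  shows "norm (h v* D) \<le> norm h * norm D"
proof -
  have "h v* D = (\<Sum>i\<in>UNIV. h $ i *\<^sub>R D $ i)"
    by (simp add: vec_eq_iff vector_matrix_mult_def mult.commute)
  also have "norm \<dots> \<le> (\<Sum>i\<in>UNIV. \<bar>h $ i\<bar> * \<bar>norm (D $ i)\<bar>)"
    by (rule order_trans[OF norm_sum]) simp
  also have "\<dots> \<le> L2_set (\<lambda>i. h $ i) UNIV * L2_set (\<lambda>i. norm (D $ i)) UNIV"
    by (rule L2_set_mult_ineq)
  also have "\<dots> = norm h * norm D"
    by (simp add: norm_vec_def L2_set_def)
  finally show ?thesis .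
qed

lemma norm_matrix_mult_le:
  fixes A :: "real^'l^'k" and B :: "real^'m^'l"
  shows "norm (A ** B) \<le> norm A * norm B"
proof -
  have row: "(A ** B) $ i = (A $ i) v* B" for i
    by (simp add: vec_eq_iff vector_matrix_mult_def matrix_matrix_mult_def mult.commute)
  have "norm (A ** B) = L2_set (\<lambda>i. norm ((A $ i) v* B)) UNIV"
    by (simp add: norm_vec_def[of "A ** B"] row)
  also have "\<dots> \<le> L2_set (\<lambda>i. norm (A $ i) * norm B) UNIV"
    by (intro L2_set_mono norm_vector_matrix_mult_le) auto
  also have "\<dots> = norm A * norm B"
    by (simp add: norm_vec_def[of A] L2_set_left_distrib)
  finally show ?thesis .
qed

lemma norm_le_card_times:
  fixes x :: "real^'k"
  assumes "\<And>i. \<bar>x $ i\<bar> \<le> e"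
  shows "norm x \<le> real CARD('k) * e"
proof -
  have "norm x \<le> (\<Sum>i\<in>UNIV. \<bar>x $ i\<bar>)" by (rule norm_le_l1_cart)
  also have "\<dots> \<le> (\<Sum>i\<in>(UNIV :: 'k set). e)" by (rule sum_mono) (rule assms)
  finally show ?thesis by simp
qed

lemma norm_le_entries:
  fixes M :: "real^'m^'k"
  assumes "\<And>i j. \<bar>M $ i $ j\<bar> \<le> c"
  shows "norm M \<le> real CARD('k) * (real CARD('m) * c)"
proof -
  have "norm (M $ i) \<le> real CARD('m) * c" for i
    by (rule norm_le_card_times) (rule assms)
  then have "L2_set (\<lambda>i. norm (M $ i)) UNIV \<le> real CARD('k) * (real CARD('m) * c)"
    by (intro order_trans[OF L2_set_le_sum] sum_bounded_above[of UNIV, simplified]) auto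
  then show ?thesis by (simp add: norm_vec_def[of M])
qed

section \<open>A cut-off identity map on a cube\<close>

text \<open>
  A quadratic spline that rises from \<open>0\<close> to \<open>1\<close> on the unit interval; \<open>dramp\<close> is its derivative, which
  is Lipschitz. Writing it with positive parts gives both functions by a single formula on the whole line.
\<close>

definition ramp :: "real \<Rightarrow> real" where
  "ramp y = 2 * ((max 0 y)\<^sup>2 - 2 * (max 0 (y - 1/2))\<^sup>2 + (max 0 (y - 1))\<^sup>2)"

definition dramp :: "real \<Rightarrow> real" where
  "dramp y = 4 * (max 0 y - 2 * max 0 (y - 1/2) + max 0 (y - 1))"

lemma DERIV_pos_part_square: "((\<lambda>y::real. (max 0 y)\<^sup>2) has_real_derivative 2 * max 0 y) (at y)"
proof (cases "y = 0")
  case True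
  have "((\<lambda>h. (max 0 (0 + h))\<^sup>2 / h) \<longlongrightarrow> (0::real)) (at 0)"
  proof (rule Lim_null_comparison[where g = "\<lambda>h. \<bar>h\<bar>"])
    show "\<forall>\<^sub>F h in at 0. norm ((max 0 (0 + h))\<^sup>2 / h) \<le> \<bar>h::real\<bar>"
      by (auto simp: eventually_at_filter max_def power2_eq_square)
    show "((\<lambda>h::real. \<bar>h\<bar>) \<longlongrightarrow> 0) (at 0)"
      by (auto intro!: tendsto_eq_intros)
  qed
  then show ?thesis using True by (simp add: DERIV_def)
next
  case False
  show ?thesis
  proof (cases "y > 0")
    case True
    have "((\<lambda>y::real. y\<^sup>2) has_real_derivative 2 * y) (at y)"
      by (auto intro!: derivative_eq_intros)
    then have "((\<lambda>y::real. (max 0 y)\<^sup>2) has_real_derivative 2 * y) (at y)"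
      by (rule has_field_derivative_transform_within_open[where S = "{0<..}"]) (use True in auto)
    with True show ?thesis by simp
  next
    case False2: False
    have "((\<lambda>y::real. 0) has_real_derivative 0) (at y)" by simp
    then have "((\<lambda>y::real. (max 0 y)\<^sup>2) has_real_derivative 0) (at y)"
      by (rule has_field_derivative_transform_within_open[where S = "{..<0}"])
        (use False False2 in \<open>auto simp: max_def\<close>)
    with False False2 show ?thesis by simp
  qed
qed

lemma DERIV_ramp: "(ramp has_real_derivative dramp y) (at y)"
proof -
  have shift: "((\<lambda>y::real. (max 0 (y - c))\<^sup>2) has_real_derivative 2 * max 0 (y - c)) (at y)" for c
    using DERIV_shift[of "\<lambda>y. (max 0 y)\<^sup>2" "2 * max 0 (y - c)" y "- c"] DERIV_pos_part_square[of "y - c"]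
    by simp
  have "((\<lambda>y. 2 * ((max 0 y)\<^sup>2 - 2 * (max 0 (y - 1/2))\<^sup>2 + (max 0 (y - 1))\<^sup>2)) has_real_derivative
      2 * (2 * max 0 y - 2 * (2 * max 0 (y - 1/2)) + 2 * max 0 (y - 1))) (at y)"
    by (intro DERIV_cmult DERIV_add DERIV_diff DERIV_pos_part_square shift)
  then show ?thesis
    unfolding ramp_def[abs_def] dramp_def by (simp add: algebra_simps)
qed

lemma ramp_bounds: "0 \<le> ramp y" "ramp y \<le> 1"
proof -
  consider "y \<le> 0" | "0 \<le> y" "y \<le> 1/2" | "1/2 \<le> y" "y \<le> 1" | "1 \<le> y" by linarith
  then have "0 \<le> ramp y \<and> ramp y \<le> 1"
  proof cases
    case 1 then show ?thesis by (simp add: ramp_def)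
  next
    case 2
    then have "y\<^sup>2 \<le> (1/2)\<^sup>2" by (intro power_mono) auto
    then show ?thesis using 2 by (simp add: ramp_def power2_eq_square)
  next
    case 3
    then have "ramp y = 1 - 2 * (1 - y)\<^sup>2" by (simp add: ramp_def power2_eq_square algebra_simps)
    moreover have "(1 - y)\<^sup>2 \<le> (1/2)\<^sup>2" using 3 by (intro power_mono) auto
    ultimately show ?thesis by (simp add: power2_eq_square)
  next
    case 4 then show ?thesis by (simp add: ramp_def power2_eq_square algebra_simps)
  qed
  then show "0 \<le> ramp y" "ramp y \<le> 1" by auto
qed

lemma ramp_outside:
  "y \<le> 0 \<Longrightarrow> ramp y = 0" "y \<ge> 1 \<Longrightarrow> ramp y = 1"
  "y \<le> 0 \<Longrightarrow> dramp y = 0" "y \<ge> 1 \<Longrightarrow> dramp y = 0"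
  by (simp_all add: ramp_def dramp_def power2_eq_square algebra_simps)

lemma dramp_bounds: "\<bar>dramp y\<bar> \<le> 2" "\<bar>dramp y - dramp z\<bar> \<le> 16 * \<bar>y - z\<bar>"
  unfolding dramp_def by (auto simp: max_def abs_if)

text \<open>
  A bump that is \<open>1\<close> for \<open>|z| \<le> 1/2 - t\<close> and \<open>0\<close> for \<open>|z| \<ge> 1/2 - t/2\<close>. At every \<open>z\<close> one of the two ramps equals
  \<open>1\<close>, so their sum minus \<open>1\<close> is the bump, and no product has to be differentiated.
\<close>

definition plateau :: "real \<Rightarrow> real \<Rightarrow> real" where
  "plateau t z = ramp (2 * (1/2 - z) / t - 1) + ramp (2 * (1/2 + z) / t - 1) - 1"

definition dplateau :: "real \<Rightarrow> real \<Rightarrow> real" where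
  "dplateau t z = (2 / t) * (dramp (2 * (1/2 + z) / t - 1) - dramp (2 * (1/2 - z) / t - 1))"

lemma DERIV_plateau: "(plateau t has_real_derivative dplateau t z) (at z)" 
proof -
  have 1: "((\<lambda>z. ramp (2 * (1/2 - z) / t - 1)) has_real_derivative
      dramp (2 * (1/2 - z) / t - 1) * (- (2 / t))) (at z)"
    by (rule DERIV_chain'[OF _ DERIV_ramp, of "\<lambda>z. 2 * (1/2 - z) / t - 1"])
      (cases "t = 0", auto intro!: derivative_eq_intros simp: field_simps)
  have 2: "((\<lambda>z. ramp (2 * (1/2 + z) / t - 1)) has_real_derivative
      dramp (2 * (1/2 + z) / t - 1) * (2 / t)) (at z)"
    by (rule DERIV_chain'[OF _ DERIV_ramp, of "\<lambda>z. 2 * (1/2 + z) / t - 1"])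
      (cases "t = 0", auto intro!: derivative_eq_intros simp: field_simps)
  show ?thesis
    unfolding plateau_def[abs_def] dplateau_def
    by (rule derivative_eq_intros 1 2 refl)+ (simp add: algebra_simps)
qed

context
  fixes t :: real
  assumes t: "0 < t" "t \<le> 1/2"
begin

lemma plateau_inside:
  assumes "\<bar>z\<bar> \<le> 1/2 - t"
  shows "plateau t z = 1" "dplateau t z = 0"
proof -
  have "2 * (1/2 - z) / t - 1 \<ge> 1" "2 * (1/2 + z) / t - 1 \<ge> 1"
    using assms t by (auto simp: field_simps)
  then show "plateau t z = 1" "dplateau t z = 0"
    by (simp_all add: plateau_def dplateau_def ramp_outside)
qed

lemma plateau_outside:
  assumes "1/2 - t/2 \<le> \<bar>z\<bar>"
  shows "plateau t z = 0" "dplateau t z = 0"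
proof -
  have "(2 * (1/2 - z) / t - 1 \<le> 0 \<and> 2 * (1/2 + z) / t - 1 \<ge> 1) \<or>
        (2 * (1/2 - z) / t - 1 \<ge> 1 \<and> 2 * (1/2 + z) / t - 1 \<le> 0)"
    using assms t by (cases "z \<ge> 0") (auto simp: field_simps)
  then show "plateau t z = 0" "dplateau t z = 0"
    by (auto simp: plateau_def dplateau_def ramp_outside)
qed

lemma plateau_bounds: "\<bar>plateau t z\<bar> \<le> 1"
proof -
  have "2 * (1/2 - z) / t - 1 \<ge> 1 \<or> 2 * (1/2 + z) / t - 1 \<ge> 1"
    using t by (cases "z \<ge> 0") (auto simp: field_simps)
  then show ?thesis
    using ramp_bounds[of "2 * (1/2 - z) / t - 1"] ramp_bounds[of "2 * (1/2 + z) / t - 1"]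
    by (auto simp: plateau_def ramp_outside)
qed

lemma dplateau_bound: "\<bar>dplateau t z\<bar> \<le> 8 / t"
proof -
  have "\<bar>dramp (2 * (1/2 + z) / t - 1) - dramp (2 * (1/2 - z) / t - 1)\<bar> \<le> 4"
    using dramp_bounds(1)[of "2 * (1/2 - z) / t - 1"] dramp_bounds(1)[of "2 * (1/2 + z) / t - 1"]
    by linarith
  then have "\<bar>dplateau t z\<bar> \<le> (2 / t) * 4"
    unfolding dplateau_def abs_mult using t by (intro mult_mono) auto
  then show ?thesis by simp
qed

lemma dplateau_lipschitz: "\<bar>dplateau t y - dplateau t z\<bar> \<le> 128 / t\<^sup>2 * \<bar>y - z\<bar>"
proof -
  have e: "\<bar>2 * (1/2 + y) / t - 1 - (2 * (1/2 + z) / t - 1)\<bar> = 2 / t * \<bar>y - z\<bar>"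
          "\<bar>2 * (1/2 - y) / t - 1 - (2 * (1/2 - z) / t - 1)\<bar> = 2 / t * \<bar>y - z\<bar>"
    using t by (auto simp: field_simps abs_if)
  have "\<bar>dramp (2 * (1/2 + y) / t - 1) - dramp (2 * (1/2 - y) / t - 1)
      - (dramp (2 * (1/2 + z) / t - 1) - dramp (2 * (1/2 - z) / t - 1))\<bar> \<le> 64 / t * \<bar>y - z\<bar>"
    using dramp_bounds(2)[of "2 * (1/2 - y) / t - 1" "2 * (1/2 - z) / t - 1"]
      dramp_bounds(2)[of "2 * (1/2 + y) / t - 1" "2 * (1/2 + z) / t - 1"]
    unfolding e by linarith
  then have "(2 / t) * \<bar>dramp (2 * (1/2 + y) / t - 1) - dramp (2 * (1/2 - y) / t - 1)
      - (dramp (2 * (1/2 + z) / t - 1) - dramp (2 * (1/2 - z) / t - 1))\<bar> \<le> (2 / t) * (64 / t * \<bar>y - z\<bar>)"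
    using t by (intro mult_left_mono) auto
  also have "\<dots> = 128 / t\<^sup>2 * \<bar>y - z\<bar>" by (simp add: power2_eq_square)
  finally show ?thesis
    unfolding dplateau_def right_diff_distrib[symmetric] abs_mult using t by simp
qed

lemma plateau_lipschitz: "\<bar>plateau t y - plateau t z\<bar> \<le> 8 / t * \<bar>y - z\<bar>"
  using field_differentiable_bound[of UNIV "plateau t" "dplateau t" "8 / t" y z]
    DERIV_plateau dplateau_bound by auto

end

text \<open>
  In the entries of \<open>dprof\<close> the factor \<open>z $ j\<close> is unbounded, but it is multiplied by a function that vanishes
  outside the unit cube; there it may be replaced by its clipped value, which is bounded and
  Lipschitz.
\<close>

definition clip :: "real \<Rightarrow> real" where
  "clip r = max (-1) (min 1 r)"

text \<open>
  The map \<open>prof t\<close> is the identity on the cube of half side \<open>1/2 - t\<close> and vanishes outside the cube of half side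
  \<open>1/2 - t/2\<close>, both centred at \<open>0\<close>; \<open>dprof t\<close> is its gradient. It is used to cut off linear maps: for a matrix \<open>a\<close> the map
  \<open>prof t z v* a\<close> is linear of slope \<open>a\<close> on the smaller cube, and it has gradient \<open>dprof t z ** a\<close>.
\<close>

definition cube_bump :: "real \<Rightarrow> real^'k \<Rightarrow> real" where
  "cube_bump t z = (\<Prod>i\<in>UNIV. plateau t (z $ i))"

definition prof :: "real \<Rightarrow> real^'k \<Rightarrow> real^'k" where
  "prof t z = cube_bump t z *\<^sub>R z"

definition dprof :: "real \<Rightarrow> real^'k \<Rightarrow> real^'k^'k" where
  "dprof t z = (\<chi> i j. (if i = j then cube_bump t z else 0) +
      dplateau t (z $ i) * (\<Prod>l\<in>UNIV - {i}. plateau t (z $ l)) * z $ j)"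

lemma prof_has_derivative:
  fixes z :: "real^'k"
  shows "(prof t has_derivative (\<lambda>h. h v* dprof t z)) (at z)"
proof -
  have d: "(plateau t has_derivative (\<lambda>r. r * dplateau t (z $ i))) (at (z $ i))" for i
    using DERIV_plateau[of t "z $ i"] by (simp add: has_field_derivative_def mult_commute_abs)
  have p: "((\<lambda>z::real^'k. plateau t (z $ i)) has_derivative (\<lambda>h. h $ i * dplateau t (z $ i))) (at z)" for i
    using has_derivative_compose[of "\<lambda>z. z $ i" "\<lambda>h. h $ i" z UNIV "plateau t" "\<lambda>r. r * dplateau t (z $ i)"]
      d[of i] by (simp add: bounded_linear_imp_has_derivative bounded_linear_vec_nth)
  have "((\<lambda>z. cube_bump t z *\<^sub>R z) has_derivative
     (\<lambda>h. cube_bump t z *\<^sub>R h + (\<Sum>i\<in>UNIV. (h $ i * dplateau t (z $ i)) * (\<Prod>l\<in>UNIV - {i}. plateau t (z $ l))) *\<^sub>R z)) (at z)"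
    unfolding cube_bump_def
    by (rule has_derivative_scaleR has_derivative_prod p has_derivative_ident)+
  moreover have "cube_bump t z *\<^sub>R h + (\<Sum>i\<in>UNIV. (h $ i * dplateau t (z $ i)) * (\<Prod>l\<in>UNIV - {i}. plateau t (z $ l))) *\<^sub>R z
     = h v* dprof t z" for h :: "real^'k"
  proof (rule vec_eq_iff[THEN iffD2], rule allI)
    fix j
    have "(\<Sum>i\<in>UNIV. (if i = j then cube_bump t z else 0) * h $ i) = cube_bump t z * h $ j"
      by (simp add: if_distrib[of "\<lambda>c. c * _"] cong: if_cong)
    then show "(cube_bump t z *\<^sub>R h + (\<Sum>i\<in>UNIV. (h $ i * dplateau t (z $ i)) * (\<Prod>l\<in>UNIV - {i}. plateau t (z $ l))) *\<^sub>R z) $ j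
     = (h v* dprof t z) $ j"
      by (simp add: vector_matrix_mult_def dprof_def algebra_simps sum.distrib sum_distrib_left)
  qed
  ultimately show ?thesis unfolding prof_def[abs_def] by simp
qed

context
  fixes t :: real
  assumes t: "0 < t" "t \<le> 1/2"
begin

lemma prof_inside:
  assumes "\<And>i. \<bar>z $ i\<bar> \<le> 1/2 - t"
  shows "prof t z = z" "dprof t z = mat 1"
proof -
  have "cube_bump t z = 1" using plateau_inside[OF t assms] by (simp add: cube_bump_def)
  then show "prof t z = z" "dprof t z = mat 1"
    using plateau_inside[OF t assms] by (auto simp: prof_def dprof_def mat_def vec_eq_iff)
qed

lemma prof_outside:
  assumes "1/2 - t/2 \<le> \<bar>z $ i\<bar>"
  shows "prof t z = 0" "dprof t z = 0"
proof -
  note o = plateau_outside[OF t assms]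
  have B: "cube_bump t z = 0"
    unfolding cube_bump_def using o(1) by (intro prod_zero) auto
  have "dplateau t (z $ l) * (\<Prod>l\<in>UNIV - {l}. plateau t (z $ l)) = 0" for l
  proof (cases "l = i")
    case False
    then have "(\<Prod>l\<in>UNIV - {l}. plateau t (z $ l)) = 0" using o(1) by (intro prod_zero) auto
    then show ?thesis by simp
  qed (simp add: o)
  then show "prof t z = 0" "dprof t z = 0"
    using B by (simp_all add: prof_def dprof_def vec_eq_iff)
qed

lemma cube_bump_le: "\<bar>\<Prod>l\<in>I. plateau t (z $ l)\<bar> \<le> 1"
  unfolding abs_prod using plateau_bounds[OF t] by (intro prod_le_1) auto

lemma prod_plateau_lipschitz:
  fixes y z :: "real^'k"
  shows "\<bar>(\<Prod>l\<in>I. plateau t (y $ l)) - (\<Prod>l\<in>I. plateau t (z $ l))\<bar> \<le> real CARD('k) * (8 / t) * norm (y - z)"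
proof -
  have "\<bar>(\<Prod>l\<in>I. plateau t (y $ l)) - (\<Prod>l\<in>I. plateau t (z $ l))\<bar>
      \<le> (\<Sum>l\<in>I. \<bar>plateau t (y $ l) - plateau t (z $ l)\<bar>)"
    using norm_prod_diff[of I "\<lambda>l. plateau t (y $ l)" "\<lambda>l. plateau t (z $ l)"] plateau_bounds[OF t]
    by simp
  also have "\<dots> \<le> (\<Sum>l\<in>I. 8 / t * norm (y - z))"
  proof (rule sum_mono)
    fix l
    have "\<bar>y $ l - z $ l\<bar> \<le> norm (y - z)"
      using component_le_norm_cart[of "y - z" l] by simp
    then show "\<bar>plateau t (y $ l) - plateau t (z $ l)\<bar> \<le> 8 / t * norm (y - z)"
      using t by (intro order_trans[OF plateau_lipschitz[OF t]] mult_left_mono) auto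
  qed
  also have "\<dots> \<le> real CARD('k) * (8 / t * norm (y - z))"
    using t by (simp only: sum_constant, intro mult_right_mono) (auto simp: card_mono)
  finally show ?thesis by simp
qed

lemma dprof_entry:
  fixes z :: "real^'k"
  shows "dprof t z $ i $ j = (if i = j then cube_bump t z else 0) +
      dplateau t (z $ i) * (\<Prod>l\<in>UNIV - {i}. plateau t (z $ l)) * clip (z $ j)"
proof (cases "\<bar>z $ j\<bar> \<le> 1/2")
  case True
  then have "clip (z $ j) = z $ j" by (simp add: clip_def)
  then show ?thesis by (simp add: dprof_def)
next
  case False
  then have "1/2 - t/2 \<le> \<bar>z $ j\<bar>" using t by simp
  note o = plateau_outside[OF t this]
  have "dplateau t (z $ i) * (\<Prod>l\<in>UNIV - {i}. plateau t (z $ l)) = 0"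
  proof (cases "i = j")
    case False
    then have "(\<Prod>l\<in>UNIV - {i}. plateau t (z $ l)) = 0" using o(1) by (intro prod_zero) auto
    then show ?thesis by simp
  qed (simp add: o)
  then show ?thesis by (simp add: dprof_def)
qed

end

lemma abs_mult_diff_le:
  fixes a b a' b' :: real
  assumes "\<bar>a\<bar> \<le> A" "\<bar>b'\<bar> \<le> B" "\<bar>a - a'\<bar> \<le> d" "\<bar>b - b'\<bar> \<le> e"
  shows "\<bar>a * b - a' * b'\<bar> \<le> A * e + B * d"
proof -
  have "a * b - a' * b' = a * (b - b') + b' * (a - a')" by (simp add: algebra_simps)
  also have "\<bar>\<dots>\<bar> \<le> \<bar>a\<bar> * \<bar>b - b'\<bar> + \<bar>b'\<bar> * \<bar>a - a'\<bar>"
    by (rule order_trans[OF abs_triangle_ineq]) (simp add: abs_mult)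
  also have "\<dots> \<le> A * e + B * d" using assms by (intro add_mono mult_mono) auto
  finally show ?thesis .
qed

text \<open>
  Each derivative costs a factor \<open>1 / t\<close>, with a constant that depends on the dimension only. All bounds
  come from the entries of \<open>dprof\<close>, which are sums of products of bounded Lipschitz functions.
\<close>

lemma profile_bounds:
  obtains C :: real where "C \<ge> 1"
    "\<And>t z. 0 < t \<Longrightarrow> t \<le> 1/2 \<Longrightarrow> norm (prof t (z::real^'k)) \<le> C"
    "\<And>t z. 0 < t \<Longrightarrow> t \<le> 1/2 \<Longrightarrow> norm (dprof t (z::real^'k)) \<le> C / t"
    "\<And>t y z. 0 < t \<Longrightarrow> t \<le> 1/2 \<Longrightarrow> norm (dprof t (y::real^'k) - dprof t z) \<le> C / t\<^sup>2 * norm (y - z)"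
proof
  define k where "k = real CARD('k)"
  have k: "k \<ge> 1" by (simp add: k_def Suc_le_eq)
  define C where "C = k * (k * (k * 8 + (8 + (64 * k + 128))))"
  have kk: "k * k \<ge> k" using k by simp
  have C9: "C \<ge> k * (k * 9)" unfolding C_def using k by (intro mult_left_mono) auto
  then show C1: "C \<ge> 1" using k kk by linarith
  fix t :: real and y z :: "real^'k" assume t: "0 < t" "t \<le> 1/2"
  have t2: "1 / t \<le> 1 / t\<^sup>2" "1 \<le> 1 / t"
    using t by (auto simp: power2_eq_square field_simps)
  have clip1: "\<bar>clip r\<bar> \<le> 1 \<and> \<bar>clip r - clip r'\<bar> \<le> \<bar>r - r'\<bar>" for r r'
    by (auto simp: clip_def)
  note clip1 = clip1[THEN conjunct1] clip1[THEN conjunct2]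
  show "norm (prof t z) \<le> C"
  proof (cases "\<exists>i. 1/2 - t/2 \<le> \<bar>z $ i\<bar>")
    case True
    then obtain i where "1/2 - t/2 \<le> \<bar>z $ i\<bar>" by blast
    then show ?thesis using prof_outside(1)[OF t, of z i] C1 by simp
  next
    case False
    then have "\<bar>z $ i\<bar> \<le> 1" for i using t by (simp add: not_le less_imp_le order_trans[of _ "1/2 - t/2"])
    then have "norm z \<le> k * 1"
      unfolding k_def by (intro order_trans[OF norm_le_l1_cart] sum_bounded_above[of UNIV, simplified]) auto
    moreover have "norm (prof t z) \<le> 1 * norm z"
      unfolding prof_def norm_scaleR using cube_bump_le[OF t, of z UNIV]
      by (intro mult_right_mono) (auto simp: cube_bump_def)
    ultimately show ?thesis using C9 kk k by linarith
  qed
  have entry: "\<bar>dprof t z $ i $ j\<bar> \<le> 9 / t" for i j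
  proof -
    have "\<bar>dplateau t (z $ i) * (\<Prod>l\<in>UNIV - {i}. plateau t (z $ l)) * clip (z $ j)\<bar> \<le> (8 / t) * 1 * 1"
      unfolding abs_mult using t
      by (intro mult_mono dplateau_bound cube_bump_le clip1) auto
    moreover have "\<bar>if i = j then cube_bump t z else 0\<bar> \<le> 1"
      using cube_bump_le[OF t, of z UNIV] by (auto simp: cube_bump_def)
    moreover have "9 / t = 8 / t + 1 / t" by (simp add: add_divide_distrib[symmetric])
    ultimately show ?thesis unfolding dprof_entry[OF t] using t2(2) by linarith
  qed
  show "norm (dprof t z) \<le> C / t"
  proof -
    have "norm (dprof t z) \<le> k * (k * (9 / t))"
      unfolding k_def by (rule norm_le_entries[OF entry])
    also have "\<dots> = (k * (k * 9)) / t" by simp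
    also have "\<dots> \<le> C / t" using C9 t by (intro divide_right_mono) auto
    finally show ?thesis .
  qed
  have dent: "\<bar>(dprof t y - dprof t z) $ i $ j\<bar> \<le> (k * 8 + (8 + (64 * k + 128))) / t\<^sup>2 * norm (y - z)" for i j
  proof -
    define n where "n = norm (y - z)"
    have n: "n \<ge> 0" "\<bar>y $ l - z $ l\<bar> \<le> n" for l
      using component_le_norm_cart[of "y - z" l] by (auto simp: n_def)
    have 1: "\<bar>(if i = j then cube_bump t y else 0) - (if i = j then cube_bump t z else 0)\<bar> \<le> k * 8 / t\<^sup>2 * n"
    proof -
      have "\<bar>cube_bump t y - cube_bump t z\<bar> \<le> k * 8 * (1 / t) * n"
        using prod_plateau_lipschitz[OF t, of y UNIV z] by (simp add: cube_bump_def k_def n_def)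
      also have "\<dots> \<le> k * 8 * (1 / t\<^sup>2) * n"
        using t2 k n by (intro mult_left_mono mult_right_mono) auto
      finally show ?thesis using k n by simp
    qed
    have 2: "\<bar>dplateau t (y $ i) - dplateau t (z $ i)\<bar> \<le> 128 / t\<^sup>2 * n"
      by (rule order_trans[OF dplateau_lipschitz[OF t]]) (intro mult_left_mono n, simp)
    have 3: "\<bar>dplateau t (y $ i) * (\<Prod>l\<in>UNIV - {i}. plateau t (y $ l)) - dplateau t (z $ i) * (\<Prod>l\<in>UNIV - {i}. plateau t (z $ l))\<bar>
       \<le> (8 / t) * (k * (8 / t) * n) + 1 * (128 / t\<^sup>2 * n)"
      using prod_plateau_lipschitz[OF t, of y "UNIV - {i}" z]
      by (intro abs_mult_diff_le 2 dplateau_bound[OF t] cube_bump_le[OF t]) (simp add: k_def n_def)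
    have "\<bar>dplateau t (y $ i) * (\<Prod>l\<in>UNIV - {i}. plateau t (y $ l)) * clip (y $ j)
        - dplateau t (z $ i) * (\<Prod>l\<in>UNIV - {i}. plateau t (z $ l)) * clip (z $ j)\<bar>
      \<le> (8 / t * 1) * n + 1 * ((8 / t) * (k * (8 / t) * n) + 1 * (128 / t\<^sup>2 * n))"
      by (intro abs_mult_diff_le 3 clip1 order_trans[OF clip1(2)] n)
        (unfold abs_mult, intro mult_mono dplateau_bound[OF t] cube_bump_le[OF t], use t in auto)
    also have "\<dots> = 8 * (1 / t) * n + (64 * k + 128) / t\<^sup>2 * n"
      by (simp add: divide_inverse power2_eq_square algebra_simps)
    also have "\<dots> \<le> 8 * (1 / t\<^sup>2) * n + (64 * k + 128) / t\<^sup>2 * n"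
      using t2 n by (intro add_right_mono mult_left_mono mult_right_mono) auto
    finally have 4: "\<bar>dplateau t (y $ i) * (\<Prod>l\<in>UNIV - {i}. plateau t (y $ l)) * clip (y $ j)
        - dplateau t (z $ i) * (\<Prod>l\<in>UNIV - {i}. plateau t (z $ l)) * clip (z $ j)\<bar>
       \<le> 8 * (1 / t\<^sup>2) * n + (64 * k + 128) / t\<^sup>2 * n" .
    have "(k * 8 + (8 + (64 * k + 128))) / t\<^sup>2 * n =
        k * 8 / t\<^sup>2 * n + (8 * (1 / t\<^sup>2) * n + (64 * k + 128) / t\<^sup>2 * n)"
      by (simp add: add_divide_distrib algebra_simps)
    then show ?thesis
      unfolding vector_minus_component dprof_entry[OF t] n_def[symmetric] using 1 4 by linarith
  qed
  show "norm (dprof t y - dprof t z) \<le> C / t\<^sup>2 * norm (y - z)"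
    using norm_le_entries[OF dent] by (simp add: C_def k_def)
qed

section \<open>Fractional seminorms of functions and series\<close>

lemma nn_integral_lebesgue_on_le_lborel:
  fixes g :: "'a::euclidean_space \<Rightarrow> ennreal"
  assumes "\<Omega> \<in> sets lebesgue" "g \<in> borel_measurable borel"
  shows "(\<integral>\<^sup>+x. g x \<partial>lebesgue_on \<Omega>) \<le> (\<integral>\<^sup>+x. g x \<partial>lborel)"
proof -
  have "(\<integral>\<^sup>+x. g x \<partial>lebesgue_on \<Omega>) = (\<integral>\<^sup>+x. g x * indicator \<Omega> x \<partial>lebesgue)"
    using assms by (intro nn_integral_restrict_space) auto
  also have "\<dots> \<le> (\<integral>\<^sup>+x. g x \<partial>lebesgue)"
    by (intro nn_integral_mono) (auto split: split_indicator)
  also have "\<dots> = (\<integral>\<^sup>+x. g x \<partial>lborel)"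
    by (rule nn_integral_completion)
  finally show ?thesis .
qed

lemma measurable_borel_lebesgue_on:
  "g \<in> borel_measurable borel \<Longrightarrow> g \<in> borel_measurable (lebesgue_on \<Omega>)"
  by (intro measurable_restrict_space1 measurable_completion) simp

text \<open>
  The kernel \<open>|x - y|\<^bsup>\<gamma> - k\<^esup>\<close> is integrable near the diagonal in dimension \<open>k\<close>, uniformly in \<open>x\<close>. Instead of
  polar coordinates, the kernel is dominated by a constant on each dyadic shell; the
  balls of radius \<open>R / 2^j\<close> have volume of order \<open>2\<^bsup>-jk\<^esup>\<close>, which leaves a geometric series of ratio
  \<open>2 powr (-\<gamma>)\<close>.
\<close>

lemma nn_integral_riesz_kernel:
  fixes R \<gamma> :: real
  assumes "\<gamma> > 0" "R > 0"
  obtains C where "C < \<infinity>" "\<And>x :: 'a::euclidean_space.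
    (\<integral>\<^sup>+y. ennreal (norm (x - y) powr (\<gamma> - real DIM('a))) * indicator (cball x R) y \<partial>lborel) \<le> C"
proof -
  have [measurable]: "cball x r \<in> sets borel" for x :: 'a and r by (simp add: borel_closed)
  define k where "k = real DIM('a)"
  define c where "c j = (R / 2^j) powr \<gamma> * (R / 2^Suc j) powr (- k)" for j :: nat
  have ptw: "ennreal (norm z powr (\<gamma> - k)) * indicator (cball 0 R) z
      \<le> (\<Sum>j. ennreal (c j) * indicator (cball 0 (R / 2^j)) z)" for z :: 'a
  proof (cases "z = 0 \<or> norm z > R")
    case False
    then have z: "0 < norm z" "norm z \<le> R" by auto
    have "\<exists>n. R / 2^Suc n < norm z"
    proof -
      obtain n where "R / norm z < 2 ^ n" using real_arch_pow[of 2 "R / norm z"] by auto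
      then have "R / 2^n < norm z" using z by (simp add: field_simps)
      moreover have "R / 2^Suc n \<le> R / 2^n" using assms by (simp add: field_simps)
      ultimately show ?thesis by (intro exI[of _ n]) linarith
    qed
    \<comment> \<open>The shell of \<open>z\<close>: \<open>R / 2^Suc n < norm z \<le> R / 2^n\<close>.\<close>
    define n where "n = (LEAST n. R / 2^Suc n < norm z)"
    have n1: "R / 2^Suc n < norm z" unfolding n_def by (rule LeastI_ex) fact
    have n2: "norm z \<le> R / 2^n"
    proof (cases n)
      case (Suc m)
      then have "\<not> R / 2^Suc m < norm z" using not_less_Least[of m "\<lambda>n. R / 2^Suc n < norm z"] n_def by auto
      then show ?thesis using Suc by simp
    qed (use z in simp)
    have "norm z powr (\<gamma> - k) = norm z powr \<gamma> * norm z powr (- k)"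
      by (simp add: powr_add[symmetric])
    also have "\<dots> \<le> c n"
      unfolding c_def using n1 n2 z assms
      by (intro mult_mono powr_mono2 powr_mono2') (auto simp: k_def)
    finally have "ennreal (norm z powr (\<gamma> - k)) \<le> ennreal (c n)" by (rule ennreal_leI)
    also have "\<dots> = (\<Sum>j\<in>{n}. ennreal (c j) * indicator (cball 0 (R / 2^j)) z)"
      using n2 by simp
    also have "\<dots> \<le> (\<Sum>j. ennreal (c j) * indicator (cball 0 (R / 2^j)) z)"
      by (rule sum_le_suminf) auto
    finally show ?thesis using z by simp
  qed auto
  define V where "V = unit_ball_vol k"
  have cV: "c j * (V * (R / 2^j) ^ DIM('a)) = V * 2 powr k * R powr \<gamma> * (2 powr (-\<gamma>)) ^ j" for j
  proof -
    have p: "(2::real) ^ j = 2 powr real j" by (simp add: powr_realpow)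
    have "(R / 2^j) ^ DIM('a) = (R / 2^j) powr k"
      using assms by (simp add: k_def powr_realpow)
    moreover have "(R / 2^Suc j) powr (-k) = (R / 2^j) powr (-k) * 2 powr k"
      using assms by (simp add: powr_mult powr_divide powr_minus field_simps)
    ultimately have "c j * (V * (R / 2^j) ^ DIM('a)) = V * 2 powr k * (R / 2^j) powr \<gamma> * ((R / 2^j) powr (-k) * (R / 2^j) powr k)"
      by (simp add: c_def)
    also have "(R / 2^j) powr (-k) * (R / 2^j) powr k = 1"
      using assms by (simp add: powr_add[symmetric])
    also have "(R / 2^j) powr \<gamma> = R powr \<gamma> * (2 powr (-\<gamma>)) ^ j"
      using assms by (simp add: powr_divide p powr_powr powr_realpow[symmetric] powr_minus_divide mult.commute powr_minus)
    finally show ?thesis by simp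
  qed
  have V: "V \<ge> 0" by (simp add: V_def k_def)
  define C where "C = (\<Sum>j. ennreal (V * 2 powr k * R powr \<gamma> * (2 powr (-\<gamma>)) ^ j))"
  have I: "(\<integral>\<^sup>+(z::'a). ennreal (norm z powr (\<gamma> - k)) * indicator (cball 0 R) z \<partial>lborel) \<le> C"
  proof -
    have "(\<integral>\<^sup>+(z::'a). ennreal (norm z powr (\<gamma> - k)) * indicator (cball 0 R) z \<partial>lborel)
        \<le> (\<integral>\<^sup>+(z::'a). (\<Sum>j. ennreal (c j) * indicator (cball 0 (R / 2^j)) z) \<partial>lborel)"
      by (intro nn_integral_mono ptw)
    also have "\<dots> = (\<Sum>j. \<integral>\<^sup>+(z::'a). ennreal (c j) * indicator (cball 0 (R / 2^j)) z \<partial>lborel)"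
      by (rule nn_integral_suminf) measurable
    also have "\<dots> = (\<Sum>j. ennreal (c j) * ennreal (V * (R / 2^j) ^ DIM('a)))"
      using assms by (simp add: nn_integral_cmult_indicator emeasure_cball V_def k_def)
    also have "\<dots> = C"
      unfolding C_def cV[symmetric] using V assms
      by (intro arg_cong[where f = suminf] ext ennreal_mult[symmetric]) (auto simp: c_def)
    finally show ?thesis .
  qed
  show thesis
  proof
    have "norm (2 powr (-\<gamma>)) < 1" using assms by (simp add: powr_minus field_simps)
    then have "summable (\<lambda>j. V * 2 powr k * R powr \<gamma> * (2 powr (-\<gamma>)) ^ j)"
      by (intro summable_mult summable_geometric)
    then have "C \<noteq> top" unfolding C_def using V by (intro ennreal_suminf_neq_top) auto
    then show "C < \<infinity>" by (simp add: less_top)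
    fix x :: 'a
    have "(\<integral>\<^sup>+y. ennreal (norm (x - y) powr (\<gamma> - real DIM('a))) * indicator (cball x R) y \<partial>lborel)
       = (\<integral>\<^sup>+y. ennreal (norm (x - y) powr (\<gamma> - real DIM('a))) * indicator (cball x R) y \<partial>distr lborel borel ((+) x))"
      by (simp add: lborel_distr_plus)
    also have "\<dots> = (\<integral>\<^sup>+(z::'a). ennreal (norm z powr (\<gamma> - k)) * indicator (cball 0 R) z \<partial>lborel)"
    proof (subst nn_integral_distr)
      show "(\<integral>\<^sup>+z. ennreal (norm (x - (x + z)) powr (\<gamma> - real DIM('a))) * indicator (cball x R) (x + z) \<partial>lborel)
        = (\<integral>\<^sup>+(z::'a). ennreal (norm z powr (\<gamma> - k)) * indicator (cball 0 R) z \<partial>lborel)"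
        by (intro nn_integral_cong) (simp add: k_def dist_norm indicator_def)
    qed measurable
    finally show "(\<integral>\<^sup>+y. ennreal (norm (x - y) powr (\<gamma> - real DIM('a))) * indicator (cball x R) y \<partial>lborel) \<le> C"
      using I by simp
  qed
qed

text \<open>
  After division by the Gagliardo weight the pointwise bound leaves the kernel \<open>|x - y|\<^bsup>(b - a) p - k\<^esup>\<close>, which is
  integrable in either variable uniformly in the other. By symmetry and Tonelli the double integral is
  at most twice a constant times the integral of \<open>\<Phi>\<close>.
\<close>

lemma gagliardo_finite:
  fixes f :: "'a::euclidean_space \<Rightarrow> 'b::euclidean_space" and \<Phi> :: "'a \<Rightarrow> ennreal"
  assumes \<Omega>: "\<Omega> \<in> sets lebesgue" "bounded \<Omega>" and "p > 0" "a < b"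
    and [measurable]: "\<Phi> \<in> borel_measurable (lebesgue_on \<Omega>)"
    and fin: "(\<integral>\<^sup>+x. \<Phi> x \<partial>lebesgue_on \<Omega>) < \<infinity>"
    and bd: "\<And>x y. x \<in> \<Omega> \<Longrightarrow> y \<in> \<Omega> \<Longrightarrow> x \<noteq> y \<Longrightarrow>
       ennreal (norm (f x - f y) powr p) \<le> ennreal (norm (x - y) powr (b * p)) * (\<Phi> x + \<Phi> y)"
  shows "gagliardo a p \<Omega> f < \<infinity>"
proof -
  define k where "k = real DIM('a)"
  define \<gamma> where "\<gamma> = (b - a) * p"
  have [measurable]: "cball x r \<in> sets borel" for x :: 'a and r by (simp add: borel_closed)
  have "\<gamma> > 0" using assms by (simp add: \<gamma>_def)
  obtain R where R: "R > 0" "\<Omega> \<subseteq> ball 0 R"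
    using \<Omega>(2) bounded_subset_ballD by blast
  obtain C where C: "C < \<infinity>" "\<And>x :: 'a.
    (\<integral>\<^sup>+y. ennreal (norm (x - y) powr (\<gamma> - real DIM('a))) * indicator (cball x (2 * R)) y \<partial>lborel) \<le> C"
    using nn_integral_riesz_kernel[OF \<open>\<gamma> > 0\<close>, of "2 * R"] R by auto
  let ?M = "lebesgue_on \<Omega>"
  have [measurable]: "(\<lambda>x. x) \<in> borel_measurable ?M"
    by (intro measurable_borel_lebesgue_on) simp
  interpret finite_measure ?M
    by (intro finite_measure_lebesgue_on bounded_set_imp_lmeasurable \<Omega>)
  interpret P: pair_sigma_finite ?M ?M ..
  define K where "K x y = ennreal (norm (x - y) powr (\<gamma> - k))" for x y :: 'a
  have Kint: "(\<integral>\<^sup>+y. K x y \<partial>?M) \<le> C" if "x \<in> \<Omega>" for x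
  proof -
    have "(\<integral>\<^sup>+y. K x y \<partial>?M) = (\<integral>\<^sup>+y. ennreal (norm (x - y) powr (\<gamma> - real DIM('a))) * indicator (cball x (2 * R)) y \<partial>?M)"
    proof (intro nn_integral_cong)
      fix y assume "y \<in> space ?M"
      then have "y \<in> \<Omega>" by simp
      then have "norm x < R" "norm y < R" using that R(2) by (auto simp: subset_eq)
      then have "dist x y \<le> 2 * R" using norm_triangle_ineq4[of x y] by (simp add: dist_norm)
      then show "K x y = ennreal (norm (x - y) powr (\<gamma> - real DIM('a))) * indicator (cball x (2 * R)) y"
        by (simp add: K_def k_def)
    qed
    also have "\<dots> \<le> C"
      by (rule order_trans[OF nn_integral_lebesgue_on_le_lborel[OF \<Omega>(1)] C(2)]) measurable
    finally show ?thesis .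
  qed
  have Ksym: "K x y = K y x" for x y by (simp add: K_def norm_minus_commute)
  have "gagliardo a p \<Omega> f \<le> (\<integral>\<^sup>+x. (\<integral>\<^sup>+y. K x y * \<Phi> x + K x y * \<Phi> y \<partial>?M) \<partial>?M)"
    unfolding gagliardo_def
  proof (intro nn_integral_mono)
    fix x y assume "x \<in> space ?M" "y \<in> space ?M"
    then have xy: "x \<in> \<Omega>" "y \<in> \<Omega>" by auto
    show "ennreal (norm (f x - f y) powr p / norm (x - y) powr (a * p + real DIM('a))) \<le> K x y * \<Phi> x + K x y * \<Phi> y"
    proof (cases "x = y")
      case False
      have "norm (f x - f y) powr p / norm (x - y) powr (a * p + real DIM('a))
         = norm (f x - f y) powr p * norm (x - y) powr (- (a * p + k))"
        unfolding powr_minus k_def by (simp add: divide_inverse)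
      then have "ennreal (norm (f x - f y) powr p / norm (x - y) powr (a * p + real DIM('a)))
         = ennreal (norm (f x - f y) powr p) * ennreal (norm (x - y) powr (- (a * p + k)))"
        by (simp add: ennreal_mult)
      also have "\<dots> \<le> ennreal (norm (x - y) powr (b * p)) * (\<Phi> x + \<Phi> y) * ennreal (norm (x - y) powr (- (a * p + k)))"
        by (intro mult_right_mono bd xy False) simp
      also have "\<dots> = (ennreal (norm (x - y) powr (b * p)) * ennreal (norm (x - y) powr (- (a * p + k)))) * (\<Phi> x + \<Phi> y)"
        by (simp add: mult_ac)
      also have "ennreal (norm (x - y) powr (b * p)) * ennreal (norm (x - y) powr (- (a * p + k))) = K x y"
        unfolding K_def by (subst ennreal_mult[symmetric])
          (auto simp: powr_add[symmetric] \<gamma>_def algebra_simps)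
      finally show ?thesis by (simp add: distrib_left)
    qed simp
  qed
  also have "\<dots> = (\<integral>\<^sup>+x. (\<integral>\<^sup>+y. K x y * \<Phi> x \<partial>?M) \<partial>?M) + (\<integral>\<^sup>+x. (\<integral>\<^sup>+y. K x y * \<Phi> y \<partial>?M) \<partial>?M)"
    unfolding K_def by (subst nn_integral_add[symmetric])
      (auto intro!: nn_integral_cong nn_integral_add)
  also have "(\<integral>\<^sup>+x. (\<integral>\<^sup>+y. K x y * \<Phi> y \<partial>?M) \<partial>?M) = (\<integral>\<^sup>+y. (\<integral>\<^sup>+x. K x y * \<Phi> y \<partial>?M) \<partial>?M)"
    unfolding K_def by (rule P.Fubini'[symmetric]) measurable
  also have "\<dots> = (\<integral>\<^sup>+x. (\<integral>\<^sup>+y. K x y * \<Phi> x \<partial>?M) \<partial>?M)"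
    by (simp add: Ksym)
  also have "(\<integral>\<^sup>+x. (\<integral>\<^sup>+y. K x y * \<Phi> x \<partial>?M) \<partial>?M) \<le> (\<integral>\<^sup>+x. C * \<Phi> x \<partial>?M)"
  proof (intro nn_integral_mono)
    fix x assume "x \<in> space ?M"
    then have "x \<in> \<Omega>" by simp
    have "(\<integral>\<^sup>+y. K x y * \<Phi> x \<partial>?M) = (\<integral>\<^sup>+y. K x y \<partial>?M) * \<Phi> x"
      unfolding K_def by (rule nn_integral_multc) measurable
    also have "\<dots> \<le> C * \<Phi> x" by (intro mult_right_mono Kint \<open>x \<in> \<Omega>\<close>) simp
    finally show "(\<integral>\<^sup>+y. K x y * \<Phi> x \<partial>?M) \<le> C * \<Phi> x" .
  qed
  also have "(\<integral>\<^sup>+x. C * \<Phi> x \<partial>?M) = C * (\<integral>\<^sup>+x. \<Phi> x \<partial>?M)"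
    by (rule nn_integral_cmult) measurable
  finally have "gagliardo a p \<Omega> f \<le> C * (\<integral>\<^sup>+x. \<Phi> x \<partial>?M) + C * (\<integral>\<^sup>+x. \<Phi> x \<partial>?M)"
    by (simp add: add_mono)
  also have "\<dots> < \<infinity>" using C(1) fin by (auto simp: ennreal_mult_less_top)
  finally show ?thesis .
qed

text \<open>
  A substitute for the Minkowski inequality for series: each term of the weighted series is at most its
  sum \<open>T\<close>, so \<open>e n \<le> T powr (1 / q) * \<theta> ^ n\<close>. The loss of the factor \<open>\<theta> ^ n\<close> does not matter for series that
  converge geometrically.
\<close>

lemma weighted_sum_le:
  fixes e :: "nat \<Rightarrow> real"
  assumes q: "1 \<le> q" and \<theta>: "0 < \<theta>" "\<theta> < 1" and e: "\<And>n. 0 \<le> e n"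
    and T: "(\<Sum>n. ennreal ((e n / \<theta> ^ n) powr q)) = ennreal T" "0 \<le> T"
  shows "summable e" "suminf e \<le> T powr (1 / q) / (1 - \<theta>)"
proof -
  have en: "e n \<le> T powr (1 / q) * \<theta> ^ n" for n
  proof -
    define g where "g n = ennreal ((e n / \<theta> ^ n) powr q)" for n
    have "sum g {n} \<le> suminf g" by (rule sum_le_suminf) auto
    also have "suminf g = ennreal T" unfolding g_def by (rule T)
    finally have "(e n / \<theta> ^ n) powr q \<le> T" using T(2) by (simp add: g_def)
    then have "((e n / \<theta> ^ n) powr q) powr (1 / q) \<le> T powr (1 / q)"
      using q by (intro powr_mono2) auto
    then have "e n / \<theta> ^ n \<le> T powr (1 / q)"
      using q \<theta> e[of n] by (simp add: powr_powr)
    then show ?thesis using \<theta> by (simp add: field_simps)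
  qed
  have S: "(\<lambda>n. T powr (1 / q) * \<theta> ^ n) sums (T powr (1 / q) * (1 / (1 - \<theta>)))"
    using \<theta> by (intro sums_mult geometric_sums) auto
  show s: "summable e"
    by (rule summable_comparison_test'[OF sums_summable[OF S], of 0]) (use en e in auto)
  show "suminf e \<le> T powr (1 / q) / (1 - \<theta>)"
    using suminf_le[OF en s sums_summable[OF S]] sums_unique[OF S] by simp
qed

lemma powr_add_le:
  fixes a b q :: real
  assumes "0 \<le> a" "0 \<le> b" "0 \<le> q"
  shows "(a + b) powr q \<le> 2 powr q * (a powr q + b powr q)"
proof -
  have "(a + b) powr q \<le> (2 * max a b) powr q" using assms by (intro powr_mono2) auto
  also have "\<dots> = 2 powr q * max a b powr q" using assms by (simp add: powr_mult)
  also have "\<dots> \<le> 2 powr q * (a powr q + b powr q)"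
    by (intro mult_left_mono) (auto simp: max_def)
  finally show ?thesis .
qed

text \<open>
  The function \<open>e n\<close> bounds both \<open>f n\<close> and its local Hoelder constant. The sum \<open>\<Phi>\<close> of the weighted powers
  \<open>(e n / \<theta> ^ n) powr q\<close> is integrable, since one of the two factors \<open>\<theta> ^ n\<close> in the bound on the norm of \<open>e n\<close>
  is left over, and by \<open>weighted_sum_le\<close> a multiple of \<open>\<Phi> powr (1 / q)\<close> bounds the sum of all \<open>e n\<close>. So \<open>\<Phi>\<close> serves
  for the integrability of the series and in \<open>gagliardo_finite\<close>; where it is infinite, the bound
  required there is trivial, and the values of the series do not matter.
\<close>

lemma fractional_series:
  fixes f :: "nat \<Rightarrow> 'a::euclidean_space \<Rightarrow> 'b::euclidean_space" and e :: "nat \<Rightarrow> 'a \<Rightarrow> real"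
  assumes \<Omega>: "\<Omega> \<in> sets lebesgue" "bounded \<Omega>" and q: "1 \<le> q" and \<theta>: "0 < \<theta>" "\<theta> < 1"
    and f[measurable]: "\<And>n. f n \<in> borel_measurable borel"
    and e[measurable]: "\<And>n. e n \<in> borel_measurable borel"
    and fe: "\<And>n x. norm (f n x) \<le> e n x"
    and holder: "\<And>n x y. norm (f n x - f n y) \<le> norm (x - y) powr b * (e n x + e n y)"
    and int: "\<And>n. (\<integral>\<^sup>+x. ennreal (e n x powr q) \<partial>lebesgue_on \<Omega>) \<le> ennreal (K * (\<theta> ^ (2 * n)) powr q)"
  shows "AE x in lebesgue_on \<Omega>. summable (\<lambda>n. norm (f n x))"
    and "(\<integral>\<^sup>+x. (\<Sum>n. ennreal (norm (f n x))) \<partial>lebesgue_on \<Omega>) < \<infinity>"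
    and "(\<lambda>x. \<Sum>n. f n x) \<in> Lp_space (ennreal q) \<Omega>"
    and "a < b \<Longrightarrow> gagliardo a q \<Omega> (\<lambda>x. \<Sum>n. f n x) < \<infinity>"
proof -
  let ?M = "lebesgue_on \<Omega>"
  define \<Phi> where "\<Phi> x = (\<Sum>n. ennreal ((e n x / \<theta> ^ n) powr q))" for x
  have [measurable]: "(\<lambda>x. x) \<in> borel_measurable ?M"
    by (intro measurable_borel_lebesgue_on) simp
  have [measurable]: "\<Phi> \<in> borel_measurable borel" unfolding \<Phi>_def by measurable
  have \<Phi>M[measurable]: "\<Phi> \<in> borel_measurable ?M" by (intro measurable_borel_lebesgue_on) measurable
  have [measurable]: "f n \<in> borel_measurable ?M" "e n \<in> borel_measurable ?M" for n
    by (intro measurable_borel_lebesgue_on, measurable)+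
  have e0: "0 \<le> e n x" for n x using fe[of n x] norm_ge_zero order_trans by blast
  interpret finite_measure ?M
    by (intro finite_measure_lebesgue_on bounded_set_imp_lmeasurable \<Omega>)
  have \<Phi>int: "(\<integral>\<^sup>+x. \<Phi> x \<partial>?M) < \<infinity>"
  proof -
    have "(\<integral>\<^sup>+x. \<Phi> x \<partial>?M) = (\<Sum>n. \<integral>\<^sup>+x. ennreal ((e n x / \<theta> ^ n) powr q) \<partial>?M)"
      unfolding \<Phi>_def by (rule nn_integral_suminf) measurable
    also have "\<dots> \<le> (\<Sum>n. ennreal (\<bar>K\<bar> * \<theta> ^ n))"
    proof (intro suminf_le summableI)
      fix n
      have "(\<integral>\<^sup>+x. ennreal ((e n x / \<theta> ^ n) powr q) \<partial>?M) = (\<integral>\<^sup>+x. ennreal (1 / (\<theta> ^ n) powr q) * ennreal (e n x powr q) \<partial>?M)"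
        using \<theta> e0 by (intro nn_integral_cong) (simp add: powr_divide ennreal_mult[symmetric])
      also have "\<dots> = ennreal (1 / (\<theta> ^ n) powr q) * (\<integral>\<^sup>+x. ennreal (e n x powr q) \<partial>?M)"
        by (rule nn_integral_cmult) measurable
      also have "\<dots> \<le> ennreal (1 / (\<theta> ^ n) powr q) * ennreal (\<bar>K\<bar> * (\<theta> ^ (2 * n)) powr q)"
        by (intro mult_left_mono order_trans[OF int] ennreal_leI mult_right_mono) auto
      also have "\<dots> = ennreal (1 / (\<theta> ^ n) powr q * (\<bar>K\<bar> * (\<theta> ^ (2 * n)) powr q))"
        by (rule ennreal_mult[symmetric]) auto
      also have "1 / (\<theta> ^ n) powr q * (\<bar>K\<bar> * (\<theta> ^ (2 * n)) powr q) = \<bar>K\<bar> * (\<theta> ^ n) powr q"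
      proof -
        have "(\<theta> ^ (2 * n)) powr q = (\<theta> ^ n) powr q * (\<theta> ^ n) powr q"
          using \<theta> by (subst powr_mult[symmetric]) (auto simp: mult_2 power_add)
        then show ?thesis using \<theta> by simp
      qed
      also have "\<dots> \<le> ennreal (\<bar>K\<bar> * \<theta> ^ n)"
        using \<theta> q powr_mono'[of 1 q "\<theta> ^ n"] by (intro ennreal_leI mult_left_mono) (auto simp: power_le_one)
      finally show "(\<integral>\<^sup>+x. ennreal ((e n x / \<theta> ^ n) powr q) \<partial>?M) \<le> ennreal (\<bar>K\<bar> * \<theta> ^ n)" .
    qed
    also have "\<dots> < top"
      unfolding less_top[symmetric] using \<theta> by (intro ennreal_suminf_neq_top summable_mult summable_geometric) auto
    finally show ?thesis by simp
  qed
  define c where "c = 1 / (1 - \<theta>)"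
  have c: "c > 0" using \<theta> by (simp add: c_def)
  have ptw: "summable (\<lambda>n. e n x)" "(\<Sum>n. e n x) \<le> c * enn2real (\<Phi> x) powr (1 / q)"
    if "\<Phi> x < \<infinity>" for x
    using weighted_sum_le[where e = "\<lambda>n. e n x" and T = "enn2real (\<Phi> x)", OF q \<theta> e0] that
    by (simp_all add: \<Phi>_def[symmetric] c_def)
  have sf: "summable (\<lambda>n. norm (f n x))" "summable (\<lambda>n. f n x)" if "\<Phi> x < \<infinity>" for x
  proof -
    show "summable (\<lambda>n. norm (f n x))"
      by (rule summable_comparison_test'[OF ptw(1)[OF that], of 0]) (use fe in auto)
    then show "summable (\<lambda>n. f n x)" by (rule summable_norm_cancel)
  qed
  have nf: "norm (\<Sum>n. f n x) \<le> c * enn2real (\<Phi> x) powr (1 / q)"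
           "(\<Sum>n. norm (f n x)) \<le> c * enn2real (\<Phi> x) powr (1 / q)" if "\<Phi> x < \<infinity>" for x
  proof -
    have "(\<Sum>n. norm (f n x)) \<le> (\<Sum>n. e n x)"
      by (rule suminf_le[OF fe sf(1)[OF that] ptw(1)[OF that]])
    with ptw(2)[OF that] show "(\<Sum>n. norm (f n x)) \<le> c * enn2real (\<Phi> x) powr (1 / q)" by simp
    with summable_norm[OF sf(1)[OF that]] show "norm (\<Sum>n. f n x) \<le> c * enn2real (\<Phi> x) powr (1 / q)" by simp
  qed
  have ae: "AE x in ?M. \<Phi> x < \<infinity>"
    using nn_integral_noteq_infinite[OF \<Phi>M] \<Phi>int by (simp add: less_top)
  then show "AE x in ?M. summable (\<lambda>n. norm (f n x))"
    by eventually_elim (rule sf)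
  have "(\<integral>\<^sup>+x. (\<Sum>n. ennreal (norm (f n x))) \<partial>?M) \<le> (\<integral>\<^sup>+x. ennreal c * (1 + \<Phi> x) \<partial>?M)"
  proof (rule nn_integral_mono_AE, use ae in eventually_elim)
    fix x assume x: "\<Phi> x < \<infinity>"
    have "(\<Sum>n. ennreal (norm (f n x))) = ennreal (\<Sum>n. norm (f n x))"
      by (rule suminf_ennreal2) (auto intro: sf x)
    also have "\<dots> \<le> ennreal (c * enn2real (\<Phi> x) powr (1 / q))"
      by (intro ennreal_leI nf x)
    also have "\<dots> \<le> ennreal (c * (1 + enn2real (\<Phi> x)))"
    proof (intro ennreal_leI mult_left_mono)
      show "enn2real (\<Phi> x) powr (1 / q) \<le> 1 + enn2real (\<Phi> x)"
      proof (cases "enn2real (\<Phi> x) \<le> 1")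
        case True
        then have "enn2real (\<Phi> x) powr (1 / q) \<le> 1" using q by (intro powr_le1) auto
        then show ?thesis by (smt (verit) enn2real_nonneg)
      next
        case False
        then have "enn2real (\<Phi> x) powr (1 / q) \<le> enn2real (\<Phi> x) powr 1" using q by (intro powr_mono) auto
        then show ?thesis using False by simp
      qed
    qed (use c in simp)
    also have "\<dots> = ennreal c * (1 + \<Phi> x)"
      using c x by (simp add: ennreal_mult ennreal_plus[symmetric] less_top[symmetric])
    finally show "(\<Sum>n. ennreal (norm (f n x))) \<le> ennreal c * (1 + \<Phi> x)" .
  qed
  also have "\<dots> = ennreal c * (emeasure ?M (space ?M) + (\<integral>\<^sup>+x. \<Phi> x \<partial>?M))"
    by (simp add: nn_integral_cmult nn_integral_add)
  also have "\<dots> < \<infinity>"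
  proof -
    have "emeasure ?M (space ?M) < top" using emeasure_finite[of "space ?M"] less_top by blast
    then show ?thesis using \<Phi>int by (simp add: ennreal_mult_less_top)
  qed
  finally show "(\<integral>\<^sup>+x. (\<Sum>n. ennreal (norm (f n x))) \<partial>?M) < \<infinity>" .
  have pq: "(c * enn2real (\<Phi> x) powr (1 / q)) powr q = c powr q * enn2real (\<Phi> x)" for x
    using c q by (simp add: powr_mult powr_powr)
  have "(\<integral>\<^sup>+x. ennreal (norm (\<Sum>n. f n x) powr q) \<partial>?M) \<le> (\<integral>\<^sup>+x. ennreal (c powr q) * \<Phi> x \<partial>?M)"
  proof (rule nn_integral_mono_AE, use ae in eventually_elim)
    fix x assume x: "\<Phi> x < \<infinity>"
    have "norm (\<Sum>n. f n x) powr q \<le> c powr q * enn2real (\<Phi> x)"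
      unfolding pq[symmetric] using q by (intro powr_mono2 nf x) auto
    then have "ennreal (norm (\<Sum>n. f n x) powr q) \<le> ennreal (c powr q * enn2real (\<Phi> x))"
      by (rule ennreal_leI)
    also have "\<dots> = ennreal (c powr q) * \<Phi> x" using x by (simp add: ennreal_mult)
    finally show "ennreal (norm (\<Sum>n. f n x) powr q) \<le> ennreal (c powr q) * \<Phi> x" .
  qed
  also have "\<dots> < \<infinity>" using \<Phi>int by (simp add: nn_integral_cmult ennreal_mult_less_top)
  finally show "(\<lambda>x. \<Sum>n. f n x) \<in> Lp_space (ennreal q) \<Omega>"
    using q by (simp add: Lp_space_def)
  assume "a < b"
  show "gagliardo a q \<Omega> (\<lambda>x. \<Sum>n. f n x) < \<infinity>"
  proof (rule gagliardo_finite[OF \<Omega> _ \<open>a < b\<close>, where \<Phi> = "\<lambda>x. ennreal (2 powr q * c powr q) * \<Phi> x"])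
    show "(\<integral>\<^sup>+x. ennreal (2 powr q * c powr q) * \<Phi> x \<partial>?M) < \<infinity>"
      using \<Phi>int by (simp add: nn_integral_cmult ennreal_mult_less_top)
    fix x y :: 'a assume "x \<noteq> y"
    show "ennreal (norm ((\<Sum>n. f n x) - (\<Sum>n. f n y)) powr q)
       \<le> ennreal (norm (x - y) powr (b * q)) * (ennreal (2 powr q * c powr q) * \<Phi> x + ennreal (2 powr q * c powr q) * \<Phi> y)"
    proof (cases "\<Phi> x < \<infinity> \<and> \<Phi> y < \<infinity>")
      case True
      then have x: "\<Phi> x < \<infinity>" and y: "\<Phi> y < \<infinity>" by auto
      define t where "t z = enn2real (\<Phi> z) powr (1 / q)" for z
      have se: "summable (\<lambda>n. norm (x - y) powr b * (e n x + e n y))"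
        by (intro summable_mult summable_add ptw(1) x y)
      have sd: "summable (\<lambda>n. norm (f n x - f n y))"
        by (rule summable_comparison_test'[OF se, of 0]) (use holder in auto)
      have "norm ((\<Sum>n. f n x) - (\<Sum>n. f n y)) = norm (\<Sum>n. f n x - f n y)"
        using suminf_diff[OF sf(2)[OF x] sf(2)[OF y]] by simp
      also have "\<dots> \<le> (\<Sum>n. norm (f n x - f n y))" by (rule summable_norm[OF sd])
      also have "\<dots> \<le> (\<Sum>n. norm (x - y) powr b * (e n x + e n y))"
        by (rule suminf_le[OF holder sd se])
      also have "\<dots> = norm (x - y) powr b * ((\<Sum>n. e n x) + (\<Sum>n. e n y))"
        using suminf_mult[OF summable_add[OF ptw(1)[OF x] ptw(1)[OF y]]] suminf_add[OF ptw(1)[OF x] ptw(1)[OF y]]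
        by simp
      also have "\<dots> \<le> norm (x - y) powr b * (c * t x + c * t y)"
        unfolding t_def by (intro mult_left_mono add_mono ptw(2) x y) simp
      finally have "norm ((\<Sum>n. f n x) - (\<Sum>n. f n y)) powr q \<le> (norm (x - y) powr b * (c * t x + c * t y)) powr q"
        using q by (intro powr_mono2) auto
      also have "\<dots> = norm (x - y) powr (b * q) * (c * t x + c * t y) powr q"
        using c by (simp add: powr_mult powr_powr t_def)
      also have "\<dots> \<le> norm (x - y) powr (b * q) * (2 powr q * ((c * t x) powr q + (c * t y) powr q))"
        using c q by (intro mult_left_mono powr_add_le) (auto simp: t_def)
      also have "\<dots> = norm (x - y) powr (b * q) * (2 powr q * c powr q * enn2real (\<Phi> x) + 2 powr q * c powr q * enn2real (\<Phi> y))"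
        by (simp add: t_def pq algebra_simps)
      finally have "ennreal (norm ((\<Sum>n. f n x) - (\<Sum>n. f n y)) powr q)
          \<le> ennreal (norm (x - y) powr (b * q) * (2 powr q * c powr q * enn2real (\<Phi> x) + 2 powr q * c powr q * enn2real (\<Phi> y)))"
        by (rule ennreal_leI)
      also have "\<dots> = ennreal (norm (x - y) powr (b * q)) * (ennreal (2 powr q * c powr q) * \<Phi> x + ennreal (2 powr q * c powr q) * \<Phi> y)"
        using x y by (simp add: ennreal_mult ennreal_plus)
      finally show ?thesis .
    next
      case False
      have "norm (x - y) powr (b * q) > 0" using \<open>x \<noteq> y\<close> by simp
      moreover have "2 powr q * c powr q > 0" using c by simp
      ultimately have "ennreal (norm (x - y) powr (b * q)) * (ennreal (2 powr q * c powr q) * \<Phi> x + ennreal (2 powr q * c powr q) * \<Phi> y) = \<infinity>"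
        using False by (auto simp: ennreal_mult_top ennreal_top_mult ennreal_mult_eq_top_iff less_top[symmetric])
      then show ?thesis by simp
    qed
  qed (use q in auto)
qed

section \<open>Weak gradients of series\<close>

text \<open>
  The difference quotients of \<open>\<psi>\<close> in direction \<open>v\<close> have integral \<open>0\<close>, as Lebesgue measure is invariant under
  translations. They are bounded by the Lipschitz constant on a fixed ball, so dominated convergence applies.
\<close>

lemma integral_directional_derivative_eq_0:
  fixes \<psi> :: "'a::euclidean_space \<Rightarrow> real"
  assumes der: "\<And>x. (\<psi> has_derivative D x) (at x)"
    and lip: "\<And>x y. \<bar>\<psi> x - \<psi> y\<bar> \<le> L * norm (x - y)"
    and supp: "\<And>x. R < norm x \<Longrightarrow> \<psi> x = 0"
  shows "(\<integral>x. D x v \<partial>lborel) = 0"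
proof -
  define h where "h n = inverse (real (Suc n))" for n
  have h: "0 < h n" "h n \<le> 1" for n by (auto simp: h_def field_simps)
  have h0: "h \<longlonglongrightarrow> 0" unfolding h_def by (rule LIMSEQ_inverse_real_of_nat)
  define g where "g n x = (\<psi> (x + h n *\<^sub>R v) - \<psi> x) / h n" for n x
  have cont: "continuous_on UNIV \<psi>"
    by (rule has_derivative_continuous_on[OF has_derivative_at_withinI[OF der]])
  then have [measurable]: "\<psi> \<in> borel_measurable borel"
    by (rule borel_measurable_continuous_onI)
  have lim: "(\<lambda>n. g n x) \<longlonglongrightarrow> D x v" for x
  proof -
    have "((\<lambda>t. \<psi> (x + t *\<^sub>R v)) has_derivative (\<lambda>t. D x (t *\<^sub>R v))) (at 0)"
    proof (rule has_derivative_compose[of "\<lambda>t. x + t *\<^sub>R v" _ _ _ \<psi>])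
      show "((\<lambda>t. x + t *\<^sub>R v) has_derivative (\<lambda>t. t *\<^sub>R v)) (at 0)"
        by (auto intro!: derivative_eq_intros)
      show "(\<psi> has_derivative D x) (at (x + 0 *\<^sub>R v))" using der[of x] by simp
    qed
    moreover have "D x (t *\<^sub>R v) = D x v * t" for t
      using linear_cmul[OF has_derivative_linear[OF der[of x]]] by simp
    ultimately have "((\<lambda>t. \<psi> (x + t *\<^sub>R v)) has_real_derivative D x v) (at 0)"
      by (simp add: has_field_derivative_def)
    then have "((\<lambda>t. (\<psi> (x + t *\<^sub>R v) - \<psi> x) / t) \<longlongrightarrow> D x v) (at 0)"
      by (simp add: DERIV_def)
    moreover have "filterlim h (at 0) sequentially"
      unfolding filterlim_at using h0 h(1) by (auto simp: less_imp_neq[symmetric] intro!: always_eventually)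
    ultimately show ?thesis
      unfolding g_def by (rule filterlim_compose)
  qed
  have Lv: "0 \<le> L * norm v" using lip[of v 0] abs_ge_zero order_trans by fastforce
  have bound: "norm (g n x) \<le> L * norm v * indicat_real (cball 0 (\<bar>R\<bar> + norm v)) x" for n x
  proof (cases "norm x \<le> \<bar>R\<bar> + norm v")
    case True
    have "\<bar>\<psi> (x + h n *\<^sub>R v) - \<psi> x\<bar> \<le> L * (h n * norm v)"
      using lip[of "x + h n *\<^sub>R v" x] h(1)[of n] by simp
    then have "norm (g n x) \<le> L * norm v"
      using h(1)[of n] by (simp add: g_def field_simps)
    then show ?thesis using True by simp
  next
    case False
    have "norm (h n *\<^sub>R v) \<le> norm v" using h[of n] by (simp add: mult_left_le_one_le)
    then have "norm (x + h n *\<^sub>R v) > R"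
      using False norm_triangle_ineq4[of "x + h n *\<^sub>R v" "h n *\<^sub>R v"] by simp
    moreover have "norm x > R" using False norm_ge_zero[of v] by linarith
    ultimately show ?thesis using Lv by (simp add: g_def supp indicator_def)
  qed
  have [measurable]: "cball (0::'a) r \<in> sets borel" for r by (simp add: borel_closed)
  have ind: "integrable lborel (\<lambda>x. L * norm v * indicat_real (cball (0::'a) (\<bar>R\<bar> + norm v)) x)"
    by (intro integrable_mult_right integrable_real_indicator) (use emeasure_lborel_cball_finite in auto)
  have g_meas[measurable]: "g n \<in> borel_measurable borel" for n unfolding g_def by measurable
  have Dmeas: "(\<lambda>x. D x v) \<in> borel_measurable borel"
    by (rule borel_measurable_LIMSEQ_real[OF lim]) measurable
  have "(\<lambda>n. \<integral>x. g n x \<partial>lborel) \<longlonglongrightarrow> (\<integral>x. D x v \<partial>lborel)"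
    by (rule integral_dominated_convergence[OF _ _ ind])
      (use lim bound Dmeas g_meas in auto)
  moreover have "(\<integral>x. g n x \<partial>lborel) = 0" for n
  proof -
    have int: "integrable lborel \<psi>"
    proof -
      have "integrable lborel (\<lambda>x. indicator (cball 0 \<bar>R\<bar>) x *\<^sub>R \<psi> x)"
        by (rule borel_integrable_compact) (auto intro: continuous_on_subset[OF cont])
      also have "(\<lambda>x. indicator (cball 0 \<bar>R\<bar>) x *\<^sub>R \<psi> x) = \<psi>"
        using supp by (auto simp: fun_eq_iff indicator_def)
      finally show ?thesis .
    qed
    \<comment> \<open>Both terms of the difference quotient have the same integral.\<close>
    have tr: "integrable lborel (\<lambda>x. \<psi> (x + c))" "(\<integral>x. \<psi> (x + c) \<partial>lborel) = (\<integral>x. \<psi> x \<partial>lborel)" for c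
    proof -
      have "integrable (distr lborel borel ((+) c)) \<psi>" using int by (simp add: lborel_distr_plus)
      then show "integrable lborel (\<lambda>x. \<psi> (x + c))"
        by (subst (asm) integrable_distr_eq) (auto simp: add.commute)
      have "(\<integral>x. \<psi> x \<partial>lborel) = (\<integral>x. \<psi> x \<partial>distr lborel borel ((+) c))" by (simp add: lborel_distr_plus)
      also have "\<dots> = (\<integral>x. \<psi> (x + c) \<partial>lborel)"
        by (subst integral_distr) (auto simp: add.commute)
      finally show "(\<integral>x. \<psi> (x + c) \<partial>lborel) = (\<integral>x. \<psi> x \<partial>lborel)" by simp
    qed
    show ?thesis unfolding g_def using tr[of "h n *\<^sub>R v"] int by (simp add: Bochner_Integration.integral_diff)
  qed
  ultimately show ?thesis using LIMSEQ_unique[of "\<lambda>n. 0" 0] by (simp add: LIMSEQ_const_iff)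
qed

lemma set_lebesgue_integral_vanishing_outside:
  fixes h :: "'a::euclidean_space \<Rightarrow> real"
  assumes "K \<subseteq> \<Omega>" "K \<in> sets lebesgue" "\<And>x. x \<in> \<Omega> \<Longrightarrow> x \<notin> K \<Longrightarrow> h x = 0"
  shows "(LINT x:\<Omega>|lebesgue. h x) = (\<integral>x. h x \<partial>lebesgue_on K)"
proof -
  have "(\<integral>x. h x \<partial>lebesgue_on K) = (\<integral>x. indicator K x *\<^sub>R h x \<partial>lebesgue)"
    using assms by (intro integral_restrict_space) auto
  also have "\<dots> = (LINT x:\<Omega>|lebesgue. h x)"
    unfolding set_lebesgue_integral_def using assms
    by (intro Bochner_Integration.integral_cong) (auto simp: indicator_def)
  finally show ?thesis by simp
qed

lemma integrable_continuous_compact: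
  fixes h :: "'a::euclidean_space \<Rightarrow> 'b::euclidean_space"
  assumes "compact K" "continuous_on K h"
  shows "integrable (lebesgue_on K) h"
proof -
  have K: "K \<in> sets lebesgue" using assms(1) by (simp add: compact_imp_closed borel_closed)
  interpret finite_measure "lebesgue_on K"
    using assms(1) K by (intro finite_measure_lebesgue_on bounded_set_imp_lmeasurable compact_imp_bounded)
  obtain B where B: "\<And>x. x \<in> K \<Longrightarrow> norm (h x) \<le> B"
    using compact_imp_bounded[OF compact_continuous_image[OF assms(2,1)]] by (auto simp: bounded_iff)
  show ?thesis
    using B by (intro integrable_const_bound[where B = B] continuous_imp_measurable_on_sets_lebesgue assms K) auto
qed

context
  fixes \<Omega> K :: "(real^'k) set" and \<phi> :: "real^'k \<Rightarrow> real"
  assumes \<Omega>: "open \<Omega>" and K: "compact K" "K \<subseteq> \<Omega>" and \<phi>: "\<phi> \<in> C1c_on \<Omega>"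
begin

lemma test_function_continuous:
  "continuous_on \<Omega> \<phi>" "continuous_on \<Omega> (\<lambda>x. frechet_derivative \<phi> (at x) v)"
  "x \<in> \<Omega> \<Longrightarrow> (\<phi> has_derivative frechet_derivative \<phi> (at x)) (at x)"
proof -
  obtain \<phi>' :: "real^'k \<Rightarrow> (real^'k) \<Rightarrow>\<^sub>L real" where
    d: "\<And>x. x \<in> \<Omega> \<Longrightarrow> (\<phi> has_derivative blinfun_apply (\<phi>' x)) (at x)" and c: "continuous_on \<Omega> \<phi>'"
    using \<phi> unfolding C1c_on_def C1_on_def by auto
  have e: "frechet_derivative \<phi> (at x) = blinfun_apply (\<phi>' x)" if "x \<in> \<Omega>" for x
    using frechet_derivative_at[OF d[OF that]] by simp
  show "continuous_on \<Omega> \<phi>"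
    by (rule has_derivative_continuous_on) (erule has_derivative_at_withinI[OF d])
  have "continuous_on \<Omega> (\<lambda>x. blinfun_apply (\<phi>' x) v)"
    by (intro continuous_intros c)
  then show "continuous_on \<Omega> (\<lambda>x. frechet_derivative \<phi> (at x) v)"
    by (rule continuous_on_eq) (simp add: e)
  show "x \<in> \<Omega> \<Longrightarrow> (\<phi> has_derivative frechet_derivative \<phi> (at x)) (at x)"
    using d e by simp
qed

text \<open>
  The integrand is a partial derivative of the product of \<open>w\<close> and \<open>\<phi>\<close>. The product is extended by \<open>0\<close>, because the test
  function \<open>\<phi>\<close> is differentiable on \<open>\<Omega>\<close> only, while \<open>w\<close> is supported in \<open>K\<close>; the extension is of class \<open>C\<^sup>1\<close> with compact
  support, hence Lipschitz.
\<close>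

lemma integration_by_parts_C1:
  fixes w :: "real^'k \<Rightarrow> real^'m" and f :: "real^'k \<Rightarrow> real^'m^'k"
  assumes der: "\<And>x. (w has_derivative (\<lambda>h. h v* f x)) (at x)"
    and cont: "continuous_on UNIV f"
    and zero: "\<And>x. x \<notin> K \<Longrightarrow> w x = 0" "\<And>x. x \<notin> K \<Longrightarrow> f x = 0"
  shows "(\<integral>x. w x $ j * frechet_derivative \<phi> (at x) (axis i 1) \<partial>lebesgue_on K) =
       - (\<integral>x. f x $ i $ j * \<phi> x \<partial>lebesgue_on K)"
proof -
  define \<psi> where "\<psi> x = (if x \<in> \<Omega> then w x $ j * \<phi> x else 0)" for x
  define D where "D x h = (if x \<in> \<Omega> then w x $ j * frechet_derivative \<phi> (at x) h + (h v* f x) $ j * \<phi> x else 0)" for x h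
  have contw: "continuous_on UNIV w"
    by (rule has_derivative_continuous_on[OF has_derivative_at_withinI[OF der]])
  have D0: "D x = (\<lambda>h. 0)" if "x \<notin> K" for x using that zero by (auto simp: D_def fun_eq_iff)
  have dpsi: "(\<psi> has_derivative D x) (at x)" for x
  proof (cases "x \<in> \<Omega>")
    case True
    have "((\<lambda>x. w x $ j) has_derivative (\<lambda>h. (h v* f x) $ j)) (at x)"
      by (rule bounded_linear.has_derivative[OF bounded_linear_vec_nth der])
    from has_derivative_mult[OF this test_function_continuous(3)[OF True]]
    have "((\<lambda>x. w x $ j * \<phi> x) has_derivative D x) (at x)"
      using True by (simp add: D_def[abs_def])
    then show ?thesis
      by (rule has_derivative_transform_within_open[OF _ \<Omega> True]) (simp add: \<psi>_def)
  next
    case False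
    have "open (- K)" using compact_imp_closed[OF K(1)] by (rule open_Compl)
    have "((\<lambda>x. 0) has_derivative D x) (at x)" using False by (simp add: D_def[abs_def])
    then show ?thesis
      by (rule has_derivative_transform_within_open[OF _ \<open>open (- K)\<close>])
        (use False K in \<open>auto simp: \<psi>_def zero\<close>)
  qed
  have lin: "D x h = (\<Sum>i\<in>UNIV. h $ i * D x (axis i 1))" for x h
  proof -
    have "linear (D x)" using has_derivative_linear[OF dpsi] .
    then have "D x (\<Sum>i\<in>UNIV. h $ i *\<^sub>R axis i 1) = (\<Sum>i\<in>UNIV. h $ i *\<^sub>R D x (axis i 1))"
      by (simp add: linear_sum linear_cmul)
    moreover have "(\<Sum>i\<in>UNIV. h $ i *\<^sub>R axis i 1) = h"
      using basis_expansion[of h] by (simp add: scalar_mult_eq_scaleR)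
    ultimately show ?thesis by simp
  qed
  have cD: "continuous_on K (\<lambda>x. D x h)" for h
  proof -
    have "continuous_on K (\<lambda>x. w x $ j * frechet_derivative \<phi> (at x) h + (h v* f x) $ j * \<phi> x)"
      unfolding vector_matrix_mult_def
      by (auto intro!: continuous_intros continuous_on_subset[OF contw] continuous_on_subset[OF cont]
          continuous_on_subset[OF test_function_continuous(1) K(2)] continuous_on_subset[OF test_function_continuous(2) K(2)])
    then show ?thesis
      by (rule continuous_on_eq) (use K in \<open>auto simp: D_def\<close>)
  qed
  have "\<exists>B. \<forall>x. \<bar>D x (axis i 1)\<bar> \<le> B" for i
  proof -
    obtain B where B: "\<And>x. x \<in> K \<Longrightarrow> norm (D x (axis i 1)) \<le> B"
      using compact_imp_bounded[OF compact_continuous_image[OF cD K(1)]] by (fastforce simp: bounded_iff)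
    show ?thesis
    proof (intro exI allI)
      fix x show "\<bar>D x (axis i 1)\<bar> \<le> max B 0"
        using B[of x] D0[of x] by (cases "x \<in> K") auto
    qed
  qed
  then obtain B where B: "\<And>i x. \<bar>D x (axis i 1)\<bar> \<le> B i" by metis
  have on: "onorm (D x) \<le> sum B UNIV" for x
  proof (rule onorm_le)
    fix h :: "real^'k"
    have "norm (D x h) \<le> (\<Sum>i\<in>UNIV. \<bar>h $ i\<bar> * \<bar>D x (axis i 1)\<bar>)"
      by (subst lin) (rule order_trans[OF norm_sum], simp add: abs_mult)
    also have "\<dots> \<le> (\<Sum>i\<in>UNIV. norm h * B i)"
      by (intro sum_mono mult_mono B component_le_norm_cart) auto
    also have "\<dots> = sum B UNIV * norm h"
      by (subst sum_distrib_left[symmetric]) (rule mult.commute)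
    finally show "norm (D x h) \<le> sum B UNIV * norm h" .
  qed
  obtain R where R: "K \<subseteq> ball 0 R"
    using bounded_subset_ballD[OF compact_imp_bounded[OF K(1)], of 0] by blast
  have supp: "\<psi> x = 0" if "R < norm x" for x
  proof -
    have "x \<notin> K" using R that by auto
    then show ?thesis by (simp add: \<psi>_def zero)
  qed
  have "(\<integral>x. D x (axis i 1) \<partial>lborel) = 0"
  proof (rule integral_directional_derivative_eq_0[OF dpsi _ supp])
    show "\<bar>\<psi> x - \<psi> y\<bar> \<le> sum B UNIV * norm (x - y)" for x y
      using differentiable_bound[of UNIV \<psi> D "sum B UNIV" x y] dpsi on by auto
  qed
  have KL: "K \<in> sets lebesgue" using K(1) by (simp add: compact_imp_closed borel_closed)
  have "(\<integral>x. D x (axis i 1) \<partial>lebesgue_on K) = (\<integral>x. indicator K x *\<^sub>R D x (axis i 1) \<partial>lebesgue)"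
    using KL by (intro integral_restrict_space) auto
  also have "\<dots> = (\<integral>x. indicator K x *\<^sub>R D x (axis i 1) \<partial>lborel)"
    by (rule integral_completion)
      (use borel_measurable_continuous_on_indicator[OF borel_closed[OF compact_imp_closed[OF K(1)]] cD] in simp)
  also have "(\<lambda>x. indicator K x *\<^sub>R D x (axis i 1)) = (\<lambda>x. D x (axis i 1))"
    using D0 by (auto simp: fun_eq_iff indicator_def)
  also note \<open>(\<integral>x. D x (axis i 1) \<partial>lborel) = 0\<close>
  finally have "(\<integral>x. D x (axis i 1) \<partial>lebesgue_on K) = 0" .
  moreover have "(\<integral>x. D x (axis i 1) \<partial>lebesgue_on K) =
    (\<integral>x. w x $ j * frechet_derivative \<phi> (at x) (axis i 1) + f x $ i $ j * \<phi> x \<partial>lebesgue_on K)"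
  proof (intro Bochner_Integration.integral_cong refl)
    fix x assume "x \<in> space (lebesgue_on K)"
    then have "x \<in> \<Omega>" using K by auto
    moreover have "(axis i 1 v* f x) $ j = f x $ i $ j"
      by (simp add: vector_matrix_mult_def axis_def if_distrib[of "\<lambda>c. c * _"] cong: if_cong)
    ultimately show "D x (axis i 1) = w x $ j * frechet_derivative \<phi> (at x) (axis i 1) + f x $ i $ j * \<phi> x"
      by (simp add: D_def)
  qed
  moreover have "integrable (lebesgue_on K) (\<lambda>x. w x $ j * frechet_derivative \<phi> (at x) (axis i 1))"
    by (intro integrable_continuous_compact[OF K(1)] continuous_intros continuous_on_subset[OF contw]
          continuous_on_subset[OF test_function_continuous(2) K(2)]) auto
  moreover have "integrable (lebesgue_on K) (\<lambda>x. f x $ i $ j * \<phi> x)"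
    by (intro integrable_continuous_compact[OF K(1)] continuous_intros continuous_on_subset[OF cont]
          continuous_on_subset[OF test_function_continuous(1) K(2)]) auto
  ultimately show ?thesis by (simp add: Bochner_Integration.integral_add)
qed

end

text \<open>
  Each term is integrated by parts, and both sides are summed. The terms \<open>w n\<close> are summable uniformly, the
  gradients only in \<open>L\<^sup>1\<close>; together with the boundedness of the test function and of its derivative on
  \<open>K\<close>, this is enough to exchange sum and integral.
\<close>

lemma weak_gradient_series:
  fixes w :: "nat \<Rightarrow> real^'k \<Rightarrow> real^'m" and f :: "nat \<Rightarrow> real^'k \<Rightarrow> real^'m^'k"
  assumes \<Omega>: "open \<Omega>" and K: "compact K" "K \<subseteq> \<Omega>"
    and der: "\<And>n x. (w n has_derivative (\<lambda>h. h v* f n x)) (at x)"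
    and cont: "\<And>n. continuous_on UNIV (f n)"
    and zero: "\<And>n x. x \<notin> K \<Longrightarrow> w n x = 0" "\<And>n x. x \<notin> K \<Longrightarrow> f n x = 0"
    and wB: "\<And>n x. norm (w n x) \<le> B n" "summable B"
    and ae: "AE x in lebesgue_on \<Omega>. summable (\<lambda>n. norm (f n x))"
    and fin: "(\<integral>\<^sup>+x. (\<Sum>n. ennreal (norm (f n x))) \<partial>lebesgue_on \<Omega>) < \<infinity>"
  shows "weak_gradient \<Omega> (\<lambda>x. \<Sum>n. w n x) (\<lambda>x. \<Sum>n. f n x)"
proof -
  let ?u = "\<lambda>x. \<Sum>n. w n x" and ?G = "\<lambda>x. \<Sum>n. f n x"
  have contw: "continuous_on UNIV (w n)" for n
    by (rule has_derivative_continuous_on[OF has_derivative_at_withinI[OF der]])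
  have contu: "continuous_on UNIV ?u"
  proof (rule uniform_limit_theorem[OF _ Weierstrass_m_test[OF wB]])
    show "\<forall>\<^sub>F n in sequentially. continuous_on UNIV (\<lambda>x. \<Sum>i<n. w i x)"
      by (intro always_eventually allI continuous_intros contw)
  qed simp
  have sw: "summable (\<lambda>n. w n x)" for x
    by (rule summable_norm_cancel, rule summable_comparison_test'[OF wB(2), of 0]) (use wB in auto)
  have \<Omega>L: "\<Omega> \<in> sets lebesgue" using \<Omega> by (simp add: borel_open)
  have KL: "K \<in> sets lebesgue" using K(1) by (simp add: compact_imp_closed borel_closed)
  have set_int: "set_integrable lebesgue A h \<longleftrightarrow> integrable (lebesgue_on A) h"
    if "A \<in> sets lebesgue" for A and h :: "real^'k \<Rightarrow> 'c::euclidean_space"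
    using that by (simp add: set_integrable_def integrable_restrict_space)
  have [measurable]: "f n \<in> borel_measurable (lebesgue_on A)" for n A
    using borel_measurable_continuous_onI[OF cont] by (intro measurable_restrict_space1 measurable_completion) simp
  have Gint: "integrable (lebesgue_on \<Omega>) ?G"
  proof (rule integrableI_bounded)
    show "?G \<in> borel_measurable (lebesgue_on \<Omega>)" by measurable
    have "(\<integral>\<^sup>+x. ennreal (norm (?G x)) \<partial>lebesgue_on \<Omega>) \<le> (\<integral>\<^sup>+x. (\<Sum>n. ennreal (norm (f n x))) \<partial>lebesgue_on \<Omega>)"
    proof (rule nn_integral_mono_AE, use ae in eventually_elim)
      fix x assume s: "summable (\<lambda>n. norm (f n x))"
      then have "(\<Sum>n. ennreal (norm (f n x))) = ennreal (\<Sum>n. norm (f n x))" by (intro suminf_ennreal2) auto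
      then show "ennreal (norm (?G x)) \<le> (\<Sum>n. ennreal (norm (f n x)))"
        using summable_norm[OF s] by (simp add: ennreal_leI)
    qed
    then show "(\<integral>\<^sup>+x. ennreal (norm (?G x)) \<partial>lebesgue_on \<Omega>) < \<infinity>" using fin by (rule order.strict_trans1)
  qed
  have finK: "(\<integral>\<^sup>+x. (\<Sum>n. ennreal (norm (f n x))) \<partial>lebesgue_on K) < \<infinity>"
  proof -
    have "(\<integral>\<^sup>+x. S x \<partial>lebesgue_on K) \<le> (\<integral>\<^sup>+x. S x \<partial>lebesgue_on \<Omega>)" for S :: "real^'k \<Rightarrow> ennreal"
    proof -
      have "(\<integral>\<^sup>+x. S x \<partial>lebesgue_on K) = (\<integral>\<^sup>+x. S x * indicator K x \<partial>lebesgue)"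
        using KL by (intro nn_integral_restrict_space) auto
      also have "\<dots> \<le> (\<integral>\<^sup>+x. S x * indicator \<Omega> x \<partial>lebesgue)"
        using K(2) by (intro nn_integral_mono) (auto simp: indicator_def)
      also have "\<dots> = (\<integral>\<^sup>+x. S x \<partial>lebesgue_on \<Omega>)"
        using \<Omega>L by (intro nn_integral_restrict_space[symmetric]) auto
      finally show ?thesis .
    qed
    then show ?thesis using fin by (rule order.strict_trans1)
  qed
  have fint: "integrable (lebesgue_on K) (f n)" for n
    by (intro integrable_continuous_compact K continuous_on_subset[OF cont]) auto
  have sumf: "summable (\<lambda>n. \<integral>x. norm (f n x) \<partial>lebesgue_on K)"
  proof (rule summable_suminf_not_top)
    have "(\<Sum>n. ennreal (\<integral>x. norm (f n x) \<partial>lebesgue_on K)) = (\<Sum>n. \<integral>\<^sup>+x. ennreal (norm (f n x)) \<partial>lebesgue_on K)"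
      using fint by (simp add: nn_integral_eq_integral)
    also have "\<dots> = (\<integral>\<^sup>+x. (\<Sum>n. ennreal (norm (f n x))) \<partial>lebesgue_on K)"
      by (rule nn_integral_suminf[symmetric]) measurable
    finally show "(\<Sum>n. ennreal (\<integral>x. norm (f n x) \<partial>lebesgue_on K)) \<noteq> top" using finK by simp
  qed simp
  have aeK: "AE x in lebesgue_on K. summable (\<lambda>n. norm (f n x))"
    using ae K(2) \<Omega>L KL by (simp add: AE_restrict_space_iff) (elim eventually_mono, blast)
  interpret KM: finite_measure "lebesgue_on K"
    using K(1) KL by (intro finite_measure_lebesgue_on bounded_set_imp_lmeasurable compact_imp_bounded)
  have main: "(LINT x:\<Omega>|lebesgue. ?u x $ j * frechet_derivative \<phi> (at x) (axis i 1)) =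
        - (LINT x:\<Omega>|lebesgue. ?G x $ i $ j * \<phi> x)" if \<phi>: "\<phi> \<in> C1c_on \<Omega>" for \<phi> i j
  proof -
    note tf = test_function_continuous[OF \<Omega> K \<phi>]
    define d where "d x = frechet_derivative \<phi> (at x) (axis i 1)" for x
    have dK: "continuous_on K d" "continuous_on K \<phi>"
      unfolding d_def using tf K(2) by (auto intro: continuous_on_subset)
    obtain C where C: "\<And>x. x \<in> K \<Longrightarrow> \<bar>d x\<bar> \<le> C" "\<And>x. x \<in> K \<Longrightarrow> \<bar>\<phi> x\<bar> \<le> C" "C \<ge> 0"
    proof -
      obtain C1 C2 where "\<And>x. x \<in> K \<Longrightarrow> \<bar>d x\<bar> \<le> C1" "\<And>x. x \<in> K \<Longrightarrow> \<bar>\<phi> x\<bar> \<le> C2"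
        using compact_imp_bounded[OF compact_continuous_image[OF dK(1) K(1)]]
          compact_imp_bounded[OF compact_continuous_image[OF dK(2) K(1)]]
        by (auto simp: bounded_iff)
      then show thesis using that[of "max 0 (max C1 C2)"] by fastforce
    qed
    have [measurable]: "d \<in> borel_measurable (lebesgue_on K)" "\<phi> \<in> borel_measurable (lebesgue_on K)"
      by (intro continuous_imp_measurable_on_sets_lebesgue dK KL)+
    have entry: "(\<lambda>M::real^'m^'k. M $ i $ j) \<in> borel_measurable borel"
      by (intro borel_measurable_continuous_onI continuous_intros)
    have [measurable]: "(\<lambda>x. f n x $ i $ j) \<in> borel_measurable (lebesgue_on K)" for n
      by (rule measurable_compose[OF _ entry]) measurable
    have [measurable]: "(\<lambda>x. ?G x $ i $ j) \<in> borel_measurable (lebesgue_on K)"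
      by (rule measurable_compose[OF _ entry]) measurable
    have nth_sum: "?u x $ j = (\<Sum>n. w n x $ j)" for x
      using bounded_linear.suminf[OF bounded_linear_vec_nth sw] by simp
    have i1: "integrable (lebesgue_on K) (\<lambda>x. w n x $ j * d x)" for n
      by (intro integrable_continuous_compact K continuous_intros continuous_on_subset[OF contw] dK) auto
    have i2: "integrable (lebesgue_on K) (\<lambda>x. f n x $ i $ j * \<phi> x)" for n
      by (intro integrable_continuous_compact K continuous_intros continuous_on_subset[OF cont] dK) auto
    have b1: "norm (w n x $ j * d x) \<le> B n * C" if "x \<in> K" for n x
      unfolding norm_mult using C(1)[OF that] component_le_norm_cart[of "w n x" j] wB(1)[of n x]
      by (intro mult_mono) auto
    have b2: "norm (f n x $ i $ j * \<phi> x) \<le> norm (f n x) * C" if "x \<in> K" for n x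
      unfolding norm_mult
      using C(2)[OF that] component_le_norm_cart[of "f n x $ i" j] Finite_Cartesian_Product.norm_nth_le[where x = "f n x" and i = i]
      by (intro mult_mono) auto
    have B0: "0 \<le> B n" for n using wB(1)[of n 0] norm_ge_zero order_trans by blast
    have "(LINT x:\<Omega>|lebesgue. ?u x $ j * d x) = (\<integral>x. ?u x $ j * d x \<partial>lebesgue_on K)"
      by (rule set_lebesgue_integral_vanishing_outside[OF K(2) KL]) (simp add: zero)
    also have "\<dots> = (\<integral>x. (\<Sum>n. w n x $ j * d x) \<partial>lebesgue_on K)"
      using bounded_linear.summable[OF bounded_linear_vec_nth sw] by (simp add: nth_sum suminf_mult2)
    also have "\<dots> = (\<Sum>n. \<integral>x. w n x $ j * d x \<partial>lebesgue_on K)"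
    proof (rule integral_suminf[OF i1])
      show "AE x in lebesgue_on K. summable (\<lambda>n. norm (w n x $ j * d x))"
      proof (rule AE_I2)
        fix x assume "x \<in> space (lebesgue_on K)"
        then have "x \<in> K" by simp
        show "summable (\<lambda>n. norm (w n x $ j * d x))"
          by (rule summable_comparison_test'[OF summable_mult2[OF wB(2), of C], of 0])
            (use b1[OF \<open>x \<in> K\<close>] in auto)
      qed
      have "(\<integral>x. norm (w n x $ j * d x) \<partial>lebesgue_on K) \<le> B n * C * measure (lebesgue_on K) K" for n
      proof -
        have "(\<integral>x. norm (w n x $ j * d x) \<partial>lebesgue_on K) \<le> (\<integral>x. B n * C \<partial>lebesgue_on K)"
          by (rule integral_mono) (use i1 b1 in auto)
        also have "\<dots> = B n * C * measure (lebesgue_on K) K" by simp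
        finally show ?thesis .
      qed
      then show "summable (\<lambda>n. \<integral>x. norm (w n x $ j * d x) \<partial>lebesgue_on K)"
        by (intro summable_comparison_test'[OF summable_mult2[OF summable_mult2[OF wB(2), of C], of "measure (lebesgue_on K) K"], of 0]) auto
    qed
    also have "\<dots> = (\<Sum>n. - (\<integral>x. f n x $ i $ j * \<phi> x \<partial>lebesgue_on K))"
      unfolding d_def
      by (subst integration_by_parts_C1[OF \<Omega> K \<phi> der cont zero]) auto
    also have "\<dots> = - (\<Sum>n. \<integral>x. f n x $ i $ j * \<phi> x \<partial>lebesgue_on K)
        \<and> (\<Sum>n. \<integral>x. f n x $ i $ j * \<phi> x \<partial>lebesgue_on K) = (\<integral>x. (\<Sum>n. f n x $ i $ j * \<phi> x) \<partial>lebesgue_on K)"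
    proof
      have ae2: "AE x in lebesgue_on K. summable (\<lambda>n. norm (f n x $ i $ j * \<phi> x))"
        using aeK AE_space
      proof eventually_elim
        fix x assume s: "summable (\<lambda>n. norm (f n x))" and "x \<in> space (lebesgue_on K)"
        then have "x \<in> K" by simp
        show "summable (\<lambda>n. norm (f n x $ i $ j * \<phi> x))"
          by (rule summable_comparison_test'[OF summable_mult2[OF s, of C], of 0])
            (use b2[OF \<open>x \<in> K\<close>] in auto)
      qed
      have le: "(\<integral>x. norm (f n x $ i $ j * \<phi> x) \<partial>lebesgue_on K) \<le> (\<integral>x. norm (f n x) \<partial>lebesgue_on K) * C" for n
      proof -
        have "(\<integral>x. norm (f n x $ i $ j * \<phi> x) \<partial>lebesgue_on K) \<le> (\<integral>x. norm (f n x) * C \<partial>lebesgue_on K)"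
          by (rule integral_mono) (use i2 b2 fint in auto)
        then show ?thesis by simp
      qed
      have su: "summable (\<lambda>n. \<integral>x. norm (f n x $ i $ j * \<phi> x) \<partial>lebesgue_on K)"
        by (rule summable_comparison_test'[OF summable_mult2[OF sumf, of C], of 0]) (use le in auto)
      show "(\<Sum>n. \<integral>x. f n x $ i $ j * \<phi> x \<partial>lebesgue_on K) = (\<integral>x. (\<Sum>n. f n x $ i $ j * \<phi> x) \<partial>lebesgue_on K)"
        by (rule integral_suminf[OF i2 ae2 su, symmetric])
      have "summable (\<lambda>n. \<integral>x. f n x $ i $ j * \<phi> x \<partial>lebesgue_on K)"
        using sums_integral[OF i2 ae2 su] by (rule sums_summable)
      then show "(\<Sum>n. - (\<integral>x. f n x $ i $ j * \<phi> x \<partial>lebesgue_on K)) = - (\<Sum>n. \<integral>x. f n x $ i $ j * \<phi> x \<partial>lebesgue_on K)"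
        by (rule suminf_minus)
    qed
    finally have "(LINT x:\<Omega>|lebesgue. ?u x $ j * d x) = - (\<integral>x. (\<Sum>n. f n x $ i $ j * \<phi> x) \<partial>lebesgue_on K)"
      by simp
    also have "(\<integral>x. (\<Sum>n. f n x $ i $ j * \<phi> x) \<partial>lebesgue_on K) = (\<integral>x. ?G x $ i $ j * \<phi> x \<partial>lebesgue_on K)"
    proof (rule integral_cong_AE)
      show "AE x in lebesgue_on K. (\<Sum>n. f n x $ i $ j * \<phi> x) = ?G x $ i $ j * \<phi> x"
        using aeK
      proof eventually_elim
        fix x assume "summable (\<lambda>n. norm (f n x))"
        then have s: "summable (\<lambda>n. f n x)" by (rule summable_norm_cancel)
        have bl: "bounded_linear (\<lambda>M::real^'m^'k. M $ i $ j)"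
          by (rule bounded_linear_compose[of "\<lambda>v. v $ j" "\<lambda>M. M $ i"]) (rule bounded_linear_vec_nth)+
        show "(\<Sum>n. f n x $ i $ j * \<phi> x) = ?G x $ i $ j * \<phi> x"
          using bounded_linear.suminf[OF bl s] suminf_mult2[OF bounded_linear.summable[OF bl s]] by simp
      qed
    qed measurable
    also have "\<dots> = (LINT x:\<Omega>|lebesgue. ?G x $ i $ j * \<phi> x)"
      by (rule set_lebesgue_integral_vanishing_outside[OF K(2) KL, symmetric]) (simp add: zero)
    finally show ?thesis by (simp add: d_def)
  qed
  show ?thesis
    unfolding weak_gradient_def locally_integrable_on_def
  proof (intro conjI allI impI ballI main)
    fix A assume A: "compact A \<and> A \<subseteq> \<Omega>"
    then have AL: "A \<in> sets lebesgue" by (simp add: compact_imp_closed borel_closed)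
    show "set_integrable lebesgue A ?u"
      unfolding set_int[OF AL] using A by (intro integrable_continuous_compact continuous_on_subset[OF contu]) auto
    have "set_integrable lebesgue \<Omega> ?G" unfolding set_int[OF \<Omega>L] by (rule Gint)
    then show "set_integrable lebesgue A ?G" by (rule set_integrable_subset) (use A AL in auto)
  qed auto
qed

section \<open>Corrections along the tree of dyadic cubes\<close>

text \<open>
  The line is cut into the intervals \<open>[j * d, (j + 1) * d)\<close>, and \<open>centre1 d r\<close> is the midpoint of the one that contains \<open>r\<close>.
  Cubes are represented by their centres: \<open>x\<close> and \<open>y\<close> lie in the same cube of side \<open>d\<close> iff
  \<open>centre d x = centre d y\<close>.
\<close>

definition centre1 :: "real \<Rightarrow> real \<Rightarrow> real" where
  "centre1 d r = (of_int \<lfloor>r / d\<rfloor> + 1/2) * d"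

definition centre :: "real \<Rightarrow> real^'k \<Rightarrow> real^'k" where
  "centre d x = (\<chi> i. centre1 d (x $ i))"

lemma centre1_eq_iff: "d > 0 \<Longrightarrow> centre1 d r = centre1 d s \<longleftrightarrow> \<lfloor>r / d\<rfloor> = \<lfloor>s / d\<rfloor>"
  by (simp add: centre1_def)

lemma cell_bounds:
  assumes "d > 0"
  shows "centre1 d r - d/2 \<le> r" "r < centre1 d r + d/2"
proof -
  have "of_int \<lfloor>r / d\<rfloor> * d \<le> r / d * d" "r / d * d < (of_int \<lfloor>r / d\<rfloor> + 1) * d"
    using assms by (intro mult_right_mono mult_strict_right_mono; linarith)+
  then show "centre1 d r - d/2 \<le> r" "r < centre1 d r + d/2"
    using assms by (simp_all add: centre1_def algebra_simps)
qed

lemma cell_unique: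
  assumes "d > 0" "centre1 d r - d/2 \<le> s" "s < centre1 d r + d/2"
  shows "centre1 d s = centre1 d r"
proof -
  have "of_int \<lfloor>r / d\<rfloor> * d \<le> s" "s < (of_int \<lfloor>r / d\<rfloor> + 1) * d"
    using assms by (simp_all add: centre1_def algebra_simps)
  then have "of_int \<lfloor>r / d\<rfloor> \<le> s / d" "s / d < of_int \<lfloor>r / d\<rfloor> + 1"
    using assms(1) by (simp_all add: field_simps)
  then have "\<lfloor>s / d\<rfloor> = \<lfloor>r / d\<rfloor>" by (intro floor_unique)
  then show ?thesis by (simp add: centre1_def)
qed

lemma centre1_dist: "d > 0 \<Longrightarrow> \<bar>r - centre1 d r\<bar> \<le> d/2"
  using cell_bounds[of d r] by linarith

lemma other_cell_dist: "d > 0 \<Longrightarrow> centre1 d s \<noteq> centre1 d r \<Longrightarrow> d/2 \<le> \<bar>s - centre1 d r\<bar>"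
  using cell_unique[of d r s] by linarith

text \<open>
  A point at distance at least \<open>a\<close> from the grid is well inside its interval, and its \<open>a\<close>-neighbourhood lies in the
  same interval.
\<close>

lemma off_grid:
  assumes "d > 0" "\<And>j::int. a \<le> \<bar>r - of_int j * d\<bar>"
  shows "\<bar>r - centre1 d r\<bar> \<le> d/2 - a"
    and "\<bar>r - s\<bar> < a \<Longrightarrow> centre1 d s = centre1 d r"
proof -
  have e: "of_int \<lfloor>r / d\<rfloor> * d = centre1 d r - d/2" "of_int (\<lfloor>r / d\<rfloor> + 1) * d = centre1 d r + d/2"
    by (simp_all add: centre1_def algebra_simps)
  have "a \<le> r - (centre1 d r - d/2)" "a \<le> centre1 d r + d/2 - r"
    using assms(2)[of "\<lfloor>r / d\<rfloor>"] assms(2)[of "\<lfloor>r / d\<rfloor> + 1"] cell_bounds[OF assms(1), of r]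
    unfolding e by linarith+
  then show "\<bar>r - centre1 d r\<bar> \<le> d/2 - a" "\<bar>r - s\<bar> < a \<Longrightarrow> centre1 d s = centre1 d r"
    using cell_unique[OF assms(1), of r s] by linarith+
qed

text \<open>
  The dyadic grids are nested: the index of the interval of length \<open>d\<close> is half the index of the interval of length
  \<open>d / 2\<close>, rounded down.
\<close>

lemma centre1_nested:
  assumes "d > 0" "centre1 (d/2) r = centre1 (d/2) s"
  shows "centre1 d r = centre1 d s"
proof -
  have "\<lfloor>r / d\<rfloor> = \<lfloor>r / (d/2)\<rfloor> div 2" for r
  proof -
    have "\<lfloor>(r / (d/2)) / real_of_int 2\<rfloor> = \<lfloor>r / (d/2)\<rfloor> div 2"
      by (rule floor_divide_real_eq_div) simp
    moreover have "(r / (d/2)) / real_of_int 2 = r / d" by simp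
    ultimately show ?thesis by (simp only:)
  qed
  moreover have "\<lfloor>r / (d/2)\<rfloor> = \<lfloor>s / (d/2)\<rfloor>"
    using assms centre1_eq_iff[of "d/2" r s] by linarith
  ultimately have "\<lfloor>r / d\<rfloor> = \<lfloor>s / d\<rfloor>" by (simp only:)
  then show ?thesis using centre1_eq_iff[OF assms(1)] by blast
qed

lemma norm_centre_le:
  fixes x :: "real^'k"
  assumes "d > 0"
  shows "norm (x - centre d x) \<le> real CARD('k) * (d/2)"
proof (rule norm_le_card_times)
  fix i
  have "(x - centre d x) $ i = x $ i - centre1 d (x $ i)" by (simp add: centre_def)
  then show "\<bar>(x - centre d x) $ i\<bar> \<le> d/2" using centre1_dist[OF assms] by (simp only:)
qed

text \<open>
  The data of the construction: the side \<open>\<delta>\<close> of the largest cubes, the relative gap widths \<open>t\<close>, the constant \<open>C\<close> of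
  \<open>profile_bounds\<close>, and the field \<open>F\<close> with its bound \<open>M\<close> and its Lipschitz constant \<open>L\<close> over \<open>D\<close> and the unit ball.
  A union \<open>good\<close> of cubes of side \<open>\<delta>\<close> carries the construction; \<open>D\<close> contains these cubes and the centres of
  their subcubes. The condition \<open>2 * k * M * \<delta> \<le> 1\<close>, where \<open>k\<close> is the dimension, keeps the values of all affine maps at the centres in the unit ball.
\<close>

locale cube_construction =
  fixes \<delta> :: real and t :: "nat \<Rightarrow> real" and C M L :: real
    and F :: "(real^'k) \<times> (real^'m) \<Rightarrow> real^'m^'k"
    and good :: "real^'k \<Rightarrow> bool" and D :: "(real^'k) set"
  assumes \<delta>: "0 < \<delta>" "\<delta> \<le> 1"
    and t: "\<And>n. 0 < t n" "\<And>n. t n \<le> 1/2"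
    and C: "C \<ge> 1"
      "\<And>t z. 0 < t \<Longrightarrow> t \<le> 1/2 \<Longrightarrow> norm (prof t (z::real^'k)) \<le> C"
      "\<And>t z. 0 < t \<Longrightarrow> t \<le> 1/2 \<Longrightarrow> norm (dprof t (z::real^'k)) \<le> C / t"
      "\<And>t y z. 0 < t \<Longrightarrow> t \<le> 1/2 \<Longrightarrow> norm (dprof t (y::real^'k) - dprof t z) \<le> C / t\<^sup>2 * norm (y - z)"
    and good_cell: "\<And>x y. centre \<delta> x = centre \<delta> y \<Longrightarrow> good x \<Longrightarrow> good y"
    and good_D: "\<And>x. good x \<Longrightarrow> x \<in> D" "\<And>x n. good x \<Longrightarrow> centre (\<delta> / 2^n) x \<in> D"
    and F_bound: "\<And>z v. z \<in> D \<Longrightarrow> norm v \<le> 1 \<Longrightarrow> norm (F (z, v)) \<le> M"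
    and F_lip: "\<And>z v z' v'. z \<in> D \<Longrightarrow> norm v \<le> 1 \<Longrightarrow> z' \<in> D \<Longrightarrow> norm v' \<le> 1 \<Longrightarrow>
       norm (F (z, v) - F (z', v')) \<le> L * (norm (z - z') + norm (v - v'))"
    and L0: "0 \<le> L" and M0: "0 \<le> M" and small: "2 * real CARD('k) * M * \<delta> \<le> 1"
begin

definition d :: "nat \<Rightarrow> real" where "d n = \<delta> / 2^n"

abbreviation c :: "nat \<Rightarrow> real^'k \<Rightarrow> real^'k" where "c n \<equiv> centre (d n)"

text \<open>
  Along the chain of cubes of \<open>x\<close>, the affine map of generation \<open>n\<close> is \<open>y \<mapsto> b n x + (y - c n x) v* S n x\<close>, with value
  \<open>b n x\<close> and slope \<open>S n x = F (c n x, b n x)\<close> at the centre \<open>c n x\<close>. The recursion says that the value at the next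
  centre is the one given by the map of the parent cube. Hence the difference of the maps of generations \<open>n\<close> and \<open>n - 1\<close>
  is linear in \<open>y - c n x\<close>, with the slope \<open>a n x\<close>.
\<close>

primrec b :: "nat \<Rightarrow> real^'k \<Rightarrow> real^'m" where
  "b 0 x = 0"
| "b (Suc n) x = b n x + (c (Suc n) x - c n x) v* (if good x then F (c n x, b n x) else 0)"

definition S :: "nat \<Rightarrow> real^'k \<Rightarrow> real^'m^'k" where
  "S n x = (if good x then F (c n x, b n x) else 0)"

definition a :: "nat \<Rightarrow> real^'k \<Rightarrow> real^'m^'k" where
  "a n x = S n x - (case n of 0 \<Rightarrow> 0 | Suc m \<Rightarrow> S m x)"

text \<open>
  The correction of generation \<open>n\<close> is \<open>(x - c n x) v* a n x\<close>, cut off near the boundary of the cube by the rescaled profile;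
  \<open>f n\<close> is its gradient. The gaps of generation \<open>n\<close> form the open set \<open>E n\<close>; outside it the cut-off is the identity.
\<close>

definition w :: "nat \<Rightarrow> real^'k \<Rightarrow> real^'m" where
  "w n x = d n *\<^sub>R (prof (t n) ((x - c n x) /\<^sub>R d n) v* a n x)"

definition f :: "nat \<Rightarrow> real^'k \<Rightarrow> real^'m^'k" where
  "f n x = dprof (t n) ((x - c n x) /\<^sub>R d n) ** a n x"

definition E :: "nat \<Rightarrow> (real^'k) set" where
  "E n = {x. \<exists>i (j::int). \<bar>x $ i - of_int j * d n\<bar> < t n * d n}"

definition \<CC> :: "(real^'k) set" where
  "\<CC> = {x. good x \<and> (\<forall>n. x \<notin> E n)}"

definition slope_const :: real where "slope_const = 2 * L * real CARD('k) * (1 + M)"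

definition A :: real where "A = max (M / \<delta>) slope_const"

lemma d_pos: "0 < d n" and d_le: "d n \<le> \<delta>" and d_le_1: "d n \<le> 1" and d_0: "d 0 = \<delta>"
  and d_Suc: "d (Suc n) = d n / 2"
proof -
  show "0 < d n" "d 0 = \<delta>" "d (Suc n) = d n / 2" using \<delta> by (simp_all add: d_def)
  show "d n \<le> \<delta>" using \<delta> one_le_power[of "2::real" n] by (simp add: d_def divide_le_eq)
  then show "d n \<le> 1" using \<delta> by simp
qed

lemma gap_width: "0 < t n * d n" "t n * d n \<le> d n / 2"
  using t[of n] d_pos[of n] mult_right_mono[of "t n" "1/2" "d n"] by simp_all

lemma A_nonneg: "0 \<le> A" "0 \<le> slope_const"
  using L0 M0 \<delta> by (auto simp: A_def slope_const_def le_max_iff_disj)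

lemma good_cong:
  assumes "c 0 x = c 0 y"
  shows "good x = good y"
proof -
  have "centre \<delta> x = centre \<delta> y" using assms unfolding d_0 .
  from good_cell[OF this] good_cell[OF this[symmetric]] show ?thesis by blast
qed

lemma c_nested:
  assumes "c (Suc n) x = c (Suc n) y"
  shows "c n x = c n y"
proof -
  have "centre1 (d n / 2) (x $ i) = centre1 (d n / 2) (y $ i)" for i
    using assms by (simp add: centre_def vec_eq_iff d_Suc)
  from centre1_nested[OF d_pos this] show ?thesis by (simp add: centre_def)
qed

lemma c_mono: "c n x = c n y \<Longrightarrow> m \<le> n \<Longrightarrow> c m x = c m y"
proof (induction n)
  case (Suc n)
  show ?case
  proof (cases "m = Suc n")
    case False
    then have "m \<le> n" using Suc.prems(2) by linarith
    then show ?thesis by (rule Suc.IH[OF c_nested[OF Suc.prems(1)]])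
  next
    case True
    show ?thesis unfolding True by (rule Suc.prems(1))
  qed
qed simp

text \<open>
  The functions \<open>b n\<close>, \<open>S n\<close> and \<open>a n\<close> are constant on the cubes of generation \<open>n\<close>, because the cube of generation \<open>n\<close>
  determines all cubes that contain it.
\<close>

lemma b_cong: "c n x = c n y \<Longrightarrow> b n x = b n y"
proof (induction n)
  case (Suc n)
  have "c n x = c n y" by (rule c_nested[OF Suc.prems])
  moreover have "good x = good y" by (rule good_cong[OF c_mono[OF Suc.prems]]) simp
  ultimately show ?case using Suc.IH Suc.prems by simp
qed simp

lemma S_cong:
  assumes "c n x = c n y"
  shows "S n x = S n y"
proof -
  have "b n x = b n y" "good x = good y"
    by (rule b_cong[OF assms], rule good_cong[OF c_mono[OF assms]]) simp
  then show ?thesis using assms by (simp add: S_def)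
qed

lemma a_cong:
  assumes "c n x = c n y"
  shows "a n x = a n y"
proof (cases n)
  case 0
  have "S n x = S n y" by (rule S_cong[OF assms])
  then show ?thesis using 0 by (simp add: a_def)
next
  case (Suc m)
  have "c (Suc m) x = c (Suc m) y" using assms unfolding Suc .
  then have "S (Suc m) x = S (Suc m) y" "S m x = S m y"
    by (rule S_cong, rule S_cong[OF c_nested])
  then show ?thesis by (simp add: a_def Suc)
qed

lemma not_good: "\<not> good x \<Longrightarrow> b n x = 0 \<and> S n x = 0 \<and> a n x = 0 \<and> w n x = 0 \<and> f n x = 0"
proof -
  assume ng: "\<not> good x"
  have "b n x = 0" by (induction n) (use ng in auto)
  moreover have S: "S n x = 0" for n using ng by (simp add: S_def)
  moreover have "a n x = 0" by (simp add: a_def S split: nat.split)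
  moreover have "w n x = 0" "f n x = 0"
    using \<open>a n x = 0\<close> by (simp_all add: w_def f_def)
  ultimately show ?thesis by simp
qed

lemma c_step: "norm (c (Suc n) x - c n x) \<le> real CARD('k) * d n"
proof -
  have "norm (c (Suc n) x - c n x) \<le> norm (x - c n x) + norm (x - c (Suc n) x)"
    using norm_triangle_ineq4[of "x - c n x" "x - c (Suc n) x"] by (simp add: algebra_simps)
  also have "\<dots> \<le> real CARD('k) * (d n / 2) + real CARD('k) * (d (Suc n) / 2)"
    by (intro add_mono norm_centre_le d_pos)
  also have "\<dots> = real CARD('k) * d n * (3/4)" by (simp add: d_Suc)
  also have "\<dots> \<le> real CARD('k) * d n * 1" using d_pos[of n] by (intro mult_left_mono) auto
  finally show ?thesis by simp
qed

lemma c_D: "good x \<Longrightarrow> c n x \<in> D"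
  using good_D(2) by (simp add: d_def)

lemma b_bound: "norm (b n x) \<le> 2 * real CARD('k) * M * (\<delta> - d n)" and b_le_1: "norm (b n x) \<le> 1"
proof -
  have le1: "2 * real CARD('k) * M * (\<delta> - d n) \<le> 1" for n
    by (rule order_trans[OF mult_left_mono small]) (use d_pos[of n] M0 in auto)
  show bn: "norm (b n x) \<le> 2 * real CARD('k) * M * (\<delta> - d n)" for n
  proof (cases "good x")
    case True
    show ?thesis
    proof (induction n)
      case 0 then show ?case by (simp add: d_0)
    next
      case (Suc n)
      have "norm (b n x) \<le> 1" using Suc le1[of n] by simp
      then have "norm (F (c n x, b n x)) \<le> M" by (intro F_bound c_D True)
      then have "norm ((c (Suc n) x - c n x) v* F (c n x, b n x)) \<le> real CARD('k) * d n * M"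
        by (intro order_trans[OF norm_vector_matrix_mult_le] mult_mono c_step) (use d_pos[of n] in auto)
      then have "norm (b (Suc n) x) \<le> 2 * real CARD('k) * M * (\<delta> - d n) + real CARD('k) * d n * M"
        using Suc True by (simp add: order_trans[OF norm_triangle_ineq add_mono])
      also have "\<dots> = 2 * real CARD('k) * M * (\<delta> - d (Suc n))" by (simp add: d_Suc algebra_simps)
      finally show ?case .
    qed
  next
    case False
    then show ?thesis using not_good[of x n] M0 d_le[of n] by simp
  qed
  show "norm (b n x) \<le> 1" using bn[of n] le1[of n] by simp
qed

lemma S_bound: "norm (S n x) \<le> M"
  using F_bound[OF c_D b_le_1, of x n n x] M0 by (simp add: S_def)

lemma b_step: "norm (b (Suc n) x - b n x) \<le> real CARD('k) * d n * M"
proof -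
  have "b (Suc n) x - b n x = (c (Suc n) x - c n x) v* S n x" by (simp add: S_def)
  then have "norm (b (Suc n) x - b n x) \<le> norm (c (Suc n) x - c n x) * norm (S n x)"
    by (simp only: norm_vector_matrix_mult_le)
  also have "\<dots> \<le> real CARD('k) * d n * M"
    using d_pos[of n] by (intro mult_mono c_step S_bound) auto
  finally show ?thesis .
qed

text \<open>
  The slopes \<open>S n x\<close> and \<open>S (Suc n) x\<close> are values of \<open>F\<close> at two successive pairs of centre and value. The centres are at distance
  at most \<open>k * d n\<close>, with the dimension \<open>k\<close>, and the values at most \<open>M\<close> times as far apart.
\<close>

lemma a_bounds: "norm (a 0 x) \<le> M" "norm (a (Suc n) x) \<le> slope_const * d (Suc n)"
proof -
  show "norm (a 0 x) \<le> M" using S_bound[of 0 x] by (simp add: a_def)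
  show "norm (a (Suc n) x) \<le> slope_const * d (Suc n)"
  proof (cases "good x")
    case True
    have "norm (a (Suc n) x) \<le> L * (norm (c (Suc n) x - c n x) + norm (b (Suc n) x - b n x))"
      using True F_lip[OF c_D[OF True] b_le_1 c_D[OF True] b_le_1, of "Suc n" "Suc n" x n n x]
      by (simp add: a_def S_def del: b.simps)
    also have "\<dots> \<le> L * (real CARD('k) * d n + real CARD('k) * d n * M)"
      using L0 by (intro mult_left_mono add_mono c_step b_step)
    also have "\<dots> = slope_const * d (Suc n)" by (simp add: slope_const_def d_Suc algebra_simps)
    finally show ?thesis .
  next
    case False
    then show ?thesis using not_good[of x "Suc n"] A_nonneg d_pos[of "Suc n"] by simp
  qed
qed

lemma a_bound: "norm (a n x) \<le> A * d n"
proof (cases n)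
  case 0
  have "M = M / \<delta> * d 0" using \<delta> by (simp add: d_0)
  also have "\<dots> \<le> A * d 0" using d_pos[of 0] by (intro mult_right_mono) (auto simp: A_def)
  finally show ?thesis using a_bounds(1)[of x] 0 by simp
next
  case (Suc m)
  have "slope_const * d n \<le> A * d n" using d_pos[of n] by (intro mult_right_mono) (auto simp: A_def)
  then show ?thesis using a_bounds(2)[of m x] Suc by simp
qed

text \<open>
  Close to \<open>x\<close>, the centre and the slope can be frozen at \<open>x\<close>. This is clear inside the cube of \<open>x\<close>. If \<open>y\<close> lies in another cube, then \<open>y\<close>
  is so close to a face that the cut-off vanishes, with either of the two centres. So \<open>w n\<close> and
  \<open>f n\<close> are locally given by smooth formulas, also across the faces.
\<close>

lemma local_form:
  assumes "norm (y - x) < t n * d n / 2"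
  shows "w n y = d n *\<^sub>R (prof (t n) ((y - c n x) /\<^sub>R d n) v* a n x)"
    and "f n y = dprof (t n) ((y - c n x) /\<^sub>R d n) ** a n x"
proof -
  have "w n y = d n *\<^sub>R (prof (t n) ((y - c n x) /\<^sub>R d n) v* a n x) \<and>
        f n y = dprof (t n) ((y - c n x) /\<^sub>R d n) ** a n x"
  proof (cases "c n y = c n x")
    case True
    then show ?thesis using a_cong[OF True] by (simp add: w_def f_def)
  next
    case False
    then obtain i where i: "centre1 (d n) (y $ i) \<noteq> centre1 (d n) (x $ i)"
      by (auto simp: centre_def vec_eq_iff)
    have "\<bar>y $ i - x $ i\<bar> < t n * d n / 2"
      using component_le_norm_cart[of "y - x" i] assms by simp
    moreover have "d n / 2 \<le> \<bar>x $ i - centre1 (d n) (y $ i)\<bar>" "d n / 2 \<le> \<bar>y $ i - centre1 (d n) (x $ i)\<bar>"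
      using other_cell_dist[OF d_pos] i by auto
    ultimately have "d n / 2 - t n * d n / 2 \<le> \<bar>y $ i - centre1 (d n) (y $ i)\<bar>"
       "d n / 2 - t n * d n / 2 \<le> \<bar>y $ i - centre1 (d n) (x $ i)\<bar>" using gap_width(1)[of n] by linarith+
    then have o: "1/2 - t n / 2 \<le> \<bar>((y - c n y) /\<^sub>R d n) $ i\<bar>" "1/2 - t n / 2 \<le> \<bar>((y - c n x) /\<^sub>R d n) $ i\<bar>"
      using d_pos[of n] by (simp_all add: centre_def abs_mult field_simps)
    show ?thesis
      unfolding w_def f_def prof_outside[OF t(1) t(2) o(1)] prof_outside[OF t(1) t(2) o(2)] by simp
  qed
  then show "w n y = d n *\<^sub>R (prof (t n) ((y - c n x) /\<^sub>R d n) v* a n x)"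
    "f n y = dprof (t n) ((y - c n x) /\<^sub>R d n) ** a n x" by auto
qed

lemma w_derivative: "(w n has_derivative (\<lambda>h. h v* f n x)) (at x)"
proof -
  let ?z = "\<lambda>y. (y - c n x) /\<^sub>R d n"
  have z: "(?z has_derivative (\<lambda>h. h /\<^sub>R d n)) (at x)"
    by (auto intro!: derivative_eq_intros)
  have "((\<lambda>y. prof (t n) (?z y)) has_derivative (\<lambda>h. (h /\<^sub>R d n) v* dprof (t n) (?z x))) (at x)"
    by (rule has_derivative_compose[OF z prof_has_derivative])
  moreover have bl: "bounded_linear (\<lambda>v::real^'k. v v* a n x)"
    by (rule bounded_linear_intro[where K = "norm (a n x)"])
      (simp_all add: vector_matrix_left_distrib scaleR_vector_matrix_assoc norm_vector_matrix_mult_le)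
  ultimately have "((\<lambda>y. prof (t n) (?z y) v* a n x) has_derivative
      (\<lambda>h. ((h /\<^sub>R d n) v* dprof (t n) (?z x)) v* a n x)) (at x)"
    by (rule bounded_linear.has_derivative[rotated])
  then have "((\<lambda>y. d n *\<^sub>R (prof (t n) (?z y) v* a n x)) has_derivative
      (\<lambda>h. d n *\<^sub>R (((h /\<^sub>R d n) v* dprof (t n) (?z x)) v* a n x))) (at x)"
    by (rule has_derivative_scaleR_right)
  moreover have "d n *\<^sub>R (((h /\<^sub>R d n) v* dprof (t n) (?z x)) v* a n x) = h v* f n x" for h
  proof -
    have "d n *\<^sub>R (((h /\<^sub>R d n) v* dprof (t n) (?z x)) v* a n x)
        = (d n *\<^sub>R (h /\<^sub>R d n)) v* (dprof (t n) (?z x) ** a n x)"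
      by (simp only: vector_matrix_mul_assoc scaleR_vector_matrix_assoc)
    also have "d n *\<^sub>R (h /\<^sub>R d n) = h" using d_pos[of n] by simp
    finally show ?thesis by (simp add: f_def)
  qed
  ultimately have "((\<lambda>y. d n *\<^sub>R (prof (t n) (?z y) v* a n x)) has_derivative (\<lambda>h. h v* f n x)) (at x)"
    by simp
  then show ?thesis
    by (rule has_derivative_transform_within_open[where s = "ball x (t n * d n / 2)"])
      (use gap_width(1)[of n] local_form(1)[of _ x n] in \<open>auto simp: dist_norm norm_minus_commute\<close>)
qed

lemma f_lipschitz_near:
  assumes "norm (x - y) < t n * d n / 2"
  shows "norm (f n x - f n y) \<le> C * A / (t n)\<^sup>2 * norm (x - y)"
proof -
  have yy: "norm (y - y) < t n * d n / 2" using gap_width(1)[of n] by simp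
  have "f n x - f n y = (dprof (t n) ((x - c n y) /\<^sub>R d n) - dprof (t n) ((y - c n y) /\<^sub>R d n)) ** a n y"
    unfolding local_form(2)[OF assms] local_form(2)[OF yy]
    by (simp add: vec_eq_iff matrix_matrix_mult_def left_diff_distrib sum_subtractf)
  also have "norm \<dots> \<le> (C / (t n)\<^sup>2 * norm ((x - c n y) /\<^sub>R d n - (y - c n y) /\<^sub>R d n)) * (A * d n)"
    by (intro order_trans[OF norm_matrix_mult_le] mult_mono a_bound C t)
      (use C(1) in auto)
  also have "(x - c n y) /\<^sub>R d n - (y - c n y) /\<^sub>R d n = (x - y) /\<^sub>R d n"
    by (simp add: scaleR_diff_right[symmetric])
  also have "norm ((x - y) /\<^sub>R d n) = norm (x - y) / d n"
    using d_pos[of n] by (simp add: divide_inverse)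
  also have "(C / (t n)\<^sup>2 * (norm (x - y) / d n)) * (A * d n) = C * A / (t n)\<^sup>2 * norm (x - y)"
    using d_pos[of n] by simp
  finally show ?thesis .
qed

lemma off_E:
  assumes "x \<notin> E n"
  shows "w n x = (x - c n x) v* a n x" "f n x = a n x"
    and "norm (x - y) < t n * d n \<Longrightarrow> c n y = c n x"
proof -
  have g: "\<And>j::int. t n * d n \<le> \<bar>x $ i - of_int j * d n\<bar>" for i
    using assms by (auto simp: E_def not_less)
  have "\<bar>x $ i - centre1 (d n) (x $ i)\<bar> \<le> d n / 2 - t n * d n" for i
    by (rule off_grid(1)[OF d_pos g])
  then have "\<bar>((x - c n x) /\<^sub>R d n) $ i\<bar> \<le> 1/2 - t n" for i
    using d_pos[of n] by (simp add: centre_def abs_mult field_simps)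
  note p = prof_inside[OF t this]
  show "f n x = a n x" by (simp add: f_def p)
  show "w n x = (x - c n x) v* a n x"
    using d_pos[of n] by (simp add: w_def p scaleR_vector_matrix_assoc[symmetric])
  assume xy: "norm (x - y) < t n * d n"
  have "centre1 (d n) (y $ i) = centre1 (d n) (x $ i)" for i
    by (rule off_grid(2)[OF d_pos g]) (use component_le_norm_cart[of "x - y" i] xy in simp)
  then show "c n y = c n x" by (simp add: centre_def)
qed

text \<open>
  The pointwise size of \<open>f n\<close>: it is at most that of the slope \<open>a n\<close> off the gaps, and larger by a factor of order \<open>1 / t n\<close> in
  the gaps.
\<close>

definition g :: "nat \<Rightarrow> real^'k \<Rightarrow> real" where
  "g n x = A * d n * (1 + C / t n * indicat_real (E n) x)"

lemma g_nonneg: "0 \<le> g n x"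
  using A_nonneg d_pos[of n] C(1) t(1)[of n] by (simp add: g_def)

lemma f_bound: "norm (f n x) \<le> g n x"
proof (cases "x \<in> E n")
  case True
  have "norm (f n x) \<le> C / t n * (A * d n)"
    unfolding f_def by (intro order_trans[OF norm_matrix_mult_le] mult_mono a_bound C t) (use C(1) t(1)[of n] in auto)
  also have "\<dots> \<le> A * d n + C / t n * (A * d n)" using A_nonneg d_pos[of n] by simp
  finally show ?thesis using True by (simp add: g_def algebra_simps)
next
  case False
  then show ?thesis using off_E(2)[OF False] a_bound[of n x] by (simp add: g_def)
qed

text \<open>
  Above the scale \<open>h = t n * d n / 2\<close> the sizes of \<open>f n\<close> are enough. Below this scale there are two cases. If one of
  the points is in the gaps, the Lipschitz constant of order \<open>C * A / (t n)\<^sup>2\<close> times \<open>h\<close> is again of the size \<open>g n\<close> at that point. If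
  both are off the gaps, they are in the same cube and \<open>f n\<close> takes the same value there.
\<close>

lemma f_holder:
  assumes "0 < \<beta>" "\<beta> \<le> 1"
  shows "norm (f n x - f n y) \<le> norm (x - y) powr \<beta> * ((t n * d n / 2) powr (-\<beta>) * g n x + (t n * d n / 2) powr (-\<beta>) * g n y)"
proof -
  define h where "h = t n * d n / 2"
  have h: "h > 0" using gap_width(1)[of n] by (simp add: h_def)
  have "norm (f n x - f n y) \<le> (norm (x - y) / h) powr \<beta> * (g n x + g n y)"
  proof (cases "h \<le> norm (x - y)")
    case True
    then have 1: "1 \<le> (norm (x - y) / h) powr \<beta>" using h assms by (intro ge_one_powr_ge_zero) auto
    have "norm (f n x - f n y) \<le> g n x + g n y"
      using norm_triangle_ineq4[of "f n x" "f n y"] f_bound[of n x] f_bound[of n y] by linarith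
    also have "\<dots> \<le> (norm (x - y) / h) powr \<beta> * (g n x + g n y)"
      using mult_right_mono[OF 1, of "g n x + g n y"] g_nonneg[of n x] g_nonneg[of n y] by simp
    finally show ?thesis .
  next
    case False
    then have near: "norm (x - y) < h" by simp
    show ?thesis
    proof (cases "x \<in> E n \<or> y \<in> E n")
      case True
      have "norm (f n x - f n y) \<le> C * A / (t n)\<^sup>2 * norm (x - y)"
        using f_lipschitz_near near by (simp add: h_def)
      also have "\<dots> = (norm (x - y) / h) * (C / t n * (A * d n) / 2)"
        using d_pos[of n] t(1)[of n] by (simp add: h_def power2_eq_square field_simps)
      also have "\<dots> \<le> (norm (x - y) / h) powr \<beta> * (g n x + g n y)"
      proof (rule mult_mono)
        show "norm (x - y) / h \<le> (norm (x - y) / h) powr \<beta>"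
        proof (cases "x = y")
          case False
          then show ?thesis using near h assms powr_mono'[of \<beta> 1 "norm (x - y) / h"] by simp
        qed simp
        define Q where "Q = C / t n * (A * d n)"
        have "Q \<le> g n x + g n y"
          using True A_nonneg d_pos[of n] C(1) t(1)[of n] by (auto simp: Q_def g_def indicator_def algebra_simps)
        moreover have "0 \<le> Q" using A_nonneg d_pos[of n] C(1) t(1)[of n] by (simp add: Q_def)
        ultimately show "C / t n * (A * d n) / 2 \<le> g n x + g n y" unfolding Q_def[symmetric] by linarith
        show "0 \<le> C / t n * (A * d n) / 2" using A_nonneg d_pos[of n] C(1) t(1)[of n] by simp
      qed simp
      finally show ?thesis .
    next
      case False
      have "c n y = c n x"
        using off_E(3)[of x n y] False near gap_width(1)[of n] by (simp add: h_def)
      then have "f n x = f n y" using off_E(2) False a_cong[of n x y] by simp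
      then show ?thesis using g_nonneg[of n x] g_nonneg[of n y] by simp
    qed
  qed
  also have "(norm (x - y) / h) powr \<beta> = norm (x - y) powr \<beta> * h powr (-\<beta>)"
    using h by (subst powr_divide) (auto simp: powr_minus divide_inverse)
  finally show ?thesis by (simp add: h_def algebra_simps)
qed

lemma f_continuous: "continuous_on UNIV (f n)"
proof -
  have "continuous (at x) (f n)" for x
    unfolding continuous_at_eps_delta
  proof (intro allI impI)
    fix e :: real assume e: "e > 0"
    define Q where "Q = C * A / (t n)\<^sup>2 + 1"
    have "0 \<le> C * A / (t n)\<^sup>2" using C(1) A_nonneg by simp
    then have Q: "Q > 0" by (simp add: Q_def)
    have "dist (f n y) (f n x) < e" if "dist y x < min (t n * d n / 2) (e / Q)" for y
    proof -
      have "norm (f n y - f n x) \<le> C * A / (t n)\<^sup>2 * norm (y - x)"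
        by (rule f_lipschitz_near) (use that in \<open>simp add: dist_norm\<close>)
      also have "\<dots> \<le> Q * norm (y - x)" by (intro mult_right_mono) (auto simp: Q_def)
      also have "\<dots> < Q * (e / Q)" using that Q by (intro mult_strict_left_mono) (auto simp: dist_norm)
      finally show ?thesis using Q by (simp add: dist_norm)
    qed
    then show "\<exists>\<delta>>0. \<forall>y. dist y x < \<delta> \<longrightarrow> dist (f n y) (f n x) < e"
      using gap_width(1)[of n] e Q by (intro exI[of _ "min (t n * d n / 2) (e / Q)"]) auto
  qed
  then show ?thesis by (simp add: continuous_on_eq_continuous_at)
qed

text \<open>
  The first correction is of size \<open>\<delta>\<close>, the later ones are of size \<open>(d n)\<^sup>2\<close>, since both the side of the cube and the slope are of order \<open>d n\<close>.
  So the sum is small with \<open>\<delta>\<close>.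
\<close>

definition w_bound :: "nat \<Rightarrow> real" where
  "w_bound n = (if n = 0 then C * M * \<delta> else C * slope_const * (d n)\<^sup>2)"

lemma norm_w_le: "norm (w n x) \<le> w_bound n"
proof -
  have "norm (w n x) \<le> d n * (C * norm (a n x))"
    unfolding w_def norm_scaleR using d_pos[of n]
    by (auto intro!: mult_left_mono order_trans[OF norm_vector_matrix_mult_le] mult_right_mono C t)
  also have "\<dots> \<le> w_bound n"
  proof (cases n)
    case 0
    then show ?thesis
      using mult_left_mono[OF a_bounds(1)[of x], of "C * \<delta>"] C(1) \<delta> by (simp add: w_bound_def d_0 algebra_simps)
  next
    case (Suc m)
    then show ?thesis
      using mult_left_mono[OF a_bounds(2)[of m x], of "C * d n"] C(1) d_pos[of n]
      by (simp add: w_bound_def power2_eq_square algebra_simps)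
  qed
  finally show ?thesis .
qed

lemma w_bound_sums: "summable w_bound" "suminf w_bound \<le> C * \<delta> * (M + slope_const)"
proof -
  have "(\<lambda>n. (1/4::real) ^ n) sums (4/3)" using geometric_sums[of "1/4::real"] by simp
  then have S1: "(\<lambda>n. C * slope_const * \<delta>\<^sup>2 * (1/4) ^ n) sums (C * slope_const * \<delta>\<^sup>2 * (4/3))"
    by (rule sums_mult)
  \<comment> \<open>The squares of the sides form a geometric series of ratio \<open>1/4\<close>.\<close>
  have dn: "C * slope_const * (d n)\<^sup>2 = C * slope_const * \<delta>\<^sup>2 * (1/4) ^ n" for n
  proof -
    have "((2::real) ^ n)\<^sup>2 = 4 ^ n" by (simp add: power2_eq_square power_mult_distrib[symmetric])
    then show ?thesis by (simp add: d_def power_divide)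
  qed
  have 1: "(\<lambda>n. C * slope_const * (d n)\<^sup>2) sums (C * slope_const * \<delta>\<^sup>2 * (4/3))"
    unfolding dn by (rule S1)
  have 2: "(\<lambda>n. if n = 0 then C * M * \<delta> - C * slope_const * \<delta>\<^sup>2 else 0) sums (C * M * \<delta> - C * slope_const * \<delta>\<^sup>2)"
    using sums_single[of 0 "\<lambda>_. C * M * \<delta> - C * slope_const * \<delta>\<^sup>2"] by simp
  have "w_bound = (\<lambda>n. C * slope_const * (d n)\<^sup>2 + (if n = 0 then C * M * \<delta> - C * slope_const * \<delta>\<^sup>2 else 0))"
    by (auto simp: w_bound_def d_0 fun_eq_iff)
  then have s: "w_bound sums (C * slope_const * \<delta>\<^sup>2 * (4/3) + (C * M * \<delta> - C * slope_const * \<delta>\<^sup>2))"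
    using sums_add[OF 1 2] by simp
  then show "summable w_bound" by (rule sums_summable)
  have "\<delta>\<^sup>2 \<le> \<delta>" using \<delta> by (simp add: power2_eq_square mult_left_le)
  moreover have cs: "0 \<le> C * slope_const" using C(1) A_nonneg by simp
  ultimately have "C * slope_const * \<delta>\<^sup>2 \<le> C * slope_const * \<delta>" by (intro mult_left_mono)
  moreover have "0 \<le> C * slope_const * \<delta>\<^sup>2" using cs by simp
  ultimately show "suminf w_bound \<le> C * \<delta> * (M + slope_const)"
    unfolding sums_unique[OF s, symmetric] by (simp add: algebra_simps)
qed

definition u :: "real^'k \<Rightarrow> real^'m" where "u x = (\<Sum>n. w n x)"

definition Du :: "real^'k \<Rightarrow> real^'m^'k" where "Du x = (\<Sum>n. f n x)"

lemma w_summable: "summable (\<lambda>n. w n x)" 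
  by (rule summable_norm_cancel, rule summable_comparison_test'[OF w_bound_sums(1), of 0]) (use norm_w_le in auto)

lemma norm_u_le: "norm (u x) \<le> C * \<delta> * (M + slope_const)"
proof -
  have s: "summable (\<lambda>n. norm (w n x))"
    by (rule summable_comparison_test'[OF w_bound_sums(1), of 0]) (use norm_w_le in auto)
  have "norm (u x) \<le> (\<Sum>n. norm (w n x))" unfolding u_def by (rule summable_norm[OF s])
  also have "\<dots> \<le> suminf w_bound" by (rule suminf_le[OF norm_w_le s w_bound_sums(1)])
  finally show ?thesis using w_bound_sums(2) by simp
qed

text \<open>
  Off all gaps nothing is cut off, so the partial sums telescope: those of \<open>f\<close> to \<open>S N x\<close>, those of \<open>w\<close> to the value of the
  affine map of generation \<open>N\<close> at \<open>x\<close>. The latter shows that \<open>b N x\<close> tends to \<open>u x\<close>, and \<open>S N x = F (c N x, b N x)\<close> then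
  tends to \<open>F (x, u x)\<close>.
\<close>

lemma f_sums_on_\<CC>:
  assumes x: "x \<in> \<CC>"
  shows "(\<lambda>n. f n x) sums F (x, u x)"
proof -
  have gx: "good x" and xE: "x \<notin> E n" for n using x by (auto simp: \<CC>_def)
  have fS: "(\<Sum>n<Suc N. f n x) = S N x" for N
    by (induction N) (simp_all add: off_E(2)[OF xE] a_def)
  have wS: "(\<Sum>n<Suc N. w n x) = b N x + (x - c N x) v* S N x" for N
  proof (induction N)
    case 0
    then show ?case by (simp add: off_E(1)[OF xE] a_def)
  next
    case (Suc N)
    have "(\<Sum>n<Suc (Suc N). w n x) = b N x + (x - c N x) v* S N x + (x - c (Suc N) x) v* (S (Suc N) x - S N x)"
      using Suc by (simp add: off_E(1)[OF xE] a_def)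
    also have "\<dots> = b (Suc N) x + (x - c (Suc N) x) v* S (Suc N) x"
      by (simp add: vec_eq_iff vector_matrix_mult_def S_def[of N] gx sum.distrib sum_subtractf algebra_simps)
    finally show ?case .
  qed
  have d0: "d \<longlonglongrightarrow> 0"
    unfolding d_def using LIMSEQ_divide_realpow_zero[of 2 \<delta>] by simp
  have cx: "(\<lambda>N. norm (x - c N x)) \<longlonglongrightarrow> 0"
  proof (rule Lim_null_comparison[OF always_eventually[OF allI]])
    show "norm (norm (x - c N x)) \<le> real CARD('k) * (d N / 2)" for N
      using norm_centre_le[OF d_pos] by simp
    show "(\<lambda>N. real CARD('k) * (d N / 2)) \<longlonglongrightarrow> 0" using d0 by (auto intro!: tendsto_eq_intros)
  qed
  have cS: "(\<lambda>N. (x - c N x) v* S N x) \<longlonglongrightarrow> 0"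
  proof (rule Lim_null_comparison[OF always_eventually[OF allI]])
    show "norm ((x - c N x) v* S N x) \<le> norm (x - c N x) * M" for N
      by (intro order_trans[OF norm_vector_matrix_mult_le] mult_left_mono S_bound) simp
    show "(\<lambda>N. norm (x - c N x) * M) \<longlonglongrightarrow> 0" by (rule tendsto_mult_left_zero[OF cx])
  qed
  have "(\<lambda>N. \<Sum>n<N. w n x) \<longlonglongrightarrow> u x"
    using summable_sums[OF w_summable] by (simp add: sums_def u_def)
  from LIMSEQ_Suc[OF this] have "(\<lambda>N. b N x + (x - c N x) v* S N x) \<longlonglongrightarrow> u x"
    unfolding wS .
  from tendsto_diff[OF this cS] have bu: "(\<lambda>N. b N x) \<longlonglongrightarrow> u x" by simp
  have u1: "norm (u x) \<le> 1"
    using tendsto_norm[OF bu] by (rule LIMSEQ_le_const2) (use b_le_1 in auto)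
  have "(\<lambda>N. S N x - F (x, u x)) \<longlonglongrightarrow> 0"
  proof (rule Lim_null_comparison[OF always_eventually[OF allI]])
    show "norm (S N x - F (x, u x)) \<le> L * (norm (x - c N x) + norm (b N x - u x))" for N
      using F_lip[OF c_D[OF gx] b_le_1 good_D(1)[OF gx] u1, of N N x] gx by (simp add: S_def norm_minus_commute)
    have "(\<lambda>N. norm (b N x - u x)) \<longlonglongrightarrow> 0" using bu by (simp add: tendsto_norm_zero LIM_zero)
    then show "(\<lambda>N. L * (norm (x - c N x) + norm (b N x - u x))) \<longlonglongrightarrow> 0"
      by (intro tendsto_mult_right_zero tendsto_add_zero cx)
  qed
  then have "(\<lambda>N. S N x) \<longlonglongrightarrow> F (x, u x)" by (rule LIM_zero_cancel)
  then have "(\<lambda>N. \<Sum>n<Suc N. f n x) \<longlonglongrightarrow> F (x, u x)" by (simp only: fS)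
  then show ?thesis unfolding sums_def by (rule LIMSEQ_imp_Suc)
qed

lemma Du_on_\<CC>: "x \<in> \<CC> \<Longrightarrow> Du x = F (x, u x)"
  unfolding Du_def using f_sums_on_\<CC> by (simp add: sums_unique[symmetric])

lemma open_E: "open (E n)"
proof -
  have "E n = (\<Union>i. \<Union>j::int. (\<lambda>x. x $ i) -` ball (of_int j * d n) (t n * d n))"
    by (rule set_eqI) (simp add: E_def dist_real_def abs_minus_commute)
  also have "open \<dots>"
    by (intro open_UN ballI open_vimage open_ball continuous_intros)
  finally show ?thesis .
qed

lemma closed_\<CC>: "closed \<CC>"
  unfolding closed_limpt islimpt_approachable
proof (intro allI impI)
  fix x assume lim: "\<forall>e>0. \<exists>x'\<in>\<CC>. x' \<noteq> x \<and> dist x' x < e"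
  have xE: "x \<notin> E n" for n
  proof
    assume "x \<in> E n"
    then obtain e where "e > 0" "ball x e \<subseteq> E n" using open_E open_contains_ball by blast
    moreover from this lim obtain x' where "x' \<in> \<CC>" "dist x' x < e" by blast
    ultimately show False by (auto simp: \<CC>_def subset_eq dist_commute)
  qed
  obtain x' where "x' \<in> \<CC>" "dist x' x < t 0 * d 0" using lim gap_width(1)[of 0] by blast
  then have "good x'" "norm (x - x') < t 0 * d 0" by (auto simp: \<CC>_def dist_norm norm_minus_commute)
  from good_cong[OF off_E(3)[OF xE this(2)]] this(1) have "good x" by blast
  then show "x \<in> \<CC>" using xE by (simp add: \<CC>_def)
qed

text \<open>
  Where the indicator of \<open>\<CC>\<close> changes between \<open>x\<close> and \<open>y\<close>, there are two cases. If \<open>y\<close> is in no gap, then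
  it is not in a good cube, and the gap of the first generation along the cube of \<open>x\<close> separates the points. Otherwise \<open>y\<close> lies in a
  slab of some generation and \<open>x\<close> does not, so that their distance is at least the distance of \<open>y\<close> to the edge of the slab.
\<close>

lemma \<CC>_boundary:
  assumes "x \<in> \<CC>" "y \<notin> \<CC>"
  shows "t 0 * d 0 \<le> norm (x - y) \<or>
    (\<exists>n i (j::int). \<bar>y $ i - of_int j * d n\<bar> < t n * d n \<and> t n * d n - \<bar>y $ i - of_int j * d n\<bar> \<le> norm (x - y))"
proof (cases "\<exists>n. y \<in> E n")
  case True
  then obtain n i and j :: int where y: "\<bar>y $ i - of_int j * d n\<bar> < t n * d n"
    by (auto simp: E_def)
  moreover have "t n * d n \<le> \<bar>x $ i - of_int j * d n\<bar>"
    using assms(1) by (auto simp: \<CC>_def E_def not_less)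
  moreover have "\<bar>x $ i - y $ i\<bar> \<le> norm (x - y)" using component_le_norm_cart[of "x - y" i] by simp
  ultimately have "t n * d n - \<bar>y $ i - of_int j * d n\<bar> \<le> norm (x - y)" by linarith
  with y show ?thesis by (intro disjI2 exI conjI)
next
  case False
  then have "\<not> good y" using assms(2) by (simp add: \<CC>_def)
  moreover have "good x" using assms(1) by (simp add: \<CC>_def)
  ultimately have "c 0 x \<noteq> c 0 y" using good_cong[of x y] by blast
  have "x \<notin> E 0" using assms(1) by (simp add: \<CC>_def)
  have "\<not> norm (x - y) < t 0 * d 0"
  proof
    assume "norm (x - y) < t 0 * d 0"
    from off_E(3)[OF \<open>x \<notin> E 0\<close> this] \<open>c 0 x \<noteq> c 0 y\<close> show False by simp
  qed
  then show ?thesis by simp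
qed

end

section \<open>Measure and fractional perimeter of the gaps\<close>

lemma nn_integral_slab_le:
  fixes g :: "real \<Rightarrow> ennreal" and i :: "'k::finite"
  assumes [measurable]: "g \<in> borel_measurable borel" and R: "0 \<le> R"
  shows "(\<integral>\<^sup>+(x::real^'k). g (x $ i) * indicator {x. \<forall>j. \<bar>x $ j\<bar> \<le> R} x \<partial>lborel)
    \<le> ennreal ((2 * R) ^ (CARD('k) - 1)) * (\<integral>\<^sup>+r. g r \<partial>lborel)"
proof -
  define h :: "(real^'k) \<Rightarrow> real \<Rightarrow> ennreal"
    where "h b r = (if b = axis i 1 then g r else 1) * indicator {-R..R} r" for b r
  have B: "Basis = range (\<lambda>j::'k. axis j (1::real))" by (auto simp: Basis_vec_def)
  have inj: "inj (\<lambda>j::'k. axis j (1::real))" by (auto simp: inj_on_def axis_eq_axis)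
  have prodB: "(\<Prod>b\<in>Basis. H b) = (\<Prod>j\<in>UNIV. H (axis (j::'k) (1::real)))" for H :: "(real^'k) \<Rightarrow> ennreal"
    unfolding B by (simp add: prod.reindex[OF inj])
  have hb: "h (axis j 1) r = (if j = i then g r else 1) * indicator {-R..R} r" for j r
    by (simp add: h_def axis_eq_axis)
  have "g (x $ i) * indicator {x. \<forall>j. \<bar>x $ j\<bar> \<le> R} x = (\<Prod>b\<in>Basis. h b (x \<bullet> b))" for x :: "real^'k"
  proof -
    have "(\<Prod>b\<in>Basis. h b (x \<bullet> b)) = (\<Prod>j\<in>UNIV. (if j = i then g (x $ j) else 1)) * (\<Prod>j\<in>UNIV. indicator {-R..R} (x $ j))"
      unfolding prodB hb by (simp add: inner_axis prod.distrib)
    also have "(\<Prod>j\<in>UNIV. (if j = i then g (x $ j) else 1)) = g (x $ i)" by (simp add: prod.delta)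
    also have "(\<Prod>j\<in>UNIV. indicator {-R..R} (x $ j)) = (indicator {x. \<forall>j. \<bar>x $ j\<bar> \<le> R} x :: ennreal)"
    proof (cases "\<forall>j. \<bar>x $ j\<bar> \<le> R")
      case True
      then have "x $ j \<in> {-R..R}" for j by (auto simp: abs_le_iff minus_le_iff)
      then show ?thesis using True by simp
    next
      case False
      then obtain j where "\<not> \<bar>x $ j\<bar> \<le> R" by blast
      then have "indicator {-R..R} (x $ j) = (0::ennreal)" by (auto simp: indicator_def)
      then have "(\<Prod>j\<in>UNIV. indicator {-R..R} (x $ j)) = (0::ennreal)" by (intro prod_zero) auto
      then show ?thesis using False by simp
    qed
    finally show ?thesis by simp
  qed
  then have "(\<integral>\<^sup>+(x::real^'k). g (x $ i) * indicator {x. \<forall>j. \<bar>x $ j\<bar> \<le> R} x \<partial>lborel)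
      = (\<integral>\<^sup>+(x::real^'k). (\<Prod>b\<in>Basis. h b (x \<bullet> b)) \<partial>lborel)" by simp
  also have "\<dots> = (\<Prod>b\<in>Basis. \<integral>\<^sup>+r. h b r \<partial>lborel)"
    by (rule nn_integral_lborel_prod) (simp_all add: h_def)
  also have "\<dots> = (\<integral>\<^sup>+r. h (axis i 1) r \<partial>lborel) * (\<Prod>j\<in>UNIV - {i}. \<integral>\<^sup>+r. h (axis j 1) r \<partial>lborel)"
    unfolding prodB by (rule prod.remove) auto
  also have "(\<Prod>j\<in>UNIV - {i}. \<integral>\<^sup>+r. h (axis j 1) r \<partial>lborel) = (\<Prod>j\<in>UNIV - {i}. ennreal (2 * R))"
  proof (rule prod.cong)
    fix j assume "j \<in> UNIV - {i}"
    then have "h (axis j 1) r = indicator {-R..R} r" for r by (simp add: hb)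
    then show "(\<integral>\<^sup>+r. h (axis j 1) r \<partial>lborel) = ennreal (2 * R)" using R by simp
  qed simp
  also have "\<dots> = ennreal ((2 * R) ^ (CARD('k) - 1))"
    using R by (simp add: ennreal_power card_Diff_singleton)
  also have "(\<integral>\<^sup>+r. h (axis i 1) r \<partial>lborel) * ennreal ((2 * R) ^ (CARD('k) - 1))
      \<le> (\<integral>\<^sup>+r. g r \<partial>lborel) * ennreal ((2 * R) ^ (CARD('k) - 1))"
    by (intro mult_right_mono nn_integral_mono) (simp_all add: hb indicator_def)
  finally show ?thesis by (simp only: mult.commute)
qed

text \<open>
  The power \<open>-\<sigma>\<close> of the distance of a point of the interval \<open>(-a, a)\<close> to the edges, extended by \<open>0\<close>. For \<open>\<sigma> = 0\<close> it is the
  indicator of the interval.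
\<close>

definition edge_sing :: "real \<Rightarrow> real \<Rightarrow> real \<Rightarrow> real" where
  "edge_sing \<sigma> a r = (if \<bar>r\<bar> < a then (a - \<bar>r\<bar>) powr (-\<sigma>) else 0)"

lemma edge_sing_measurable [measurable]: "edge_sing \<sigma> a \<in> borel_measurable borel"
  unfolding edge_sing_def[abs_def] by measurable

lemma nn_integral_edge_sing_le:
  assumes \<sigma>: "0 \<le> \<sigma>" "\<sigma> < 1" and a: "0 < a"
  shows "(\<integral>\<^sup>+r. ennreal (edge_sing \<sigma> a (r - c)) \<partial>lborel) \<le> ennreal (2 * ((2 * a) powr (1 - \<sigma>) / (1 - \<sigma>)))"
proof -
  define h where "h y = (if y \<in> {0..2 * a} then y powr (-\<sigma>) else 0)" for y
  have [measurable]: "h \<in> borel_measurable borel" unfolding h_def[abs_def] by measurable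
  have "((\<lambda>y. y powr (-\<sigma>)) has_integral ((2 * a) powr (-\<sigma> + 1) / (-\<sigma> + 1))) {0..2 * a}"
    using \<sigma> a by (intro has_integral_powr_from_0) auto
  then have "((\<lambda>y. if y \<in> {0..2 * a} then y powr (-\<sigma>) else 0) has_integral ((2 * a) powr (1 - \<sigma>) / (1 - \<sigma>))) UNIV"
    unfolding has_integral_restrict_UNIV by (simp only: add.commute[of "-\<sigma>"] diff_conv_add_uminus)
  then have hI: "(h has_integral ((2 * a) powr (1 - \<sigma>) / (1 - \<sigma>))) UNIV"
    unfolding h_def[abs_def] .
  then have int: "(\<integral>\<^sup>+r. ennreal (h r) \<partial>lborel) = ennreal ((2 * a) powr (1 - \<sigma>) / (1 - \<sigma>))"
    by (intro nn_integral_has_integral_lborel[OF _ _ hI]) (measurable, simp add: h_def)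
  have "ennreal (edge_sing \<sigma> a (r - c)) \<le> ennreal (h ((a + c) + (-1) * r)) + ennreal (h ((a - c) + 1 * r))" for r
  proof -
    have "edge_sing \<sigma> a (r - c) \<le> h ((a + c) + (-1) * r) + h ((a - c) + 1 * r)"
    proof (cases "r \<ge> c")
      case True
      then have "edge_sing \<sigma> a (r - c) \<le> h ((a + c) + (-1) * r)"
        using a by (auto simp: edge_sing_def h_def algebra_simps)
      then show ?thesis by (simp add: h_def add_increasing2)
    next
      case False
      then have "edge_sing \<sigma> a (r - c) \<le> h ((a - c) + 1 * r)"
        using a by (auto simp: edge_sing_def h_def algebra_simps)
      then show ?thesis by (simp add: h_def add_increasing)
    qed
    then have "ennreal (edge_sing \<sigma> a (r - c)) \<le> ennreal (h ((a + c) + (-1) * r) + h ((a - c) + 1 * r))"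
      by (rule ennreal_leI)
    also have "\<dots> = ennreal (h ((a + c) + (-1) * r)) + ennreal (h ((a - c) + 1 * r))"
      by (rule ennreal_plus) (auto simp: h_def)
    finally show ?thesis .
  qed
  then have "(\<integral>\<^sup>+r. ennreal (edge_sing \<sigma> a (r - c)) \<partial>lborel)
     \<le> (\<integral>\<^sup>+r. ennreal (h ((a + c) + (-1) * r)) + ennreal (h ((a - c) + 1 * r)) \<partial>lborel)"
    by (intro nn_integral_mono) auto
  also have "\<dots> = (\<integral>\<^sup>+r. ennreal (h ((a + c) + (-1) * r)) \<partial>lborel) + (\<integral>\<^sup>+r. ennreal (h ((a - c) + 1 * r)) \<partial>lborel)"
    by (rule nn_integral_add) measurable
  also have "\<dots> = (\<integral>\<^sup>+r. ennreal (h r) \<partial>lborel) + (\<integral>\<^sup>+r. ennreal (h r) \<partial>lborel)"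
    using nn_integral_real_affine[of "\<lambda>r. ennreal (h r)" "-1" "a + c"]
      nn_integral_real_affine[of "\<lambda>r. ennreal (h r)" 1 "a - c"] by simp
  also have "\<dots> = ennreal (2 * ((2 * a) powr (1 - \<sigma>) / (1 - \<sigma>)))"
    unfolding int using \<sigma> by (subst ennreal_plus[symmetric]) auto
  finally show ?thesis .
qed

definition slab_const :: "nat \<Rightarrow> real \<Rightarrow> real \<Rightarrow> real" where
  "slab_const k R \<sigma> = real k * (2 * R + 5) * (2 * R) ^ (k - 1) * (2 * (2 powr (1 - \<sigma>) / (1 - \<sigma>)))"

lemma slab_const_nonneg: "0 \<le> R \<Longrightarrow> \<sigma> < 1 \<Longrightarrow> 0 \<le> slab_const k R \<sigma>"
  by (simp add: slab_const_def)

text \<open>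
  A common majorant \<open>Z\<close> for the edge singularities of all slabs of one generation: their sum over the directions and over the about
  \<open>1 / d\<close> slabs that meet \<open>\<Omega>\<close>, each of which has an integral of order \<open>a powr (1 - \<sigma>)\<close>. With \<open>\<sigma> = 0\<close> it bounds the measure of the
  slabs.
\<close>

lemma grid_slabs:
  fixes \<Omega> :: "(real^'k) set"
  assumes \<Omega>L: "\<Omega> \<in> sets lebesgue" and \<Omega>R: "\<Omega> \<subseteq> {x. \<forall>i. \<bar>x $ i\<bar> \<le> R}"
    and R: "0 \<le> R" and \<sigma>: "0 \<le> \<sigma>" "\<sigma> < 1" and d: "0 < d" "d \<le> 1" and a: "0 < a" "a \<le> 1"
  obtains Z :: "real^'k \<Rightarrow> ennreal" where "Z \<in> borel_measurable borel"
    "\<And>x i (j::int). x \<in> \<Omega> \<Longrightarrow> \<bar>x $ i - of_int j * d\<bar> < a \<Longrightarrow> ennreal ((a - \<bar>x $ i - of_int j * d\<bar>) powr (-\<sigma>)) \<le> Z x"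
    "(\<integral>\<^sup>+x. Z x \<partial>lebesgue_on \<Omega>) \<le> ennreal (slab_const CARD('k) R \<sigma> * (a powr (1 - \<sigma>) / d))"
proof
  have \<Omega>: "\<Omega> \<in> sets lebesgue" "\<And>x i. x \<in> \<Omega> \<Longrightarrow> \<bar>x $ i\<bar> \<le> R" using \<Omega>L \<Omega>R by auto
  define X where "X = (R + 1) / d"
  have X0: "0 \<le> X" using R d by (simp add: X_def)
  define m where "m = \<lceil>X\<rceil>"
  define J where "J = {-m..m}"
  have m0: "0 \<le> m" using X0 unfolding m_def by linarith
  define Z :: "real^'k \<Rightarrow> ennreal" where "Z x = (\<Sum>i\<in>UNIV. \<Sum>j\<in>J. ennreal (edge_sing \<sigma> a (x $ i - of_int j * d)))" for x
  have nth[measurable]: "(\<lambda>x::real^'k. x $ i) \<in> borel_measurable borel" for i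
    by (intro borel_measurable_continuous_onI continuous_intros)
  show "Z \<in> borel_measurable borel" unfolding Z_def[abs_def] by measurable
  show "ennreal ((a - \<bar>x $ i - of_int j * d\<bar>) powr (-\<sigma>)) \<le> Z x"
    if x: "x \<in> \<Omega>" and j: "\<bar>x $ i - of_int j * d\<bar> < a" for x i and j :: int
  proof -
    have "\<bar>of_int j * d\<bar> \<le> R + 1" using \<Omega>(2)[OF x, of i] j a by linarith
    then have "\<bar>of_int j\<bar> \<le> X" using d by (simp add: X_def abs_mult field_simps)
    then have "\<bar>j\<bar> \<le> m" unfolding m_def by linarith
    then have jJ: "j \<in> J" by (auto simp: J_def)
    have "ennreal ((a - \<bar>x $ i - of_int j * d\<bar>) powr (-\<sigma>)) = ennreal (edge_sing \<sigma> a (x $ i - of_int j * d))"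
      using j by (simp add: edge_sing_def)
    also have "\<dots> \<le> (\<Sum>j\<in>J. ennreal (edge_sing \<sigma> a (x $ i - of_int j * d)))"
      using jJ by (intro member_le_sum) (auto simp: J_def)
    also have "\<dots> \<le> Z x"
      unfolding Z_def by (rule member_le_sum[where f = "\<lambda>i. \<Sum>j\<in>J. ennreal (edge_sing \<sigma> a (x $ i - of_int j * d))"]) auto
    finally show ?thesis .
  qed
  define I where "I = 2 * ((2 * a) powr (1 - \<sigma>) / (1 - \<sigma>))"
  have I0: "0 \<le> I" using \<sigma> by (simp add: I_def)
  let ?Q = "{x::real^'k. \<forall>j. \<bar>x $ j\<bar> \<le> R}"
  have "?Q = (\<Inter>j. (\<lambda>x. \<bar>x $ j\<bar>) -` {..R})" by auto
  also have "closed \<dots>" by (intro closed_INT ballI closed_vimage continuous_intros closed_atMost)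
  finally have Q[measurable]: "?Q \<in> sets borel" by (rule borel_closed)
  have one: "(\<integral>\<^sup>+x. ennreal (edge_sing \<sigma> a (x $ i - of_int j * d)) \<partial>lebesgue_on \<Omega>) \<le> ennreal ((2 * R) ^ (CARD('k) - 1) * I)"
    for i and j :: int
  proof -
    have "(\<integral>\<^sup>+x. ennreal (edge_sing \<sigma> a (x $ i - of_int j * d)) \<partial>lebesgue_on \<Omega>)
      = (\<integral>\<^sup>+x. ennreal (edge_sing \<sigma> a (x $ i - of_int j * d)) * indicator ?Q x \<partial>lebesgue_on \<Omega>)"
      using \<Omega>(2) by (intro nn_integral_cong) simp
    also have "\<dots> \<le> (\<integral>\<^sup>+x. ennreal (edge_sing \<sigma> a (x $ i - of_int j * d)) * indicator ?Q x \<partial>lborel)"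
      by (rule nn_integral_lebesgue_on_le_lborel[OF \<Omega>(1)]) measurable
    also have "\<dots> \<le> ennreal ((2 * R) ^ (CARD('k) - 1)) * (\<integral>\<^sup>+r. ennreal (edge_sing \<sigma> a (r - of_int j * d)) \<partial>lborel)"
      by (rule nn_integral_slab_le[OF _ R, where g = "\<lambda>r. ennreal (edge_sing \<sigma> a (r - of_int j * d))"]) measurable
    also have "\<dots> \<le> ennreal ((2 * R) ^ (CARD('k) - 1)) * ennreal I"
      unfolding I_def by (intro mult_left_mono nn_integral_edge_sing_le \<sigma> a) simp
    also have "\<dots> = ennreal ((2 * R) ^ (CARD('k) - 1) * I)"
      using R I0 by (intro ennreal_mult[symmetric]) auto
    finally show ?thesis .
  qed
  have [measurable]: "(\<lambda>x. ennreal (edge_sing \<sigma> a (x $ i - of_int j * d))) \<in> borel_measurable (lebesgue_on \<Omega>)" for i and j :: int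
    by (intro measurable_borel_lebesgue_on) measurable
  have "(\<integral>\<^sup>+x. Z x \<partial>lebesgue_on \<Omega>) = (\<Sum>i\<in>UNIV. \<Sum>j\<in>J. \<integral>\<^sup>+x. ennreal (edge_sing \<sigma> a (x $ i - of_int j * d)) \<partial>lebesgue_on \<Omega>)"
    unfolding Z_def by (subst nn_integral_sum, measurable) (intro sum.cong refl nn_integral_sum, measurable)
  also have "\<dots> \<le> (\<Sum>i\<in>(UNIV::'k set). \<Sum>j\<in>J. ennreal ((2 * R) ^ (CARD('k) - 1) * I))"
    by (intro sum_mono one)
  also have "\<dots> = ennreal (real CARD('k) * (real (card J) * ((2 * R) ^ (CARD('k) - 1) * I)))"
    using R I0 by (simp add: ennreal_mult ennreal_of_nat_eq_real_of_nat)
  also have "\<dots> \<le> ennreal (slab_const CARD('k) R \<sigma> * (a powr (1 - \<sigma>) / d))"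
  proof (rule ennreal_leI)
    have "real (card J) = 2 * of_int m + 1" using m0 by (simp add: J_def)
    also have "\<dots> \<le> 2 * (X + 1) + 1"
      unfolding m_def by (intro add_right_mono mult_left_mono of_int_ceiling_le_add_one) simp
    also have "\<dots> = (2 * R + 2 + 3 * d) / d" using d by (simp add: X_def field_simps)
    also have "\<dots> \<le> (2 * R + 5) / d" using d by (intro divide_right_mono) auto
    finally have "real CARD('k) * (real (card J) * ((2 * R) ^ (CARD('k) - 1) * I))
       \<le> real CARD('k) * ((2 * R + 5) / d * ((2 * R) ^ (CARD('k) - 1) * I))"
      using R I0 by (intro mult_left_mono mult_right_mono) auto
    also have "\<dots> = slab_const CARD('k) R \<sigma> * (a powr (1 - \<sigma>) / d)"
      using a by (simp add: slab_const_def I_def powr_mult mult_ac)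
    finally show "real CARD('k) * (real (card J) * ((2 * R) ^ (CARD('k) - 1) * I)) \<le> slab_const CARD('k) R \<sigma> * (a powr (1 - \<sigma>) / d)" .
  qed
  finally show "(\<integral>\<^sup>+x. Z x \<partial>lebesgue_on \<Omega>) \<le> ennreal (slab_const CARD('k) R \<sigma> * (a powr (1 - \<sigma>) / d))" .
qed

context cube_construction
begin

context
  fixes \<Omega> :: "(real^'k) set" and R :: real
  assumes \<Omega>: "\<Omega> \<in> sets lebesgue" "bounded \<Omega>" "\<Omega> \<subseteq> {x. \<forall>i. \<bar>x $ i\<bar> \<le> R}" and R: "0 \<le> R"
begin

lemma nn_integral_E_le: "(\<integral>\<^sup>+x. indicator (E n) x \<partial>lebesgue_on \<Omega>) \<le> ennreal (slab_const CARD('k) R 0 * t n)"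
proof -
  have a1: "t n * d n \<le> 1" using gap_width(2)[of n] d_le_1[of n] by linarith
  obtain Z :: "real^'k \<Rightarrow> ennreal" where Z: "Z \<in> borel_measurable borel"
    "\<And>x i (j::int). x \<in> \<Omega> \<Longrightarrow> \<bar>x $ i - of_int j * d n\<bar> < t n * d n \<Longrightarrow> ennreal ((t n * d n - \<bar>x $ i - of_int j * d n\<bar>) powr (- 0)) \<le> Z x"
    "(\<integral>\<^sup>+x. Z x \<partial>lebesgue_on \<Omega>) \<le> ennreal (slab_const CARD('k) R 0 * ((t n * d n) powr (1 - 0) / d n))"
    using grid_slabs[OF \<Omega>(1,3) R _ _ d_pos d_le_1 gap_width(1) a1, of 0 n] by auto
  have "(\<integral>\<^sup>+x. indicator (E n) x \<partial>lebesgue_on \<Omega>) \<le> (\<integral>\<^sup>+x. Z x \<partial>lebesgue_on \<Omega>)"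
  proof (rule nn_integral_mono)
    fix x assume "x \<in> space (lebesgue_on \<Omega>)"
    then have x: "x \<in> \<Omega>" by simp
    show "indicator (E n) x \<le> Z x"
    proof (cases "x \<in> E n")
      case True
      then obtain i and j :: int where "\<bar>x $ i - of_int j * d n\<bar> < t n * d n" by (auto simp: E_def)
      from Z(2)[OF x this] this show ?thesis using True by simp
    qed simp
  qed
  also have "\<dots> \<le> ennreal (slab_const CARD('k) R 0 * t n)"
    using Z(3) gap_width(1)[of n] d_pos[of n] by simp
  finally show ?thesis .
qed

text \<open>
  If the indicator jumps between two points, then \<open>\<CC>_boundary\<close> bounds \<open>1\<close> by \<open>|x - y| powr \<sigma>\<close> times the power \<open>-\<sigma>\<close> of the distance of the
  point outside \<open>\<CC>\<close> to the edge of its slab. The sum of the majorants of \<open>grid_slabs\<close> over the generations is the integrable \<open>\<Phi>\<close> of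
  \<open>gagliardo_finite\<close>; the additional constant accounts for the points separated by the first generation.
\<close>

lemma gagliardo_indicator_\<CC>:
  assumes s: "s < \<sigma>" "0 \<le> \<sigma>" "\<sigma> < 1" and sm: "summable (\<lambda>n. (t n * d n) powr (1 - \<sigma>) / d n)"
  shows "gagliardo s 1 \<Omega> (indicat_real \<CC>) < \<infinity>"
proof -
  have a1: "t n * d n \<le> 1" for n using gap_width(2)[of n] d_le_1[of n] by linarith
  have "\<exists>Z :: real^'k \<Rightarrow> ennreal. Z \<in> borel_measurable borel \<and>
    (\<forall>x\<in>\<Omega>. \<forall>i (j::int). \<bar>x $ i - of_int j * d n\<bar> < t n * d n \<longrightarrow> ennreal ((t n * d n - \<bar>x $ i - of_int j * d n\<bar>) powr (- \<sigma>)) \<le> Z x) \<and>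
    (\<integral>\<^sup>+x. Z x \<partial>lebesgue_on \<Omega>) \<le> ennreal (slab_const CARD('k) R \<sigma> * ((t n * d n) powr (1 - \<sigma>) / d n))" for n
    by (rule grid_slabs[OF \<Omega>(1,3) R s(2,3) d_pos[of n] d_le_1[of n] gap_width(1)[of n] a1[of n]])
      (rule exI, intro conjI ballI allI impI, assumption, blast, assumption)
  then obtain Z :: "nat \<Rightarrow> real^'k \<Rightarrow> ennreal" where Zm[measurable]: "\<And>n. Z n \<in> borel_measurable borel"
    and Z: "\<And>n x i (j::int). x \<in> \<Omega> \<Longrightarrow> \<bar>x $ i - of_int j * d n\<bar> < t n * d n \<Longrightarrow> ennreal ((t n * d n - \<bar>x $ i - of_int j * d n\<bar>) powr (- \<sigma>)) \<le> Z n x"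
    and Zi: "\<And>n. (\<integral>\<^sup>+x. Z n x \<partial>lebesgue_on \<Omega>) \<le> ennreal (slab_const CARD('k) R \<sigma> * ((t n * d n) powr (1 - \<sigma>) / d n))"
    by metis
  define \<Phi> where "\<Phi> x = ennreal ((t 0 * d 0) powr (-\<sigma>)) + (\<Sum>n. Z n x)" for x
  have [measurable]: "Z n \<in> borel_measurable (lebesgue_on \<Omega>)" for n by (intro measurable_borel_lebesgue_on Zm)
  interpret finite_measure "lebesgue_on \<Omega>"
    by (intro finite_measure_lebesgue_on bounded_set_imp_lmeasurable \<Omega>)
  have sep: "1 \<le> ennreal (norm (x - y) powr \<sigma>) * (\<Phi> x + \<Phi> y)" if "x \<in> \<CC>" "y \<notin> \<CC>" "y \<in> \<Omega>" for x y
  proof -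
    have key: "1 \<le> ennreal (norm (x - y) powr \<sigma>) * (\<Phi> x + \<Phi> y)"
      if r: "0 < r" "r \<le> norm (x - y)" "ennreal (r powr (-\<sigma>)) \<le> \<Phi> y" for r
    proof -
      have "1 = r powr \<sigma> * r powr (-\<sigma>)" using r by (simp add: powr_add[symmetric])
      also have "\<dots> \<le> norm (x - y) powr \<sigma> * r powr (-\<sigma>)"
        using r s by (intro mult_right_mono powr_mono2) auto
      finally have "1 \<le> ennreal (norm (x - y) powr \<sigma> * r powr (-\<sigma>))" by (simp add: ennreal_leI[of 1, simplified])
      also have "\<dots> = ennreal (norm (x - y) powr \<sigma>) * ennreal (r powr (-\<sigma>))" by (simp add: ennreal_mult)
      also have "\<dots> \<le> ennreal (norm (x - y) powr \<sigma>) * (\<Phi> x + \<Phi> y)"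
        by (intro mult_left_mono order_trans[OF r(3)] add_increasing) auto
      finally show ?thesis .
    qed
    from \<CC>_boundary[OF that(1,2)] show ?thesis
    proof
      assume "t 0 * d 0 \<le> norm (x - y)"
      then show ?thesis by (intro key[OF gap_width(1)]) (auto simp: \<Phi>_def)
    next
      assume "\<exists>n i (j::int). \<bar>y $ i - of_int j * d n\<bar> < t n * d n \<and> t n * d n - \<bar>y $ i - of_int j * d n\<bar> \<le> norm (x - y)"
      then obtain n i and j :: int where y: "\<bar>y $ i - of_int j * d n\<bar> < t n * d n"
        "t n * d n - \<bar>y $ i - of_int j * d n\<bar> \<le> norm (x - y)" by blast
      have "Z n y = sum (\<lambda>n. Z n y) {n}" by simp
      also have "\<dots> \<le> (\<Sum>n. Z n y)" by (rule sum_le_suminf) auto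
      finally have "Z n y \<le> \<Phi> y" unfolding \<Phi>_def by (rule add_increasing[rotated]) simp
      with Z[OF that(3) y(1)] have "ennreal ((t n * d n - \<bar>y $ i - of_int j * d n\<bar>) powr (- \<sigma>)) \<le> \<Phi> y"
        by (rule order_trans)
      with y show ?thesis by (intro key[of "t n * d n - \<bar>y $ i - of_int j * d n\<bar>"]) auto
    qed
  qed
  show ?thesis
  proof (rule gagliardo_finite[OF \<Omega>(1,2) _ s(1), where \<Phi> = \<Phi>])
    show "\<Phi> \<in> borel_measurable (lebesgue_on \<Omega>)" unfolding \<Phi>_def[abs_def] by measurable
    have "(\<Sum>n. \<integral>\<^sup>+x. Z n x \<partial>lebesgue_on \<Omega>) \<le> (\<Sum>n. ennreal (slab_const CARD('k) R \<sigma> * ((t n * d n) powr (1 - \<sigma>) / d n)))"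
      by (intro suminf_le Zi summableI)
    also have "\<dots> < top"
      unfolding less_top[symmetric] using slab_const_nonneg[OF R s(3)] d_pos
      by (intro ennreal_suminf_neq_top summable_mult sm) (auto intro!: mult_nonneg_nonneg divide_nonneg_pos)
    finally have Zfin: "(\<Sum>n. \<integral>\<^sup>+x. Z n x \<partial>lebesgue_on \<Omega>) < top" .
    have "(\<integral>\<^sup>+x. \<Phi> x \<partial>lebesgue_on \<Omega>) = (\<integral>\<^sup>+x. ennreal ((t 0 * d 0) powr (-\<sigma>)) \<partial>lebesgue_on \<Omega>) + (\<integral>\<^sup>+x. (\<Sum>n. Z n x) \<partial>lebesgue_on \<Omega>)"
      unfolding \<Phi>_def by (rule nn_integral_add) measurable
    also have "(\<integral>\<^sup>+x. (\<Sum>n. Z n x) \<partial>lebesgue_on \<Omega>) = (\<Sum>n. \<integral>\<^sup>+x. Z n x \<partial>lebesgue_on \<Omega>)"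
      by (rule nn_integral_suminf) measurable
    also have "(\<integral>\<^sup>+x. ennreal ((t 0 * d 0) powr (-\<sigma>)) \<partial>lebesgue_on \<Omega>) < top"
    proof -
      have "emeasure (lebesgue_on \<Omega>) (space (lebesgue_on \<Omega>)) < top"
        using emeasure_finite[of "space (lebesgue_on \<Omega>)"] less_top by blast
      then show ?thesis by (simp add: ennreal_mult_less_top)
    qed
    finally show "(\<integral>\<^sup>+x. \<Phi> x \<partial>lebesgue_on \<Omega>) < \<infinity>" using Zfin
      by (simp add: \<open>(\<integral>\<^sup>+x. ennreal ((t 0 * d 0) powr (-\<sigma>)) \<partial>lebesgue_on \<Omega>) < top\<close>)
    fix x y assume xy: "x \<in> \<Omega>" "y \<in> \<Omega>" "x \<noteq> y"
    consider "x \<in> \<CC> \<longleftrightarrow> y \<in> \<CC>" | "x \<in> \<CC>" "y \<notin> \<CC>" | "y \<in> \<CC>" "x \<notin> \<CC>" by blast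
    then show "ennreal (norm (indicat_real \<CC> x - indicat_real \<CC> y) powr 1) \<le> ennreal (norm (x - y) powr (\<sigma> * 1)) * (\<Phi> x + \<Phi> y)"
    proof cases
      case 1
      then have "indicat_real \<CC> x = indicat_real \<CC> y" by (simp add: indicator_def)
      then show ?thesis by simp
    next
      case 2
      then show ?thesis using sep[OF 2 xy(2)] by simp
    next
      case 3
      then show ?thesis using sep[OF 3 xy(1)] by (simp add: norm_minus_commute add.commute)
    qed
  qed simp
qed

end

end

section \<open>Regularity of the limit\<close>

text \<open>
  The derivative \<open>h \<mapsto> h v* M\<close> of a map with gradient \<open>M\<close>, as a bounded linear function.
\<close>

definition row_map :: "real^'m^'k \<Rightarrow> (real^'k) \<Rightarrow>\<^sub>L (real^'m)" where
  "row_map M = Blinfun (\<lambda>h. h v* M)"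

lemma row_map_apply: "blinfun_apply (row_map M) h = h v* M"
proof -
  have "bounded_linear (\<lambda>h. h v* M)"
    by (rule bounded_linear_intro[where K = "norm M"])
      (simp_all add: vector_matrix_left_distrib scaleR_vector_matrix_assoc norm_vector_matrix_mult_le)
  then show ?thesis unfolding row_map_def by (simp add: bounded_linear_Blinfun_apply)
qed

lemma norm_row_map_diff_le: "norm (row_map M - row_map M') \<le> norm (M - M')"
proof (rule norm_blinfun_bound)
  fix h
  have "blinfun_apply (row_map M - row_map M') h = h v* (M - M')"
    by (simp add: minus_blinfun.rep_eq row_map_apply vec_eq_iff vector_matrix_mult_def right_diff_distrib sum_subtractf)
  then show "norm (blinfun_apply (row_map M - row_map M') h) \<le> norm (M - M') * norm h"
    using norm_vector_matrix_mult_le[of h "M - M'"] by (simp add: mult.commute)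
qed simp

lemma C1_holderI:
  fixes u :: "real^'k \<Rightarrow> real^'m"
  assumes der: "\<And>x. (u has_derivative (\<lambda>h. h v* G x)) (at x)"
    and \<beta>: "0 < \<beta>" and B: "\<And>x. norm (G x) \<le> B" and Q: "\<And>x y. norm (G x - G y) \<le> Q * norm (x - y) powr \<beta>"
    and ub: "\<And>x. norm (u x) \<le> U"
  shows "u \<in> C1_holder \<beta> \<Omega>" and "u \<in> C1_on \<Omega>"
proof -
  have der': "(u has_derivative blinfun_apply (row_map (G x))) (at x)" for x
    using der[of x] by (simp add: row_map_apply[abs_def])
  have hol: "dist (row_map (G x)) (row_map (G y)) \<le> Q * dist x y powr \<beta>" for x y
    using norm_row_map_diff_le[of "G x" "G y"] Q[of x y] by (simp add: dist_norm)
  have "norm (row_map (G x)) \<le> B" for x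
    using norm_row_map_diff_le[of "G x" 0] B[of x]
    by (smt (verit) diff_zero norm_blinfun_bound norm_ge_zero row_map_apply norm_vector_matrix_mult_le mult.commute)
  then have "bounded ((\<lambda>x. row_map (G x)) ` \<Omega>)" by (auto simp: bounded_iff)
  moreover have "bounded (u ` \<Omega>)" using ub by (auto simp: bounded_iff)
  moreover have "(\<lambda>x. row_map (G x)) \<in> holder_space \<beta> \<Omega>"
    unfolding holder_space_def using hol calculation(1) by (intro CollectI conjI exI[of _ Q] ballI)
  ultimately show "u \<in> C1_holder \<beta> \<Omega>"
    unfolding C1_holder_def by (intro CollectI conjI exI[of _ "\<lambda>x. row_map (G x)"] ballI der')
  have "continuous_on \<Omega> (\<lambda>x. row_map (G x))"
  proof (rule continuous_at_imp_continuous_on, rule ballI)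
    fix x
    have "((\<lambda>y. row_map (G y)) \<longlongrightarrow> row_map (G x)) (at x)"
    proof (rule Lim_transform_bound[OF always_eventually[OF allI], THEN Lim_null[THEN iffD2]])
      show "norm (row_map (G y) - row_map (G x)) \<le> norm (Q * norm (y - x) powr \<beta>)" for y
        using hol[of y x] by (simp add: dist_norm)
      have "((\<lambda>y. norm (y - x) powr \<beta>) \<longlongrightarrow> 0 powr \<beta>) (at x)"
        by (intro tendsto_powr2 tendsto_eq_intros) (use \<beta> in auto)
      then show "((\<lambda>y. Q * norm (y - x) powr \<beta>) \<longlongrightarrow> 0) (at x)"
        by (intro tendsto_mult_right_zero) simp
    qed
    then show "isCont (\<lambda>y. row_map (G y)) x" by (simp add: isCont_def)
  qed
  then show "u \<in> C1_on \<Omega>"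
    unfolding C1_on_def by (intro CollectI conjI exI[of _ "\<lambda>x. row_map (G x)"] ballI der')
qed

context cube_construction
begin

text \<open>
  Up to a constant, the \<open>L\<^sup>q\<close> norm of the local \<open>\<beta>\<close>-Hoelder constant \<open>e \<beta> n\<close> of \<open>f n\<close>, for \<open>\<iota> = 1/q\<close>: in the gaps, of measure of order \<open>t n\<close>,
  this constant is of order \<open>(t n * d n) powr (-\<beta>) * d n / t n\<close>.
\<close>

definition rate :: "real \<Rightarrow> real \<Rightarrow> nat \<Rightarrow> real" where
  "rate \<beta> \<iota> n = d n * (t n * d n / 2) powr (-\<beta>) * t n powr (\<iota> - 1)"

definition e :: "real \<Rightarrow> nat \<Rightarrow> real^'k \<Rightarrow> real" where
  "e \<beta> n x = (t n * d n / 2) powr (-\<beta>) * g n x"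

lemma rate_nonneg: "0 \<le> rate \<beta> \<iota> n"
  using d_pos[of n] by (simp add: rate_def)

lemma f_le_e:
  assumes "0 \<le> \<beta>"
  shows "norm (f n x) \<le> e \<beta> n x"
proof -
  have "t n * d n / 2 \<le> 1" using gap_width(2)[of n] d_le_1[of n] by linarith
  then have "1 powr (-\<beta>) \<le> (t n * d n / 2) powr (-\<beta>)"
    using gap_width(1)[of n] assms by (intro powr_mono2') auto
  then have "1 * g n x \<le> e \<beta> n x"
    unfolding e_def using g_nonneg by (intro mult_right_mono) auto
  then show ?thesis using f_bound[of n x] by simp
qed

lemma e_bounds:
  assumes "\<iota> \<le> 1"
  shows "x \<notin> E n \<Longrightarrow> e \<beta> n x \<le> 2 * A * C * rate \<beta> \<iota> n"
    and "e \<beta> n x \<le> 2 * A * C * rate \<beta> \<iota> n * t n powr (-\<iota>)"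
proof -
  define P where "P = A * d n * (t n * d n / 2) powr (-\<beta>)"
  have P: "0 \<le> P" using A_nonneg d_pos[of n] by (simp add: P_def)
  have tn: "0 < t n" "t n \<le> 1" using t[of n] by auto
  have "1 \<le> t n powr (\<iota> - 1)" using tn assms powr_mono2'[of "\<iota> - 1" "t n" 1] by simp
  then have "1 \<le> 2 * C * t n powr (\<iota> - 1)"
    using C(1) mult_mono[of 1 "2 * C" 1 "t n powr (\<iota> - 1)"] by simp
  then have "P * 1 \<le> P * (2 * C * t n powr (\<iota> - 1))" using P by (intro mult_left_mono)
  also have "\<dots> = 2 * A * C * rate \<beta> \<iota> n" by (simp add: P_def rate_def algebra_simps)
  finally show "e \<beta> n x \<le> 2 * A * C * rate \<beta> \<iota> n" if "x \<notin> E n"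
    using that by (simp add: e_def g_def P_def algebra_simps)
  have "1 + C / t n * indicat_real (E n) x \<le> 2 * C / t n"
    using C(1) tn by (auto simp: indicator_def field_simps)
  then have "P * (1 + C / t n * indicat_real (E n) x) \<le> P * (2 * C / t n)" using P by (intro mult_left_mono)
  also have "2 * C / t n = 2 * C * (t n powr (\<iota> - 1) * t n powr (-\<iota>))"
  proof -
    have "t n powr (\<iota> - 1) * t n powr (-\<iota>) = t n powr (-1)" by (simp add: powr_add[symmetric])
    then show ?thesis using tn by (simp add: powr_neg_one)
  qed
  also have "P * (2 * C * (t n powr (\<iota> - 1) * t n powr (-\<iota>))) = 2 * A * C * rate \<beta> \<iota> n * t n powr (-\<iota>)"
    by (simp add: P_def rate_def algebra_simps)
  finally show "e \<beta> n x \<le> 2 * A * C * rate \<beta> \<iota> n * t n powr (-\<iota>)"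
    by (simp add: e_def g_def P_def algebra_simps)
qed

lemma e_nonneg: "0 \<le> e \<beta> n x"
  using g_nonneg by (simp add: e_def)

lemma e_measurable: "e \<beta> n \<in> borel_measurable borel"
proof -
  have [measurable]: "E n \<in> sets borel" using open_E by (rule borel_open)
  show ?thesis unfolding e_def[abs_def] g_def[abs_def] by measurable
qed

lemma f_measurable: "f n \<in> borel_measurable borel"
  by (rule borel_measurable_continuous_onI[OF f_continuous])

lemma f_holder_e:
  assumes "0 < \<beta>" "\<beta> \<le> 1"
  shows "norm (f n x - f n y) \<le> norm (x - y) powr \<beta> * (e \<beta> n x + e \<beta> n y)"
  using f_holder[OF assms, of n x y] by (simp add: e_def)

text \<open>
  The case \<open>q = \<infinity>\<close>: if the \<open>\<beta>\<close>-Hoelder constants are summable uniformly, then the gradients converge uniformly, and the limit is differentiable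
  in the classical sense.
\<close>

lemma holder_gradient:
  assumes \<beta>: "0 < \<beta>" "\<beta> \<le> 1" and r: "summable (rate \<beta> 0)"
  obtains B where "\<And>x. norm (Du x) \<le> B" "\<And>x y. norm (Du x - Du y) \<le> B * norm (x - y) powr \<beta>"
    "\<And>x. (u has_derivative (\<lambda>h. h v* Du x)) (at x)"
proof -
  define m where "m n = 2 * A * C * rate \<beta> 0 n" for n
  have m: "summable m" unfolding m_def by (intro summable_mult r)
  have m0: "0 \<le> m n" for n using A_nonneg C(1) rate_nonneg by (simp add: m_def)
  have em: "e \<beta> n x \<le> m n" for n x using e_bounds(2)[of 0 \<beta> n x] t(1)[of n] by (simp add: m_def)
  have fm: "norm (f n x) \<le> m n" for n x using f_le_e[of \<beta> n x] em[of n x] \<beta> by simp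
  have sn: "summable (\<lambda>n. norm (f n x))" for x
    by (rule summable_comparison_test'[OF m, of 0]) (use fm in auto)
  have sf: "summable (\<lambda>n. f n x)" for x by (rule summable_norm_cancel[OF sn])
  have 1: "norm (Du x) \<le> suminf m" for x
    unfolding Du_def by (rule order_trans[OF summable_norm[OF sn] suminf_le[OF fm sn m]])
  have 2: "norm (Du x - Du y) \<le> 2 * suminf m * norm (x - y) powr \<beta>" for x y
  proof -
    have hol: "norm (f n x - f n y) \<le> norm (x - y) powr \<beta> * (2 * m n)" for n
      using em[of n x] em[of n y]
      by (intro order_trans[OF f_holder_e[OF \<beta>]] mult_left_mono) auto
    have s2: "summable (\<lambda>n. norm (x - y) powr \<beta> * (2 * m n))" by (intro summable_mult m)
    have sd: "summable (\<lambda>n. norm (f n x - f n y))"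
      by (rule summable_comparison_test'[OF s2, of 0]) (use hol in auto)
    have "norm (Du x - Du y) = norm (\<Sum>n. f n x - f n y)"
      unfolding Du_def using suminf_diff[OF sf sf] by simp
    also have "\<dots> \<le> (\<Sum>n. norm (x - y) powr \<beta> * (2 * m n))"
      by (rule order_trans[OF summable_norm[OF sd] suminf_le[OF hol sd s2]])
    also have "\<dots> = norm (x - y) powr \<beta> * (2 * suminf m)"
      using suminf_mult[OF summable_mult[OF m, of 2]] suminf_mult[OF m, of 2] by simp
    finally show ?thesis by (simp add: mult_ac)
  qed
  have 3: "(u has_derivative (\<lambda>h. h v* Du x)) (at x)" for x
  proof -
    have unif: "uniform_limit UNIV (\<lambda>n x. \<Sum>i<n. f i x) Du sequentially"
      unfolding Du_def by (rule Weierstrass_m_test[OF fm m])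
    have ev: "\<forall>\<^sub>F n in sequentially. \<forall>x\<in>UNIV. \<forall>h. norm ((\<Sum>i<n. h v* f i x) - h v* Du x) \<le> \<epsilon> * norm h"
      if "\<epsilon> > 0" for \<epsilon>
      using unif[unfolded uniform_limit_iff, rule_format, OF that]
    proof eventually_elim
      case (elim n)
      show ?case
      proof (intro ballI allI)
        fix x h
        have "(\<Sum>i<n. h v* f i x) - h v* Du x = h v* ((\<Sum>i<n. f i x) - Du x)"
        proof -
          have add: "h v* (M + M') = h v* M + h v* M'" for M M' :: "real^'m^'k"
            by (simp add: vec_eq_iff vector_matrix_mult_def distrib_left sum.distrib)
          have "(\<Sum>i<n. h v* f i x) = h v* (\<Sum>i<n. f i x)"
            by (induction n) (simp_all add: add)
          moreover have "h v* (M - M') = h v* M - h v* M'" for M M' :: "real^'m^'k"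
            by (simp add: vec_eq_iff vector_matrix_mult_def right_diff_distrib sum_subtractf)
          ultimately show ?thesis by simp
        qed
        also have "norm \<dots> \<le> norm h * norm ((\<Sum>i<n. f i x) - Du x)" by (rule norm_vector_matrix_mult_le)
        also have "\<dots> \<le> norm h * \<epsilon>" using elim by (intro mult_left_mono) (auto simp: dist_norm less_imp_le)
        finally show "norm ((\<Sum>i<n. h v* f i x) - h v* Du x) \<le> \<epsilon> * norm h" by (simp add: mult.commute)
      qed
    qed
    have "\<exists>g. \<forall>x\<in>UNIV. (\<lambda>n. w n x) sums g x \<and> (g has_derivative (\<lambda>h. h v* Du x)) (at x within UNIV)"
    proof (rule has_derivative_series[where f' = "\<lambda>n x h. h v* f n x"])
      show "(w n has_derivative (\<lambda>h. h v* f n x)) (at x within UNIV)" for n x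
        using w_derivative by simp
      show "(\<lambda>n. w n 0) sums u 0" unfolding u_def by (rule summable_sums[OF w_summable])
    qed (use ev in auto)
    then obtain v where v: "\<And>x. (\<lambda>n. w n x) sums v x" "\<And>x. (v has_derivative (\<lambda>h. h v* Du x)) (at x)" by auto
    have "v = u" using v(1) by (auto simp: u_def fun_eq_iff sums_unique)
    with v(2) show ?thesis by simp
  qed
  show thesis
  proof (rule that[of "2 * suminf m"])
    show "norm (Du x) \<le> 2 * suminf m" for x
      using 1[of x] suminf_nonneg[OF m m0] by linarith
  qed (use 2 3 in auto)
qed

context
  fixes \<Omega> :: "(real^'k) set" and R :: real
  assumes \<Omega>: "open \<Omega>" "bounded \<Omega>" "\<Omega> \<subseteq> {x. \<forall>i. \<bar>x $ i\<bar> \<le> R}" and R: "0 \<le> R"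
begin

lemma \<Omega>_lebesgue: "\<Omega> \<in> sets lebesgue" 
  using \<Omega>(1) by (simp add: borel_open)

lemma nn_integral_e_powr_le:
  assumes q: "1 \<le> q"
  shows "(\<integral>\<^sup>+x. ennreal (e \<beta> n x powr q) \<partial>lebesgue_on \<Omega>)
     \<le> ennreal ((2 * A * C) powr q * (measure (lebesgue_on \<Omega>) \<Omega> + slab_const CARD('k) R 0) * rate \<beta> (1 / q) n powr q)"
proof -
  interpret finite_measure "lebesgue_on \<Omega>"
    by (intro finite_measure_lebesgue_on bounded_set_imp_lmeasurable \<Omega> \<Omega>_lebesgue)
  have [measurable]: "E n \<in> sets lebesgue" using open_E by (simp add: borel_open)
  have Em[measurable]: "(\<lambda>x. indicator (E n) x :: ennreal) \<in> borel_measurable (lebesgue_on \<Omega>)"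
    by (intro measurable_restrict_space1) measurable
  have tn: "0 < t n" using t(1) .
  define Y where "Y = (2 * A * C * rate \<beta> (1 / q) n) powr q"
  have AC: "0 \<le> 2 * A * C" using A_nonneg C(1) by simp
  have "ennreal (e \<beta> n x powr q) \<le> ennreal Y * (1 + ennreal (1 / t n) * indicator (E n) x)" for x
  proof (cases "x \<in> E n")
    case True
    have "e \<beta> n x powr q \<le> (2 * A * C * rate \<beta> (1 / q) n * t n powr (-(1 / q))) powr q"
      using q by (intro powr_mono2 e_bounds e_nonneg) auto
    also have "\<dots> = Y * (t n powr (-(1 / q))) powr q"
      unfolding Y_def using AC rate_nonneg by (intro powr_mult)
    also have "(t n powr (-(1 / q))) powr q = 1 / t n"
    proof -
      have "- (1 / q) * q = -1" using q by simp
      then show ?thesis unfolding powr_powr using tn by (simp add: powr_neg_one)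
    qed
    also have "Y * (1 / t n) \<le> Y * (1 + 1 / t n)" by (intro mult_left_mono) (auto simp: Y_def)
    finally have "ennreal (e \<beta> n x powr q) \<le> ennreal (Y * (1 + 1 / t n))" by (rule ennreal_leI)
    also have "\<dots> = ennreal Y * (1 + ennreal (1 / t n))"
    proof -
      have "ennreal (1 + 1 / t n) = 1 + ennreal (1 / t n)" using ennreal_plus[of 1 "1 / t n"] tn by simp
      then show ?thesis using tn by (simp add: ennreal_mult Y_def)
    qed
    finally show ?thesis using True by simp
  next
    case False
    have "e \<beta> n x powr q \<le> Y"
      unfolding Y_def using q False by (intro powr_mono2 e_bounds e_nonneg) auto
    then show ?thesis using False by (simp add: ennreal_leI)
  qed
  then have "(\<integral>\<^sup>+x. ennreal (e \<beta> n x powr q) \<partial>lebesgue_on \<Omega>)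
     \<le> (\<integral>\<^sup>+x. ennreal Y * (1 + ennreal (1 / t n) * indicator (E n) x) \<partial>lebesgue_on \<Omega>)"
    by (intro nn_integral_mono) auto
  also have "\<dots> = ennreal Y * (\<integral>\<^sup>+x. 1 + ennreal (1 / t n) * indicator (E n) x \<partial>lebesgue_on \<Omega>)"
    by (rule nn_integral_cmult) measurable
  also have "(\<integral>\<^sup>+x. 1 + ennreal (1 / t n) * indicator (E n) x \<partial>lebesgue_on \<Omega>)
      = (\<integral>\<^sup>+x. 1 \<partial>lebesgue_on \<Omega>) + (\<integral>\<^sup>+x. ennreal (1 / t n) * indicator (E n) x \<partial>lebesgue_on \<Omega>)"
    by (rule nn_integral_add) measurable
  also have "(\<integral>\<^sup>+x. ennreal (1 / t n) * indicator (E n) x \<partial>lebesgue_on \<Omega>) = ennreal (1 / t n) * (\<integral>\<^sup>+x. indicator (E n) x \<partial>lebesgue_on \<Omega>)"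
    by (rule nn_integral_cmult[OF Em])
  also have "(\<integral>\<^sup>+x. 1 \<partial>lebesgue_on \<Omega>) = ennreal (measure (lebesgue_on \<Omega>) \<Omega>)"
    by (simp add: emeasure_eq_measure)
  also have "ennreal Y * (ennreal (measure (lebesgue_on \<Omega>) \<Omega>) + ennreal (1 / t n) * (\<integral>\<^sup>+x. indicator (E n) x \<partial>lebesgue_on \<Omega>))
     \<le> ennreal Y * (ennreal (measure (lebesgue_on \<Omega>) \<Omega>) + ennreal (1 / t n) * ennreal (slab_const CARD('k) R 0 * t n))"
    by (intro mult_left_mono add_left_mono nn_integral_E_le[OF \<Omega>_lebesgue \<Omega>(2,3) R]) auto
  also have "\<dots> = ennreal (Y * (measure (lebesgue_on \<Omega>) \<Omega> + slab_const CARD('k) R 0))"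
    using tn slab_const_nonneg[OF R, of 0 "CARD('k)"]
    by (simp add: ennreal_mult[symmetric] ennreal_plus[symmetric] Y_def del: ennreal_plus)
  also have "Y * (measure (lebesgue_on \<Omega>) \<Omega> + slab_const CARD('k) R 0)
    = (2 * A * C) powr q * (measure (lebesgue_on \<Omega>) \<Omega> + slab_const CARD('k) R 0) * rate \<beta> (1 / q) n powr q"
    unfolding Y_def using powr_mult[of "2 * A * C" "rate \<beta> (1 / q) n" q] by simp
  finally show ?thesis .
qed

text \<open>
  The case of finite \<open>q\<close>, where only the \<open>L\<^sup>q\<close> norms of the local Hoelder constants are summable.
\<close>

lemma gradient_series:
  assumes q: "1 \<le> q" and \<beta>: "0 < \<beta>" "\<beta> \<le> 1" and \<theta>: "0 < \<theta>" "\<theta> < 1"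
    and r: "\<And>n. rate \<beta> (1 / q) n \<le> K * \<theta> ^ (2 * n)"
  shows "AE x in lebesgue_on \<Omega>. summable (\<lambda>n. norm (f n x))"
    and "(\<integral>\<^sup>+x. (\<Sum>n. ennreal (norm (f n x))) \<partial>lebesgue_on \<Omega>) < \<infinity>"
    and "Du \<in> Lp_space (ennreal q) \<Omega>"
    and "\<alpha> < \<beta> \<Longrightarrow> gagliardo \<alpha> q \<Omega> Du < \<infinity>"
proof -
  define Q where "Q = (2 * A * C) powr q * (measure (lebesgue_on \<Omega>) \<Omega> + slab_const CARD('k) R 0)"
  have Q: "0 \<le> Q" using slab_const_nonneg[OF R, of 0 "CARD('k)"] by (simp add: Q_def)
  have int: "(\<integral>\<^sup>+x. ennreal (e \<beta> n x powr q) \<partial>lebesgue_on \<Omega>) \<le> ennreal ((Q * K powr q) * (\<theta> ^ (2 * n)) powr q)" for n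
  proof -
    have K: "0 \<le> K" using order_trans[OF rate_nonneg r[of 0]] by simp
    have "rate \<beta> (1 / q) n powr q \<le> (K * \<theta> ^ (2 * n)) powr q"
      using q by (intro powr_mono2 r rate_nonneg) auto
    also have "\<dots> = K powr q * (\<theta> ^ (2 * n)) powr q"
      by (rule powr_mult)
    finally have "Q * rate \<beta> (1 / q) n powr q \<le> (Q * K powr q) * (\<theta> ^ (2 * n)) powr q"
      using Q by (simp add: mult_left_mono mult.assoc)
    with nn_integral_e_powr_le[OF q, of \<beta> n] show ?thesis
      unfolding Q_def[symmetric] by (meson ennreal_leI order_trans)
  qed
  note fs = fractional_series[OF \<Omega>_lebesgue \<Omega>(2) q \<theta>, where f = f and e = "e \<beta>" and b = \<beta> and K = "Q * K powr q",
      OF f_measurable e_measurable f_le_e[OF less_imp_le[OF \<beta>(1)]] f_holder_e[OF \<beta>] int]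
  show "AE x in lebesgue_on \<Omega>. summable (\<lambda>n. norm (f n x))" by (rule fs(1))
  show "(\<integral>\<^sup>+x. (\<Sum>n. ennreal (norm (f n x))) \<partial>lebesgue_on \<Omega>) < \<infinity>" by (rule fs(2))
  show "Du \<in> Lp_space (ennreal q) \<Omega>" using fs(3) by (simp add: Du_def[abs_def])
  show "gagliardo \<alpha> q \<Omega> Du < \<infinity>" if "\<alpha> < \<beta>" using fs(4)[OF that] by (simp add: Du_def[abs_def])
qed

lemma weak_gradient_u:
  assumes D: "compact D" "D \<subseteq> \<Omega>"
    and "AE x in lebesgue_on \<Omega>. summable (\<lambda>n. norm (f n x))"
    and "(\<integral>\<^sup>+x. (\<Sum>n. ennreal (norm (f n x))) \<partial>lebesgue_on \<Omega>) < \<infinity>"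
  shows "weak_gradient \<Omega> u Du"
  unfolding u_def[abs_def] Du_def[abs_def]
proof (rule weak_gradient_series[OF \<Omega>(1) D w_derivative f_continuous _ _ norm_w_le w_bound_sums(1) assms(3,4)])
  fix n x assume "x \<notin> D"
  then have "\<not> good x" using good_D(1) by blast
  then show "w n x = 0" "f n x = 0" using not_good by blast+
qed

end

end

section \<open>Choice of the gap widths\<close>

lemma powr_le_exponential:
  fixes p \<kappa> :: real
  assumes "0 \<le> p" "0 < \<kappa>"
  obtains K where "0 < K" "\<And>n. real (Suc n) powr p \<le> K * 2 powr (\<kappa> * real n)"
proof
  define c where "c = \<kappa> * ln 2"
  have c: "c > 0" using assms by (simp add: c_def)
  define K where "K = exp (c + p * \<bar>ln ((p + 1) / c)\<bar>)"
  show "0 < K" by (simp add: K_def)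
  fix n
  define y where "y = real (Suc n)"
  have y: "y > 0" by (simp add: y_def)
  have "ln y = ln (y * c / (p + 1)) + ln ((p + 1) / c)"
    using y c assms by (subst ln_mult_pos[symmetric]) auto
  also have "\<dots> \<le> y * c / (p + 1) + \<bar>ln ((p + 1) / c)\<bar>"
    using ln_le_minus_one[of "y * c / (p + 1)"] y c assms by (intro add_mono) auto
  finally have "p * ln y \<le> p * (y * c / (p + 1) + \<bar>ln ((p + 1) / c)\<bar>)"
    using assms by (intro mult_left_mono)
  also have "\<dots> = (p / (p + 1)) * (y * c) + p * \<bar>ln ((p + 1) / c)\<bar>" by (simp add: algebra_simps)
  also have "\<dots> \<le> 1 * (y * c) + p * \<bar>ln ((p + 1) / c)\<bar>"
    using assms y c by (intro add_right_mono mult_right_mono) auto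
  also have "\<dots> = (c + p * \<bar>ln ((p + 1) / c)\<bar>) + c * real n"
    by (simp add: y_def algebra_simps)
  finally have "exp (p * ln y) \<le> K * exp (c * real n)"
    by (simp add: K_def exp_add[symmetric])
  moreover have "y powr p = exp (p * ln y)" using y by (simp add: powr_def)
  moreover have "2 powr (\<kappa> * real n) = exp (c * real n)" by (simp add: powr_def c_def mult_ac)
  ultimately show "real (Suc n) powr p \<le> K * 2 powr (\<kappa> * real n)" by (simp add: y_def)
qed

text \<open>
  The power \<open>\<sigma> / (1 - \<sigma>)\<close> of \<open>2^n\<close> is the borderline for the summability of \<open>(t n * d n) powr (1 - \<sigma>) / d n\<close>; the power of
  \<open>n\<close> turns this series into the sum of the inverse squares. For \<open>\<sigma> = 0\<close> there is no exponential decay.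
\<close>

definition gap :: "real \<Rightarrow> real \<Rightarrow> nat \<Rightarrow> real" where
  "gap t0 \<sigma> n = t0 * real (Suc n) powr (- (2 / (1 - \<sigma>))) * 2 powr (- (\<sigma> / (1 - \<sigma>)) * real n)"

lemma gap_bounds:
  assumes "0 < t0" "0 \<le> \<sigma>" "\<sigma> < 1"
  shows "0 < gap t0 \<sigma> n" "gap t0 \<sigma> n \<le> t0 * (1 / real (Suc n) ^ 2)" "gap t0 \<sigma> n \<le> t0"
proof -
  show "0 < gap t0 \<sigma> n" using assms by (simp add: gap_def)
  have "2 \<le> 2 / (1 - \<sigma>)" using assms by (simp add: field_simps)
  then have "real (Suc n) powr (- (2 / (1 - \<sigma>))) \<le> real (Suc n) powr (-2)"
    by (intro powr_mono) auto
  also have "\<dots> = 1 / real (Suc n) ^ 2" by (simp add: powr_minus powr_numeral divide_inverse)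
  finally have 1: "real (Suc n) powr (- (2 / (1 - \<sigma>))) \<le> 1 / real (Suc n) ^ 2" .
  have "0 \<le> (\<sigma> / (1 - \<sigma>)) * real n" using assms by simp
  then have 2: "2 powr (- (\<sigma> / (1 - \<sigma>)) * real n) \<le> 1" using powr_mono[of "- (\<sigma> / (1 - \<sigma>)) * real n" 0 2] by simp
  have "gap t0 \<sigma> n \<le> t0 * (1 / real (Suc n) ^ 2) * 1"
    unfolding gap_def using assms 1 2 by (intro mult_mono mult_left_mono) auto
  then show "gap t0 \<sigma> n \<le> t0 * (1 / real (Suc n) ^ 2)" by simp
  also have "\<dots> \<le> t0 * 1" using assms by (intro mult_left_mono) (auto simp: divide_le_eq)
  finally show "gap t0 \<sigma> n \<le> t0" by simp
qed

lemma summable_inverse_squares: "summable (\<lambda>n. 1 / real (Suc n) ^ 2)"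
proof -
  have "summable (\<lambda>n. inverse (real n ^ 2))" by (rule inverse_power_summable) simp
  then have "summable (\<lambda>n. inverse (real (Suc n) ^ 2))" by (subst summable_Suc_iff)
  then show ?thesis by (simp add: divide_inverse)
qed

context cube_construction
begin

context
  fixes t0 \<sigma> :: real
  assumes t0: "0 < t0" and \<sigma>: "0 \<le> \<sigma>" "\<sigma> < 1" and tn: "\<And>n. t n = gap t0 \<sigma> n"
begin

lemma d_powr: "d n powr r = \<delta> powr r * 2 powr (- r * real n)"
proof -
  have "d n = \<delta> * 2 powr (- real n)"
    by (simp add: d_def powr_minus powr_realpow divide_inverse)
  then show ?thesis by (simp add: powr_mult powr_powr mult.commute)
qed

lemma t_powr: "t n powr r = t0 powr r * (real (Suc n) powr (- (2 / (1 - \<sigma>)) * r) * 2 powr (- (\<sigma> / (1 - \<sigma>)) * r * real n))"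
  unfolding tn gap_def by (simp add: powr_mult powr_powr mult_ac)

text \<open>
  Collecting the powers of \<open>2^n\<close>, the rate is a power of \<open>n\<close> times \<open>2 powr (-\<kappa> * n)\<close> with
  \<open>(1 - \<sigma>) * \<kappa> = 1 - (2 - \<iota>) * \<sigma> - \<beta>\<close>. The power of \<open>n\<close> is absorbed by half of the exponent.
\<close>

lemma rate_le_geometric:
  assumes \<beta>: "0 < \<beta>" and \<iota>: "\<iota> \<le> 1" and lt: "\<beta> < 1 - (2 - \<iota>) * \<sigma>"
  obtains K \<theta> where "0 < \<theta>" "\<theta> < 1" "\<And>n. rate \<beta> \<iota> n \<le> K * \<theta> ^ (2 * n)"
proof -
  define \<tau> where "\<tau> = \<sigma> / (1 - \<sigma>)"
  define \<kappa> where "\<kappa> = 1 - \<beta> - \<tau> * (1 + \<beta> - \<iota>)"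
  have "(1 - \<sigma>) * \<tau> = \<sigma>" using \<sigma> by (simp add: \<tau>_def)
  then have "(1 - \<sigma>) * \<kappa> = (1 - \<sigma>) * (1 - \<beta>) - \<sigma> * (1 + \<beta> - \<iota>)"
    by (simp add: \<kappa>_def right_diff_distrib mult.assoc[symmetric])
  also have "\<dots> = 1 - (2 - \<iota>) * \<sigma> - \<beta>" by (simp add: algebra_simps)
  finally have "0 < (1 - \<sigma>) * \<kappa>" using lt by simp
  then have \<kappa>: "0 < \<kappa>" using \<sigma> by (simp add: zero_less_mult_iff)
  define p where "p = (2 / (1 - \<sigma>)) * (1 + \<beta> - \<iota>)"
  have p: "0 \<le> p" using \<sigma> \<beta> \<iota> by (simp add: p_def)
  define Q where "Q = 2 powr \<beta> * \<delta> powr (1 - \<beta>) * t0 powr (\<iota> - 1 - \<beta>)"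
  have Q: "0 \<le> Q" by (simp add: Q_def)
  have form: "rate \<beta> \<iota> n = Q * (real (Suc n) powr p * 2 powr (- \<kappa> * real n))" for n
  proof -
    \<comment> \<open>All powers are separated, so that \<open>d_powr\<close> and \<open>t_powr\<close> apply.\<close>
    have h: "(t n * d n / 2) powr (-\<beta>) = t n powr (-\<beta>) * d n powr (-\<beta>) * 2 powr \<beta>"
    proof -
      have "(1/2 :: real) = 2 powr (-1)" by (simp add: powr_neg_one)
      then have "(1/2 :: real) powr (-\<beta>) = 2 powr (-1 * (-\<beta>))" by (simp only: powr_powr)
      moreover have "t n * d n / 2 = t n * d n * (1/2)" by simp
      ultimately show ?thesis by (simp only: powr_mult mult_minus1 minus_minus)
    qed
    have "rate \<beta> \<iota> n = 2 powr \<beta> * (d n * d n powr (-\<beta>)) * (t n powr (-\<beta>) * t n powr (\<iota> - 1))"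
      unfolding rate_def h by (simp only: mult_ac)
    also have "d n * d n powr (-\<beta>) = d n powr (1 - \<beta>)"
      using d_pos[of n] powr_add[of "d n" 1 "-\<beta>"] by simp
    also have "t n powr (-\<beta>) * t n powr (\<iota> - 1) = t n powr (\<iota> - 1 - \<beta>)"
      using powr_add[of "t n" "-\<beta>" "\<iota> - 1"] by (simp add: algebra_simps)
    also have "2 powr \<beta> * d n powr (1 - \<beta>) * t n powr (\<iota> - 1 - \<beta>) = Q * (real (Suc n) powr (- (2 / (1 - \<sigma>)) * (\<iota> - 1 - \<beta>)) *
        (2 powr (- (1 - \<beta>) * real n) * 2 powr (- \<tau> * (\<iota> - 1 - \<beta>) * real n)))"
      unfolding d_powr t_powr \<tau>_def[symmetric] Q_def by (simp only: mult_ac)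
    also have "2 powr (- (1 - \<beta>) * real n) * 2 powr (- \<tau> * (\<iota> - 1 - \<beta>) * real n) = 2 powr (- \<kappa> * real n)"
    proof -
      have "- (1 - \<beta>) * real n + - \<tau> * (\<iota> - 1 - \<beta>) * real n = - \<kappa> * real n"
        by (simp add: \<kappa>_def algebra_simps)
      then show ?thesis by (simp only: powr_add[symmetric])
    qed
    also have "- (2 / (1 - \<sigma>)) * (\<iota> - 1 - \<beta>) = p"
    proof -
      have "- X * (\<iota> - 1 - \<beta>) = X * (1 + \<beta> - \<iota>)" for X :: real by (simp add: algebra_simps)
      then show ?thesis unfolding p_def .
    qed
    finally show ?thesis .
  qed
  obtain K where K: "0 < K" "\<And>n. real (Suc n) powr p \<le> K * 2 powr (\<kappa> / 2 * real n)"
    using powr_le_exponential[OF p, of "\<kappa> / 2"] \<kappa> by auto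
  define \<theta> :: real where "\<theta> = 2 powr (- \<kappa> / 4)"
  show thesis
  proof (rule that[of \<theta> "Q * K"])
    show "0 < \<theta>" "\<theta> < 1" using \<kappa> powr_less_mono[of "-\<kappa>/4" 0 2] by (simp_all add: \<theta>_def)
    fix n
    have "rate \<beta> \<iota> n \<le> Q * (K * 2 powr (\<kappa> / 2 * real n) * 2 powr (- \<kappa> * real n))"
      unfolding form using Q K by (intro mult_left_mono mult_right_mono) auto
    also have "K * 2 powr (\<kappa> / 2 * real n) * 2 powr (- \<kappa> * real n) = K * 2 powr (- \<kappa> / 2 * real n)"
    proof -
      have "\<kappa> / 2 * real n + - \<kappa> * real n = - \<kappa> / 2 * real n" by simp
      then show ?thesis by (simp only: mult.assoc powr_add[symmetric])
    qed
    also have "2 powr (- \<kappa> / 2 * real n) = \<theta> ^ (2 * n)"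
    proof -
      have "\<theta> ^ (2 * n) = \<theta> powr real (2 * n)" by (rule powr_realpow[symmetric]) (simp add: \<theta>_def)
      also have "\<dots> = 2 powr (- \<kappa> / 4 * real (2 * n))" by (simp only: \<theta>_def powr_powr)
      also have "- \<kappa> / 4 * real (2 * n) = - \<kappa> / 2 * real n" by simp
      finally show ?thesis ..
    qed
    finally show "rate \<beta> \<iota> n \<le> Q * K * \<theta> ^ (2 * n)" by (simp add: mult.assoc)
  qed
qed

lemma rate_summable:
  assumes "0 < \<beta>" "\<beta> < 1 - 2 * \<sigma>"
  shows "summable (rate \<beta> 0)"
proof -
  obtain K \<theta> where \<theta>: "0 < \<theta>" "\<theta> < 1" and r: "\<And>n. rate \<beta> 0 n \<le> K * \<theta> ^ (2 * n)"
    by (rule rate_le_geometric[of \<beta> 0]) (use assms in auto)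
  have "summable (\<lambda>n. K * (\<theta>\<^sup>2) ^ n)"
    using \<theta> by (intro summable_mult summable_geometric) (simp add: abs_square_less_1)
  then show ?thesis
  proof (rule summable_comparison_test'[of _ 0])
    show "norm (rate \<beta> 0 n) \<le> K * (\<theta>\<^sup>2) ^ n" for n
      using r[of n] rate_nonneg[of \<beta> 0 n] by (simp only: power_mult real_norm_def abs_of_nonneg)
  qed
qed

lemma gap_summable: "summable (\<lambda>n. (t n * d n) powr (1 - \<sigma>) / d n)"
proof -
  have cancel: "- (y / v) * v = - y" if "v \<noteq> 0" for y v :: real using that by simp
  have eq: "(t n * d n) powr (1 - \<sigma>) / d n = t0 powr (1 - \<sigma>) * \<delta> powr (- \<sigma>) * (1 / real (Suc n) ^ 2)" for n
  proof -
    have "(t n * d n) powr (1 - \<sigma>) / d n = t n powr (1 - \<sigma>) * (d n powr (1 - \<sigma>) * (1 / d n))"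
      by (simp add: powr_mult)
    also have "1 / d n = d n powr (-1)"
      using d_pos[of n] by (simp add: powr_neg_one)
    also have "d n powr (1 - \<sigma>) * d n powr (-1) = d n powr (- \<sigma>)"
      using powr_add[of "d n" "1 - \<sigma>" "-1"] by simp
    also have "t n powr (1 - \<sigma>) * d n powr (- \<sigma>) = t0 powr (1 - \<sigma>) * \<delta> powr (- \<sigma>) *
        (real (Suc n) powr (- (2 / (1 - \<sigma>)) * (1 - \<sigma>)) * (2 powr (- (\<sigma> / (1 - \<sigma>)) * (1 - \<sigma>) * real n) * 2 powr (- (- \<sigma>) * real n)))"
      unfolding t_powr d_powr by (simp only: mult_ac)
    also have "- (2 / (1 - \<sigma>)) * (1 - \<sigma>) = -2" by (rule cancel) (use \<sigma> in simp)
    also have "- (\<sigma> / (1 - \<sigma>)) * (1 - \<sigma>) = - \<sigma>" by (rule cancel) (use \<sigma> in simp)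
    also have "2 powr (- \<sigma> * real n) * 2 powr (- (- \<sigma>) * real n) = 1" by (simp add: powr_add[symmetric])
    also have "real (Suc n) powr (-2) * 1 = 1 / real (Suc n) ^ 2"
      by (simp add: powr_minus powr_numeral divide_inverse)
    finally show ?thesis .
  qed
  show ?thesis unfolding eq by (intro summable_mult summable_inverse_squares)
qed

end

end

section \<open>Choice of the cubes and conclusion\<close>

text \<open>
  The notion \<open>local_lipschitz\<close>, for which the compactness argument is known, concerns families of maps with a
  second parameter; here this parameter ranges over a single point.
\<close>

lemma locally_lipschitz_compact:
  fixes F :: "'a::metric_space \<Rightarrow> 'b::metric_space"
  assumes "locally_lipschitz_on S F" "compact X" "X \<subseteq> S"
  obtains L where "L-lipschitz_on X F"
proof -
  have "local_lipschitz {0::real} X (\<lambda>_. F)"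
    unfolding local_lipschitz_def
  proof (intro ballI)
    fix x and t :: real assume "x \<in> X"
    then obtain r L where r: "r > 0" "L-lipschitz_on (ball x r \<inter> S) F"
      using assms(1,3) unfolding locally_lipschitz_on_def by blast
    have "cball x (r/2) \<inter> X \<subseteq> ball x r \<inter> S" using r(1) assms(3) by auto
    then have "L-lipschitz_on (cball x (r/2) \<inter> X) F" by (rule lipschitz_on_subset[OF r(2)])
    then show "\<exists>u>0. \<exists>L. \<forall>t\<in>cball t u \<inter> {0}. L-lipschitz_on (cball x u \<inter> X) F"
      using r(1) by (intro exI[of _ "r/2"]) auto
  qed
  then obtain L where "\<And>t. t \<in> {0::real} \<Longrightarrow> L-lipschitz_on X F"
    by (rule local_lipschitz_compact_implies_lipschitz[OF _ assms(2)]) auto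
  then show thesis using that by blast
qed

lemma Lp_space_bounded:
  fixes v :: "'a::euclidean_space \<Rightarrow> 'b::euclidean_space"
  assumes \<Omega>: "\<Omega> \<in> sets lebesgue" "bounded \<Omega>" and v: "v \<in> borel_measurable borel" and B: "\<And>x. norm (v x) \<le> B"
  shows "Linf_norm \<Omega> v \<le> ennreal B" and "v \<in> Lp_space p \<Omega>"
proof -
  have vm[measurable]: "v \<in> borel_measurable (lebesgue_on \<Omega>)"
    by (rule measurable_borel_lebesgue_on[OF v])
  show L: "Linf_norm \<Omega> v \<le> ennreal B"
    unfolding Linf_norm_def by (rule esssup_I) (auto intro!: ennreal_leI B)
  have B0: "0 \<le> B" using order_trans[OF norm_ge_zero B] .
  interpret finite_measure "lebesgue_on \<Omega>"
    by (intro finite_measure_lebesgue_on bounded_set_imp_lmeasurable \<Omega>)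
  have "(\<integral>\<^sup>+x. ennreal (norm (v x) powr r) \<partial>lebesgue_on \<Omega>) < \<infinity>" if "0 \<le> r" for r
  proof -
    have "(\<integral>\<^sup>+x. ennreal (norm (v x) powr r) \<partial>lebesgue_on \<Omega>) \<le> (\<integral>\<^sup>+x. ennreal (B powr r) \<partial>lebesgue_on \<Omega>)"
      using that by (intro nn_integral_mono ennreal_leI powr_mono2 B) auto
    also have "\<dots> < \<infinity>"
    proof -
      have "emeasure (lebesgue_on \<Omega>) (space (lebesgue_on \<Omega>)) < top"
        using emeasure_finite[of "space (lebesgue_on \<Omega>)"] less_top by blast
      then show ?thesis by (simp add: ennreal_mult_less_top)
    qed
    finally show ?thesis .
  qed
  moreover have "Linf_norm \<Omega> v < \<infinity>" using order.strict_trans1[OF L ennreal_less_top] by simp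
  ultimately show "v \<in> Lp_space p \<Omega>" unfolding Lp_space_def by (auto intro: vm)
qed

text \<open>
  The order of the choices: first a compact set \<open>K\<close> that exhausts \<open>\<Omega>\<close> up to measure \<open>e0\<close>, then a compact neighbourhood \<open>D\<close> of \<open>K\<close> in \<open>\<Omega>\<close> on which \<open>F\<close>
  is bounded and Lipschitz, then \<open>\<delta>\<close>, small enough that the cubes that meet \<open>K\<close> stay in \<open>D\<close> and that \<open>u\<close> is bounded by \<open>\<eta>\<close>, and
  finally \<open>t0\<close>, which makes the total measure of the gaps at most \<open>e0\<close>.
\<close>

lemma exists_construction:
  fixes F :: "(real^'k) \<times> (real^'m) \<Rightarrow> real^'m^'k" and \<Omega> :: "(real^'k) set"
  assumes \<eta>: "0 < \<eta>" and e0: "0 < e0" and \<Omega>: "open \<Omega>" "bounded \<Omega>"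
    and F: "locally_lipschitz_on (\<Omega> \<times> UNIV) F"
    and R: "0 \<le> R" and \<sigma>: "0 \<le> \<sigma>" "\<sigma> < 1"
  obtains \<delta> t0 C M L good D K where "cube_construction \<delta> (gap t0 \<sigma>) C M L F good D"
    "0 < t0" "compact D" "D \<subseteq> \<Omega>" "K \<subseteq> \<Omega>" "K \<in> sets lebesgue" "emeasure lebesgue (\<Omega> - K) \<le> ennreal e0"
    "\<And>x. x \<in> K \<Longrightarrow> good x" "C * \<delta> * (M + 2 * L * real CARD('k) * (1 + M)) \<le> \<eta>"
    "slab_const CARD('k) R 0 * (t0 * (\<Sum>n. 1 / real (Suc n) ^ 2)) \<le> e0"
proof -
  define k where "k = real CARD('k)"
  have k: "1 \<le> k" by (simp add: k_def Suc_le_eq)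
  have \<Omega>L: "\<Omega> \<in> sets lebesgue" using \<Omega>(1) by (simp add: borel_open)
  obtain K where K: "closed K" "K \<subseteq> \<Omega>" "emeasure lebesgue (\<Omega> - K) < ennreal e0"
    using sets_lebesgue_inner_closed[OF \<Omega>L e0] by metis
  have Kc: "compact K" using K(1,2) \<Omega>(2) bounded_subset compact_eq_bounded_closed by blast
  obtain r where r: "r > 0" "(\<Union>x\<in>K. cball x r) \<subseteq> \<Omega>"
    using compact_subset_open_imp_cball_epsilon_subset[OF Kc \<Omega>(1) K(2)] by blast
  define D where "D = (\<Union>x\<in>K. cball x r)"
  have D: "compact D" "D \<subseteq> \<Omega>" unfolding D_def using compact_minkowski_sum_cball[OF Kc] r(2) by auto
  define X where "X = D \<times> cball (0::real^'m) 1"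
  have X: "compact X" "X \<subseteq> \<Omega> \<times> UNIV" unfolding X_def using D by (auto intro: compact_Times)
  obtain L where L: "L-lipschitz_on X F" using locally_lipschitz_compact[OF F X] by blast
  have L0: "0 \<le> L" using L by (rule lipschitz_on_nonneg)
  obtain M0 where M0: "\<And>p. p \<in> X \<Longrightarrow> norm (F p) \<le> M0"
    using compact_imp_bounded[OF compact_continuous_image[OF lipschitz_on_continuous_on[OF L] X(1)]]
    by (auto simp: bounded_iff)
  define M where "M = max 0 M0"
  have M: "0 \<le> M" "\<And>p. p \<in> X \<Longrightarrow> norm (F p) \<le> M" using M0 by (fastforce simp: M_def)+
  obtain C :: real where C: "C \<ge> 1"
    "\<And>t z. 0 < t \<Longrightarrow> t \<le> 1/2 \<Longrightarrow> norm (prof t (z::real^'k)) \<le> C"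
    "\<And>t z. 0 < t \<Longrightarrow> t \<le> 1/2 \<Longrightarrow> norm (dprof t (z::real^'k)) \<le> C / t"
    "\<And>t y z. 0 < t \<Longrightarrow> t \<le> 1/2 \<Longrightarrow> norm (dprof t (y::real^'k) - dprof t z) \<le> C / t\<^sup>2 * norm (y - z)"
    by (rule profile_bounds) blast
  define B where "B = C * (M + 2 * L * k * (1 + M))"
  have B: "0 \<le> B" using C(1) M(1) L0 k by (simp add: B_def)
  define \<delta> where "\<delta> = Min {1, 1 / (2 * k * M + 1), \<eta> / (B + 1), r / (2 * k)}"
  have pos: "0 < 2 * k * M + 1" using k M(1) by (simp add: add_nonneg_pos)
  have \<delta>: "0 < \<delta>" "\<delta> \<le> 1" "\<delta> \<le> 1 / (2 * k * M + 1)" "\<delta> \<le> \<eta> / (B + 1)" "\<delta> \<le> r / (2 * k)"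
    using pos \<eta> B r(1) k unfolding \<delta>_def by (auto simp: Min_le_iff)
  have d1: "2 * k * M * \<delta> \<le> 1"
  proof -
    have "\<delta> * (2 * k * M + 1) \<le> 1" using \<delta>(3) pos by (simp add: pos_le_divide_eq)
    then show ?thesis using \<delta>(1) by (simp add: algebra_simps)
  qed
  have d2: "C * \<delta> * (M + 2 * L * k * (1 + M)) \<le> \<eta>"
  proof -
    have "\<delta> * (B + 1) \<le> \<eta>" using \<delta>(4) B by (simp add: pos_le_divide_eq)
    then have "\<delta> * B \<le> \<eta>" using \<delta>(1) by (simp add: algebra_simps)
    then show ?thesis by (simp add: B_def mult_ac)
  qed
  have d3: "2 * k * \<delta> \<le> r" using \<delta>(5) k by (simp add: field_simps)
  define good where "good x \<longleftrightarrow> (\<exists>z\<in>K. centre \<delta> z = centre \<delta> x)" for x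
  have goodD: "y \<in> D" if g: "good x" and yx: "norm (y - x) \<le> k * (\<delta> / 2)" for x y
  proof -
    obtain z where z: "z \<in> K" "centre \<delta> z = centre \<delta> x" using g unfolding good_def by blast
    have "z - y = (z - centre \<delta> z) + ((centre \<delta> x - x) + (x - y))" using z(2) by simp
    then have "norm (z - y) = norm ((z - centre \<delta> z) + ((centre \<delta> x - x) + (x - y)))" by (rule arg_cong)
    also have "\<dots> \<le> norm (z - centre \<delta> z) + (norm (centre \<delta> x - x) + norm (x - y))"
      by (rule order_trans[OF norm_triangle_ineq add_left_mono[OF norm_triangle_ineq]])
    also have "\<dots> \<le> k * (\<delta>/2) + (k * (\<delta>/2) + k * (\<delta>/2))"
      using norm_centre_le[OF \<delta>(1), of z] norm_centre_le[OF \<delta>(1), of x] yx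
      unfolding k_def norm_minus_commute[of "centre \<delta> x"] norm_minus_commute[of x y] by linarith
    also have "\<dots> \<le> 2 * k * \<delta>" using k \<delta>(1) by simp
    also have "\<dots> \<le> r" by (rule d3)
    finally show ?thesis using z(1) by (auto simp: D_def dist_norm)
  qed
  have S0: "0 \<le> (\<Sum>n. 1 / real (Suc n) ^ 2)" by (intro suminf_nonneg summable_inverse_squares) simp
  define W where "W = slab_const CARD('k) R 0 * (\<Sum>n. 1 / real (Suc n) ^ 2)"
  have W: "0 \<le> W" unfolding W_def using slab_const_nonneg[OF R, of 0 "CARD('k)"] S0 by simp
  define t0 where "t0 = min (1/2) (e0 / (W + 1))"
  have t0: "0 < t0" "t0 \<le> 1/2" "t0 \<le> e0 / (W + 1)" 
    using e0 W unfolding t0_def by (simp, intro min.cobounded1, intro min.cobounded2)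
  have "t0 * W \<le> e0"
  proof -
    have "t0 * (W + 1) \<le> e0" using t0(3) W by (simp add: pos_le_divide_eq)
    then show ?thesis using t0(1) by (simp add: algebra_simps)
  qed
  then have small: "slab_const CARD('k) R 0 * (t0 * (\<Sum>n. 1 / real (Suc n) ^ 2)) \<le> e0"
    by (simp only: W_def mult_ac)
  have "cube_construction \<delta> (gap t0 \<sigma>) C M L F good D"
  proof
    show "gap t0 \<sigma> n \<le> 1/2" for n using gap_bounds(3)[OF t0(1) \<sigma>, of n] t0(2) by linarith
    show "good x \<Longrightarrow> x \<in> D" for x using goodD[of x x] k \<delta>(1) by simp
    show "good x \<Longrightarrow> centre (\<delta> / 2^n) x \<in> D" for x n
    proof (rule goodD)
      have dn: "0 < \<delta> / 2^n" "\<delta> / 2^n \<le> \<delta>" using \<delta>(1) by (simp_all add: divide_le_eq mult_left_le[of 1] )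
      have "norm (x - centre (\<delta> / 2^n) x) \<le> k * (\<delta> / 2^n / 2)" unfolding k_def by (rule norm_centre_le[OF dn(1)])
      also have "\<dots> \<le> k * (\<delta> / 2)" using dn(2) k by (intro mult_left_mono divide_right_mono) auto
      finally show "norm (centre (\<delta> / 2^n) x - x) \<le> k * (\<delta> / 2)" by (simp add: norm_minus_commute)
    qed
    show "norm (F (z, v)) \<le> M" if "z \<in> D" "norm v \<le> 1" for z v
      using M(2)[of "(z, v)"] that by (simp add: X_def)
    show "norm (F (z, v) - F (z', v')) \<le> L * (norm (z - z') + norm (v - v'))"
      if "z \<in> D" "norm v \<le> 1" "z' \<in> D" "norm v' \<le> 1" for z v z' v'
    proof -
      have "dist (F (z, v)) (F (z', v')) \<le> L * dist (z, v) (z', v')"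
        using L that by (intro lipschitz_onD) (auto simp: X_def)
      also have "dist (z, v) (z', v') \<le> norm (z - z') + norm (v - v')"
        unfolding dist_Pair_Pair unfolding dist_norm by (rule sqrt_sum_squares_le_sum) auto
      finally show ?thesis using L0 by (simp add: dist_norm mult_left_mono)
    qed
  qed (use \<delta>(1,2) C M(1) L0 d1 gap_bounds(1)[OF t0(1) \<sigma>] in \<open>auto simp: good_def k_def\<close>)
  moreover have "good x" if "x \<in> K" for x using that by (auto simp: good_def)
  ultimately show thesis
    using that[of \<delta> t0 C M L good D K] t0(1) D K d2 small by (simp add: k_def borel_closed less_imp_le)
qed

theorem theorem1p2p3:
  fixes \<eta> \<epsilon> \<alpha> s :: real and q :: ennreal
    and \<Omega> :: "(real^'k) set"
    and F :: "(real^'k) \<times> (real^'m) \<Rightarrow> real^'m^'k"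
  assumes "\<eta> > 0" and "\<epsilon> > 0" and "1 \<le> q"
    and "0 \<le> \<alpha>" and "\<alpha> < 1"
    and "0 \<le> s" and "s < (if q = \<infinity> then 1 / 2 else enn2real q / (2 * enn2real q - 1))"
    and "\<alpha> < 1 - (2 - (if q = \<infinity> then 0 else 1 / enn2real q)) * s"
    and "open \<Omega>" and "bounded \<Omega>"
    and "locally_lipschitz_on (\<Omega> \<times> UNIV) F"
  shows "\<exists>\<CC> (u :: real^'k \<Rightarrow> real^'m) (Du :: real^'k \<Rightarrow> real^'m^'k).
    compact \<CC> \<and> \<CC> \<subseteq> \<Omega> \<and> weak_gradient \<Omega> u Du \<and>
    (supp_on \<Omega> u \<subseteq> \<Omega> \<and> Linf_norm \<Omega> u \<le> ennreal \<eta> \<and>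
      (AE x in lebesgue_on \<CC>. Du x = F (x, u x))) \<and>
    (measure lebesgue (\<Omega> - \<CC>) \<le> \<epsilon> * measure lebesgue \<Omega> \<and>
      indicat_real \<CC> \<in> frac_sobolev s 1 \<Omega>) \<and>
    (u \<in> Lp_space \<infinity> \<Omega> \<inter> sobolev1 q \<Omega> \<and> Du \<in> frac_sobolev \<alpha> q \<Omega>) \<and>
    (s < 1 / 2 \<longrightarrow> u \<in> C1c_on \<Omega> \<and> (\<forall>x\<in>\<CC>. has_gradient u (F (x, u x)) x)) \<and>
    (s = 0 \<longrightarrow> u \<in> (\<Inter>\<beta>\<in>{0<..<1}. C1_holder \<beta> \<Omega>))"
proof -
  note \<eta> = assms(1) and \<epsilon> = assms(2) and \<Omega> = assms(9,10) and F = assms(11)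
  define \<iota> where "\<iota> = (if q = \<infinity> then 0 else 1 / enn2real q)"
  have q1: "1 \<le> enn2real q" if "q \<noteq> \<infinity>"
    using enn2real_mono[of 1 q] assms(3) that by (simp add: less_top)
  have qe: "ennreal (enn2real q) = q" if "q \<noteq> \<infinity>"
    by (rule ennreal_enn2real) (use that in \<open>simp add: less_top\<close>)
  have \<iota>: "0 \<le> \<iota>" "\<iota> \<le> 1" using q1 by (auto simp: \<iota>_def)
  have lt: "\<alpha> < 1 - (2 - \<iota>) * s" using assms(8) by (simp add: \<iota>_def)
  obtain \<sigma> where \<sigma>: "0 \<le> \<sigma>" "\<sigma> < 1" "\<alpha> < 1 - (2 - \<iota>) * \<sigma>" "s < 1/2 \<Longrightarrow> \<sigma> < 1/2"
    "s = 0 \<Longrightarrow> \<sigma> = 0" "s \<noteq> 0 \<Longrightarrow> s < \<sigma>"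
  proof (cases "s = 0")
    case True
    then show thesis using that[of 0] lt by simp
  next
    case False
    \<comment> \<open>Everything below \<open>m\<close> satisfies the strict inequalities required of \<open>\<sigma>\<close>; the midpoint of \<open>s\<close> and \<open>m\<close> is one choice.\<close>
    define m where "m = min (if s < 1/2 then 1/2 else 1) ((1 - \<alpha>) / (2 - \<iota>))"
    have "1 * s \<le> (2 - \<iota>) * s" using \<iota> assms(6) by (intro mult_right_mono) auto
    then have "s < 1" using lt assms(4) by simp
    moreover have "s < (1 - \<alpha>) / (2 - \<iota>)" using lt \<iota> by (simp add: pos_less_divide_eq mult.commute)
    ultimately have sm: "s < m" by (simp add: m_def)
    define \<sigma> where "\<sigma> = (s + m) / 2"
    have s\<sigma>: "s < \<sigma>" "\<sigma> < m" using sm by (simp_all add: \<sigma>_def)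
    have "\<sigma> < (1 - \<alpha>) / (2 - \<iota>)" using s\<sigma>(2) by (simp add: m_def)
    then have "\<alpha> < 1 - (2 - \<iota>) * \<sigma>" using \<iota> by (simp add: pos_less_divide_eq mult.commute)
    moreover have "\<sigma> < 1" "s < 1/2 \<Longrightarrow> \<sigma> < 1/2" using s\<sigma>(2) by (auto simp: m_def split: if_splits)
    ultimately show thesis using that[of \<sigma>] s\<sigma>(1) assms(6) False by simp
  qed
  obtain R where R: "0 < R" "\<Omega> \<subseteq> ball 0 R" using bounded_subset_ballD[OF \<Omega>(2), of 0] by blast
  have Rc: "\<Omega> \<subseteq> {x. \<forall>i. \<bar>x $ i\<bar> \<le> R}"
  proof (intro subsetI CollectI allI)
    fix x i assume "x \<in> \<Omega>"
    then have "norm x < R" using R(2) by auto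
    then show "\<bar>x $ i\<bar> \<le> R" using component_le_norm_cart[of x i] by linarith
  qed
  \<comment> \<open>If \<open>\<Omega>\<close> is a null set, any positive number will do, since \<open>\<Omega> - \<CC>\<close> is then a null set too.\<close>
  define e0 where "e0 = (if measure lebesgue \<Omega> = 0 then 1 else \<epsilon> * measure lebesgue \<Omega> / 2)"
  have e0: "0 < e0" using \<epsilon> by (simp add: e0_def zero_less_measure_iff)
  obtain \<delta> t0 C M L good D K where cc: "cube_construction \<delta> (gap t0 \<sigma>) C M L F good D"
    and t0: "0 < t0" and D: "compact D" "D \<subseteq> \<Omega>" and K: "K \<subseteq> \<Omega>" "K \<in> sets lebesgue" "emeasure lebesgue (\<Omega> - K) \<le> ennreal e0"
    and goodK: "\<And>x. x \<in> K \<Longrightarrow> good x" and bnd: "C * \<delta> * (M + 2 * L * real CARD('k) * (1 + M)) \<le> \<eta>"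
    "slab_const CARD('k) R 0 * (t0 * (\<Sum>n. 1 / real (Suc n) ^ 2)) \<le> e0"
    by (rule exists_construction[OF \<eta> e0 \<Omega> F less_imp_le[OF R(1)] \<sigma>(1,2)]) blast
  interpret cube_construction \<delta> "gap t0 \<sigma>" C M L F good D by (rule cc)
  note R0 = less_imp_le[OF R(1)]
  note \<Omega>L = \<Omega>_lebesgue[OF \<Omega> Rc R0]
  interpret fin: finite_measure "lebesgue_on \<Omega>"
    by (intro finite_measure_lebesgue_on bounded_set_imp_lmeasurable \<Omega> \<Omega>L)
  have CD: "\<CC> \<subseteq> D" using good_D(1) by (auto simp: \<CC>_def)
  have Ccomp: "compact \<CC>"
    using closed_\<CC> CD D(1) bounded_subset compact_eq_bounded_closed by blast
  have Csub: "\<CC> \<subseteq> \<Omega>" using CD D(2) by blast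
  have u_le: "norm (u x) \<le> \<eta>" for x
    using norm_u_le[of x] bnd(1) unfolding slope_const_def by linarith
  have um: "u \<in> borel_measurable borel"
  proof -
    have [measurable]: "w n \<in> borel_measurable borel" for n
      by (intro borel_measurable_continuous_onI has_derivative_continuous_on[OF has_derivative_at_withinI[OF w_derivative]])
    show ?thesis unfolding u_def[abs_def] by measurable
  qed
  have supp: "supp_on \<Omega> u \<subseteq> D"
    unfolding supp_on_def
  proof (rule closure_minimal[OF _ compact_imp_closed[OF D(1)]], rule subsetI)
    fix x assume "x \<in> {x \<in> \<Omega>. u x \<noteq> 0}"
    then have "u x \<noteq> 0" by simp
    have "good x"
    proof (rule ccontr)
      assume "\<not> good x"
      then have "w n x = 0" for n using not_good by blast
      then show False using \<open>u x \<noteq> 0\<close> by (simp add: u_def)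
    qed
    then show "x \<in> D" by (rule good_D(1))
  qed
  obtain \<beta> where \<beta>': "\<alpha> < \<beta>" "\<beta> < 1 - (2 - \<iota>) * \<sigma>" using dense[OF \<sigma>(3)] by blast
  then have \<beta>: "0 < \<beta>" "\<alpha> < \<beta>" "\<beta> < 1 - (2 - \<iota>) * \<sigma>" using assms(4) by linarith+
  have "0 \<le> (2 - \<iota>) * \<sigma>" using \<iota> \<sigma>(1) by simp
  then have \<beta>1: "\<beta> \<le> 1" using \<beta>(3) by linarith
  \<comment> \<open>For \<open>q = \<infinity>\<close> the series is also controlled in \<open>L\<^sup>1\<close>, which gives the weak gradient in both cases.\<close>
  define p where "p = (if q = \<infinity> then 1 else enn2real q)"
  have p: "1 \<le> p" using q1 by (simp add: p_def)
  obtain K' \<theta> where \<theta>: "0 < \<theta>" "\<theta> < 1" and r: "\<And>n. rate \<beta> \<iota> n \<le> K' * \<theta> ^ (2 * n)"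
    by (rule rate_le_geometric[OF t0 \<sigma>(1,2) refl \<beta>(1) \<iota>(2) \<beta>(3)]) blast
  have rp: "rate \<beta> (1 / p) n \<le> K' * \<theta> ^ (2 * n)" for n
  proof -
    have "gap t0 \<sigma> n powr (1 / p - 1) \<le> gap t0 \<sigma> n powr (\<iota> - 1)"
      using t(1)[of n] t(2)[of n] \<iota>(2) by (intro powr_mono') (auto simp: p_def \<iota>_def)
    then have "rate \<beta> (1 / p) n \<le> rate \<beta> \<iota> n"
      unfolding rate_def using d_pos[of n] by (intro mult_left_mono) auto
    with r[of n] show ?thesis by simp
  qed
  note grad = gradient_series[OF \<Omega> Rc R0 p \<beta>(1) \<beta>1 \<theta> rp]
  have weak: "weak_gradient \<Omega> u Du"
    by (rule weak_gradient_u[OF \<Omega> Rc R0 D grad(1,2)])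
  have hol: "\<exists>B. (\<forall>x. norm (Du x) \<le> B) \<and> (\<forall>x y. norm (Du x - Du y) \<le> B * norm (x - y) powr \<gamma>) \<and>
      (\<forall>x. (u has_derivative (\<lambda>h. h v* Du x)) (at x))" if "0 < \<gamma>" "\<gamma> < 1 - 2 * \<sigma>" for \<gamma>
  proof -
    have "\<gamma> \<le> 1" using that \<sigma>(1) by linarith
    then show ?thesis
      by (rule holder_gradient[OF that(1) _ rate_summable[OF t0 \<sigma>(1,2) refl that]]) blast
  qed
  have Dum: "Du \<in> borel_measurable borel"
  proof -
    have [measurable]: "f n \<in> borel_measurable borel" for n by (rule f_measurable)
    show ?thesis unfolding Du_def[abs_def] by measurable
  qed
  have DuLp: "Du \<in> Lp_space q \<Omega>"
  proof (cases "q = \<infinity>")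
    case True
    then have "\<beta> < 1 - 2 * \<sigma>" using \<beta>(3) by (simp add: \<iota>_def)
    then obtain B where "\<And>x. norm (Du x) \<le> B" using hol[OF \<beta>(1)] by blast
    then show ?thesis by (rule Lp_space_bounded(2)[OF \<Omega>L \<Omega>(2) Dum])
  next
    case False
    then show ?thesis using grad(3) qe by (simp add: p_def)
  qed
  have Dufrac: "Du \<in> frac_sobolev \<alpha> q \<Omega>"
  proof (cases "\<alpha> = 0")
    case True
    then show ?thesis using DuLp by (simp add: frac_sobolev_def)
  next
    case \<alpha>: False
    show ?thesis
    proof (cases "q = \<infinity>")
      case True
      then have "\<alpha> < 1 - 2 * \<sigma>" "0 < \<alpha>" using \<sigma>(3) \<alpha> assms(4) by (simp_all add: \<iota>_def)
      then obtain B where B: "\<And>x. norm (Du x) \<le> B" "\<And>x y. norm (Du x - Du y) \<le> B * norm (x - y) powr \<alpha>"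
        using hol[of \<alpha>] by blast
      have "bounded (Du ` \<Omega>)" using B(1) by (auto simp: bounded_iff)
      then have "Du \<in> holder_space \<alpha> \<Omega>"
        unfolding holder_space_def dist_norm using B(2) by blast
      then show ?thesis using True \<alpha> by (simp add: frac_sobolev_def)
    next
      case False
      then show ?thesis using \<alpha> DuLp grad(4)[OF \<beta>(2)] by (simp add: frac_sobolev_def p_def)
    qed
  qed
  have ind: "indicat_real \<CC> \<in> frac_sobolev s 1 \<Omega>"
  proof -
    have "indicat_real \<CC> \<in> borel_measurable borel"
      using borel_closed[OF closed_\<CC>] by (rule borel_measurable_indicator)
    then have "indicat_real \<CC> \<in> Lp_space 1 \<Omega>"
      by (rule Lp_space_bounded(2)[OF \<Omega>L \<Omega>(2), where B = 1]) simp
    moreover have "gagliardo s 1 \<Omega> (indicat_real \<CC>) < \<infinity>" if "s \<noteq> 0"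
      by (rule gagliardo_indicator_\<CC>[OF \<Omega>L \<Omega>(2) Rc R0 \<sigma>(6)[OF that] \<sigma>(1,2) gap_summable[OF t0 \<sigma>(1,2) refl]])
    ultimately show ?thesis by (simp add: frac_sobolev_def)
  qed
  have meas: "measure lebesgue (\<Omega> - \<CC>) \<le> \<epsilon> * measure lebesgue \<Omega>"
  proof -
    have EL: "E n \<in> sets lebesgue" for n using open_E by (simp add: borel_open)
    have EL2: "\<Omega> \<inter> E n \<in> sets lebesgue" for n using \<Omega>L EL by auto
    have eE: "emeasure lebesgue (\<Omega> \<inter> E n) \<le> ennreal (slab_const CARD('k) R 0 * (t0 * (1 / real (Suc n) ^ 2)))" for n
    proof -
      have "emeasure lebesgue (\<Omega> \<inter> E n) = (\<integral>\<^sup>+x. indicator (E n) x \<partial>lebesgue_on \<Omega>)"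
      proof -
        have "(\<integral>\<^sup>+x. indicator (E n) x \<partial>lebesgue_on \<Omega>) = (\<integral>\<^sup>+x. indicator (E n) x * indicator \<Omega> x \<partial>lebesgue)"
          using \<Omega>L by (intro nn_integral_restrict_space) auto
        also have "\<dots> = (\<integral>\<^sup>+x. indicator (\<Omega> \<inter> E n) x \<partial>lebesgue)"
          by (intro nn_integral_cong) (auto simp: indicator_def)
        also have "\<dots> = emeasure lebesgue (\<Omega> \<inter> E n)" by (rule nn_integral_indicator[OF EL2])
        finally show ?thesis ..
      qed
      also have "\<dots> \<le> ennreal (slab_const CARD('k) R 0 * gap t0 \<sigma> n)"
        by (rule nn_integral_E_le[OF \<Omega>L \<Omega>(2) Rc R0])
      also have "\<dots> \<le> ennreal (slab_const CARD('k) R 0 * (t0 * (1 / real (Suc n) ^ 2)))"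
        using slab_const_nonneg[OF R0, of 0 "CARD('k)"] gap_bounds(2)[OF t0 \<sigma>(1,2), of n]
        by (intro ennreal_leI mult_left_mono) auto
      finally show ?thesis .
    qed
    have "\<Omega> - \<CC> \<subseteq> (\<Omega> - K) \<union> (\<Union>n. \<Omega> \<inter> E n)" using goodK by (auto simp: \<CC>_def)
    moreover have U: "(\<Union>n. \<Omega> \<inter> E n) \<in> sets lebesgue" by (rule sets.countable_UN) (use EL2 in auto)
    ultimately have "emeasure lebesgue (\<Omega> - \<CC>) \<le> emeasure lebesgue ((\<Omega> - K) \<union> (\<Union>n. \<Omega> \<inter> E n))"
      by (intro emeasure_mono sets.Un sets.Diff \<Omega>L K(2))
    also have "\<dots> \<le> emeasure lebesgue (\<Omega> - K) + emeasure lebesgue (\<Union>n. \<Omega> \<inter> E n)"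
      by (intro emeasure_subadditive sets.Diff \<Omega>L K(2) U)
    also have "\<dots> \<le> ennreal e0 + ennreal e0"
    proof (rule add_mono[OF K(3)])
      have "emeasure lebesgue (\<Union>n. \<Omega> \<inter> E n) \<le> (\<Sum>n. emeasure lebesgue (\<Omega> \<inter> E n))"
        using EL2 by (intro emeasure_subadditive_countably) auto
      also have "\<dots> \<le> (\<Sum>n. ennreal (slab_const CARD('k) R 0 * (t0 * (1 / real (Suc n) ^ 2))))"
        by (intro suminf_le eE summableI)
      also have "\<dots> = ennreal (slab_const CARD('k) R 0 * (t0 * (\<Sum>n. 1 / real (Suc n) ^ 2)))"
        using slab_const_nonneg[OF R0, of 0 "CARD('k)"] t0
        by (intro suminf_ennreal_eq sums_mult summable_sums summable_inverse_squares) auto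
      also have "\<dots> \<le> ennreal e0" by (rule ennreal_leI[OF bnd(2)])
      finally show "emeasure lebesgue (\<Union>n. \<Omega> \<inter> E n) \<le> ennreal e0" .
    qed
    also have "\<dots> = ennreal (2 * e0)" using e0 by (subst ennreal_plus[symmetric]) auto
    finally have le: "emeasure lebesgue (\<Omega> - \<CC>) \<le> ennreal (2 * e0)" .
    then have m: "measure lebesgue (\<Omega> - \<CC>) \<le> 2 * e0"
      using e0 by (simp add: measure_def enn2real_leI)
    show ?thesis
    proof (cases "measure lebesgue \<Omega> = 0")
      case True
      have "measure lebesgue (\<Omega> - \<CC>) \<le> measure lebesgue \<Omega>"
        by (intro measure_mono_fmeasurable bounded_set_imp_lmeasurable \<Omega> \<Omega>L)
          (use \<Omega>L borel_closed[OF closed_\<CC>] in auto)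
      then show ?thesis using True by simp
    next
      case False
      then show ?thesis using m by (simp add: e0_def)
    qed
  qed
  have C1: "u \<in> C1c_on \<Omega> \<and> (\<forall>x\<in>\<CC>. has_gradient u (F (x, u x)) x)" if "s < 1/2"
  proof -
    \<comment> \<open>Any Hoelder exponent below \<open>1 - 2 * \<sigma>\<close> shows that the gradient is continuous.\<close>
    define \<gamma> where "\<gamma> = (1 - 2 * \<sigma>) / 2"
    have \<gamma>: "0 < \<gamma>" "\<gamma> < 1 - 2 * \<sigma>" using \<sigma>(4)[OF that] by (simp_all add: \<gamma>_def)
    then obtain B where B: "\<And>x. norm (Du x) \<le> B" "\<And>x y. norm (Du x - Du y) \<le> B * norm (x - y) powr \<gamma>"
      "\<And>x. (u has_derivative (\<lambda>h. h v* Du x)) (at x)" using hol by blast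
    have "u \<in> C1_on \<Omega>" by (rule C1_holderI(2)[OF B(3) \<gamma>(1) B(1,2) u_le])
    moreover have "closed (supp_on \<Omega> u)" by (simp add: supp_on_def)
    then have "compact (supp_on \<Omega> u)"
      using bounded_subset[OF compact_imp_bounded[OF D(1)] supp] by (simp add: compact_eq_bounded_closed)
    moreover have "has_gradient u (F (x, u x)) x" if "x \<in> \<CC>" for x
      using B(3)[of x] Du_on_\<CC>[OF that] by (simp add: has_gradient_def)
    ultimately show ?thesis using supp D(2) by (auto simp: C1c_on_def)
  qed
  have C1h: "u \<in> (\<Inter>\<beta>\<in>{0<..<1}. C1_holder \<beta> \<Omega>)" if "s = 0"
  proof
    fix \<gamma> :: real assume "\<gamma> \<in> {0<..<1}"
    then have \<gamma>: "0 < \<gamma>" "\<gamma> < 1 - 2 * \<sigma>" using \<sigma>(5)[OF that] by auto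
    then obtain B where B: "\<And>x. norm (Du x) \<le> B" "\<And>x y. norm (Du x - Du y) \<le> B * norm (x - y) powr \<gamma>"
      "\<And>x. (u has_derivative (\<lambda>h. h v* Du x)) (at x)" using hol by blast
    show "u \<in> C1_holder \<gamma> \<Omega>" by (rule C1_holderI(1)[OF B(3) \<gamma>(1) B(1,2) u_le])
  qed
  have "AE x in lebesgue_on \<CC>. Du x = F (x, u x)"
    by (rule AE_I2) (simp add: Du_on_\<CC>)
  moreover have "u \<in> sobolev1 q \<Omega>"
    unfolding sobolev1_def using Lp_space_bounded(2)[OF \<Omega>L \<Omega>(2) um u_le] DuLp weak by blast
  ultimately show ?thesis
    using Ccomp Csub weak order_trans[OF supp D(2)] Lp_space_bounded[OF \<Omega>L \<Omega>(2) um u_le] meas ind Dufrac C1 C1h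
    by (intro exI[of _ \<CC>] exI[of _ u] exI[of _ Du]) blast
qed

end
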